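(* Let $\hbar\ge0$. Then there exists a faithful (i.e. injective) continuous representation of the Fréchet $*$-algebra $(\mathcal{A}(D_n),\star_\hbar,{}^* )$.
   Context: Fix $n\ge1$; multi-index conventions $|P|=\sum P_i$, $P!=\prod P_i!$, $\binom PT=\prod\binom{P_i}{T_i}$, componentwise $\le,\min$. $D_n=Z/U(1)$, $Z=\{r\in\mathbb{C}^{1+n}:-|r^0|^2+\sum_{i\ge1}|r^i|^2=-1\}$. $\hat D_n=\hat Z/\mathbb{C}^*$, $\hat Z=\{(p,q):-p^0q^0+\sum_{i\ge1}p^iq^i=-1\}$, $z\cdot(p,q)=(zp,q/z)$; $\Delta_D([r])=[r,\bar r]$. $\mathcal{A}(D_n)=\{\hat a\circ\Delta_D:\hat a\in\mathcal{O}(\hat D_n)\}$ with Fréchet seminorms $\|a\|_{D_n,K}=\sup_K|\hat a|$ and involution $a^*=\bar a$ (pointwise complex conjugation). $f_{P,Q}([r])=r^P\bar r^Q$ ($P,Q\in\mathbb{N}_0^{1+n}$, $|P|=|Q|$); $\mathcal{P}(D_n)$ their span, dense in $\mathcal{A}(D_n)$. $\star_0$ is the pointwise product. For $\hbar>0$, with $(z)_m=\prod_{k=0}^{m-1}(z+k)$, $\star_\hbar$ is the associative product on $\mathcal{P}(D_n)$ given by $f_{P,Q}\star_\hbar f_{R,S}=\sum_{T\in\mathbb{N}_0^{1+n},T\le\min\{P,S\}}(-1)^{T_0}\frac{(\frac1{2\hbar})_{|P+S-T|}T!}{(\frac1{2\hbar})_{|P|}(\frac1{2\hbar})_{|S|}}\binom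 PT\binom ST f_{P+R-T,Q+S-T}$ (reduced Wick product), extended (as is known) continuously to $\mathcal{A}(D_n)$; for real $\hbar$ this is a Fréchet $*$-algebra with involution $^*$. A continuous representation of $(\mathcal{A}(D_n),\star_\hbar,{}^* )$ is a pair $(\mathcal{H},\pi)$ of a pre-Hilbert space $\mathcal{H}$ and a unital $*$-homomorphism $\pi:\mathcal{A}(D_n)\to\mathcal{L}^*(\mathcal{H})$ that is continuous for the weak topology on $\mathcal{L}^*(\mathcal{H})$ (seminorms $A\mapsto|\langle\phi|A\psi\rangle|$, $\phi,\psi\in\mathcal{H}$); here $\mathcal{L}^*(\mathcal{H})$ is the $*$-algebra of all linear maps $A:\mathcal{H}\to\mathcal{H}$ admitting a linear $A^*:\mathcal{H}\to\mathcal{H}$ with $\langle\phi|A\psi\rangle=\langle A^*\phi|\psi\rangle$ for all $\phi,\psi$. *)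

theory Defs
  imports "HOL-Analysis.Analysis"
begin

text \<open>Coordinates: index set {0,...,n} is rendered as the finite type 'n option,
  with None playing the role of the index 0 and Some i (i :: 'n) the indices 1..n,
  so n = CARD('n) \<ge> 1.\<close>

type_synonym 'n pt = "complex ^ 'n option"
type_synonym 'n mi = "'n option \<Rightarrow> nat"

definition Zset :: "('n::finite) pt set" where
  "Zset = {r. - (cmod (r $ None))\<^sup>2 + (\<Sum>i\<in>UNIV. (cmod (r $ Some i))\<^sup>2) = -1}"

definition Zhat :: "(('n::finite) pt \<times> 'n pt) set" where
  "Zhat = {(p,q). - (p $ None * q $ None) + (\<Sum>i\<in>UNIV. p $ Some i * q $ Some i) = -1}"

definition conjv :: "('n::finite) pt \<Rightarrow> 'n pt" where
  "conjv r = (\<chi> i. cnj (r $ i))"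

definition DeltaD :: "('n::finite) pt \<Rightarrow> 'n pt \<times> 'n pt" where
  "DeltaD r = (r, conjv r)"

definition csc :: "complex \<Rightarrow> ('n::finite) pt \<Rightarrow> 'n pt" where
  "csc c p = (\<chi> i. c * p $ i)"

text \<open>Holomorphic functions on the complex submanifold Zhat of C^(2+2n): locally
  restrictions of holomorphic functions (complex-linear Frechet derivative) on open sets.\<close>
definition holo_Zhat :: "(('n::finite) pt \<times> 'n pt \<Rightarrow> complex) \<Rightarrow> bool" where
  "holo_Zhat F \<longleftrightarrow> (\<forall>z\<in>Zhat. \<exists>U G. open U \<and> z \<in> U \<and>
      (\<forall>w\<in>U. \<exists>D. (G has_derivative D) (at w) \<and>
          (\<forall>c v. D (csc c (fst v), csc c (snd v)) = c * D v)) \<and>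
      (\<forall>w\<in>U \<inter> Zhat. G w = F w))"

definition cstar_inv :: "(('n::finite) pt \<times> 'n pt \<Rightarrow> complex) \<Rightarrow> bool" where
  "cstar_inv F \<longleftrightarrow> (\<forall>z p q. z \<noteq> 0 \<and> (p,q) \<in> Zhat \<longrightarrow> F (csc z p, csc (1/z) q) = F (p,q))"

text \<open>O(hat D_n), realised as C^*-invariant holomorphic functions on hat Z.\<close>
definition hol_Dhat :: "(('n::finite) pt \<times> 'n pt \<Rightarrow> complex) \<Rightarrow> bool" where
  "hol_Dhat F \<longleftrightarrow> holo_Zhat F \<and> cstar_inv F"

text \<open>A(D_n): functions on D_n, realised as (U(1)-invariant) functions on Z, set to 0 off Z.\<close>
definition Adn :: "(('n::finite) pt \<Rightarrow> complex) set" where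
  "Adn = {a. \<exists>F. hol_Dhat F \<and> a = (\<lambda>r. if r \<in> Zset then F (DeltaD r) else 0)}"

text \<open>The (unique) holomorphic extension hat a of a, normalised to be 0 off hat Z.\<close>
definition lift :: "(('n::finite) pt \<Rightarrow> complex) \<Rightarrow> ('n pt \<times> 'n pt \<Rightarrow> complex)" where
  "lift a = (THE F. hol_Dhat F \<and> (\<forall>w. w \<notin> Zhat \<longrightarrow> F w = 0) \<and> (\<forall>r\<in>Zset. a r = F (DeltaD r)))"

text \<open>Seminorm ||a||_K = sup_K |hat a| for compact K (taken in hat Z; compacts of hat D_n are
  images of compacts of hat Z and hat a is invariant).\<close>
definition snorm :: "(('n::finite) pt \<times> 'n pt) set \<Rightarrow> ('n pt \<Rightarrow> complex) \<Rightarrow> real" where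
  "snorm K a = (if K = {} then 0 else (SUP w\<in>K. cmod (lift a w)))"

definition conv_A :: "(nat \<Rightarrow> ('n::finite) pt \<Rightarrow> complex) \<Rightarrow> ('n pt \<Rightarrow> complex) \<Rightarrow> bool" where
  "conv_A s a \<longleftrightarrow> (\<forall>K. compact K \<and> K \<subseteq> Zhat \<longrightarrow>
      (\<lambda>k. snorm K (\<lambda>r. s k r - a r)) \<longlonglongrightarrow> 0)"

definition mabs :: "('n::finite) mi \<Rightarrow> nat" where "mabs P = (\<Sum>i\<in>UNIV. P i)"
definition mfact :: "('n::finite) mi \<Rightarrow> nat" where "mfact P = (\<Prod>i\<in>UNIV. fact (P i))"
definition mbinom :: "('n::finite) mi \<Rightarrow> 'n mi \<Rightarrow> nat" where
  "mbinom P T = (\<Prod>i\<in>UNIV. P i choose T i)"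
definition mpow :: "('n::finite) pt \<Rightarrow> 'n mi \<Rightarrow> complex" where
  "mpow r P = (\<Prod>i\<in>UNIV. (r $ i) ^ (P i))"

definition fPQ :: "('n::finite) mi \<Rightarrow> 'n mi \<Rightarrow> 'n pt \<Rightarrow> complex" where
  "fPQ P Q = (\<lambda>r. if r \<in> Zset then mpow r P * mpow (conjv r) Q else 0)"

definition valid_coef :: "(('n::finite) mi \<times> 'n mi \<Rightarrow> complex) \<Rightarrow> bool" where
  "valid_coef c \<longleftrightarrow> finite {x. c x \<noteq> 0} \<and> (\<forall>P Q. c (P,Q) \<noteq> 0 \<longrightarrow> mabs P = mabs Q)"

definition poly_of :: "(('n::finite) mi \<times> 'n mi \<Rightarrow> complex) \<Rightarrow> 'n pt \<Rightarrow> complex" where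
  "poly_of c = (\<lambda>r. \<Sum>x\<in>{x. c x \<noteq> 0}. c x * fPQ (fst x) (snd x) r)"

definition wick_basis :: "real \<Rightarrow> ('n::finite) mi \<Rightarrow> 'n mi \<Rightarrow> 'n mi \<Rightarrow> 'n mi \<Rightarrow> 'n pt \<Rightarrow> complex" where
  "wick_basis h P Q R S = (\<lambda>r. \<Sum>T\<in>{T. \<forall>i. T i \<le> min (P i) (S i)}.
      (-1) ^ (T None) *
      complex_of_real (pochhammer (1 / (2*h)) (mabs (\<lambda>i. P i + S i - T i)) * real (mfact T)
        / (pochhammer (1 / (2*h)) (mabs P) * pochhammer (1 / (2*h)) (mabs S))) *
      of_nat (mbinom P T * mbinom S T) *
      fPQ (\<lambda>i. P i + R i - T i) (\<lambda>i. Q i + S i - T i) r)"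

definition pstar :: "real \<Rightarrow> (('n::finite) mi \<times> 'n mi \<Rightarrow> complex) \<Rightarrow> ('n mi \<times> 'n mi \<Rightarrow> complex)
    \<Rightarrow> 'n pt \<Rightarrow> complex" where
  "pstar h c d = (\<lambda>r. \<Sum>x\<in>{x. c x \<noteq> 0}. \<Sum>y\<in>{y. d y \<noteq> 0}.
      c x * d y * wick_basis h (fst x) (snd x) (fst y) (snd y) r)"

text \<open>star_hbar on A(D_n): pointwise product for hbar = 0; for hbar > 0 the continuous
  extension of the reduced Wick product from the dense subalgebra P(D_n).\<close>
definition star_h :: "real \<Rightarrow> (('n::finite) pt \<Rightarrow> complex) \<Rightarrow> ('n pt \<Rightarrow> complex) \<Rightarrow> ('n pt \<Rightarrow> complex)" where
  "star_h h a b = (if h = 0 then (\<lambda>r. a r * b r) else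
     (THE e. e \<in> Adn \<and> (\<forall>cs ds. (\<forall>k. valid_coef (cs k)) \<and> (\<forall>k. valid_coef (ds k)) \<and>
        conv_A (\<lambda>k. poly_of (cs k)) a \<and> conv_A (\<lambda>k. poly_of (ds k)) b \<longrightarrow>
        conv_A (\<lambda>k. pstar h (cs k) (ds k)) e)))"

definition invol :: "(('n::finite) pt \<Rightarrow> complex) \<Rightarrow> ('n pt \<Rightarrow> complex)" where
  "invol a = (\<lambda>r. cnj (a r))"

definition unitA :: "('n::finite) pt \<Rightarrow> complex" where
  "unitA = (\<lambda>r. if r \<in> Zset then 1 else 0)"

text \<open>Pre-Hilbert spaces: a complex linear subspace V of the vector space nat => complex
  equipped with an inner product (antilinear in the first slot).\<close>
type_synonym vec = "nat \<Rightarrow> complex"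

definition vadd :: "vec \<Rightarrow> vec \<Rightarrow> vec" where "vadd f g = (\<lambda>n. f n + g n)"
definition vscale :: "complex \<Rightarrow> vec \<Rightarrow> vec" where "vscale c f = (\<lambda>n. c * f n)"

definition pre_hilbert :: "vec set \<Rightarrow> (vec \<Rightarrow> vec \<Rightarrow> complex) \<Rightarrow> bool" where
  "pre_hilbert V ip \<longleftrightarrow> (\<lambda>n. 0) \<in> V \<and>
     (\<forall>f\<in>V. \<forall>g\<in>V. vadd f g \<in> V) \<and> (\<forall>c. \<forall>f\<in>V. vscale c f \<in> V) \<and>
     (\<forall>f\<in>V. \<forall>g\<in>V. \<forall>h\<in>V. ip f (vadd g h) = ip f g + ip f h) \<and>
     (\<forall>c. \<forall>f\<in>V. \<forall>g\<in>V. ip f (vscale c g) = c * ip f g) \<and>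
     (\<forall>f\<in>V. \<forall>g\<in>V. ip f g = cnj (ip g f)) \<and>
     (\<forall>f\<in>V. Re (ip f f) \<ge> 0) \<and>
     (\<forall>f\<in>V. ip f f = 0 \<longrightarrow> f = (\<lambda>n. 0))"

definition lin_on :: "vec set \<Rightarrow> (vec \<Rightarrow> vec) \<Rightarrow> bool" where
  "lin_on V T \<longleftrightarrow> (\<forall>f\<in>V. T f \<in> V) \<and>
     (\<forall>f\<in>V. \<forall>g\<in>V. T (vadd f g) = vadd (T f) (T g)) \<and>
     (\<forall>c. \<forall>f\<in>V. T (vscale c f) = vscale c (T f))"

definition adjointable :: "vec set \<Rightarrow> (vec \<Rightarrow> vec \<Rightarrow> complex) \<Rightarrow> (vec \<Rightarrow> vec) \<Rightarrow> bool" where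
  "adjointable V ip T \<longleftrightarrow> lin_on V T \<and>
     (\<exists>B. lin_on V B \<and> (\<forall>f\<in>V. \<forall>g\<in>V. ip f (T g) = ip (B f) g))"

text \<open>Continuous representations of (A(D_n), star_hbar, *).  Continuity for the weak
  topology: each functional a |-> <phi|rho(a) psi> is continuous on the Frechet space,
  i.e. bounded by a constant times one of the defining seminorms.\<close>
definition cont_rep :: "real \<Rightarrow> vec set \<Rightarrow> (vec \<Rightarrow> vec \<Rightarrow> complex)
    \<Rightarrow> ((('n::finite) pt \<Rightarrow> complex) \<Rightarrow> vec \<Rightarrow> vec) \<Rightarrow> bool" where
  "cont_rep h V ip rho \<longleftrightarrow> pre_hilbert V ip \<and>
     (\<forall>a\<in>Adn. adjointable V ip (rho a)) \<and>
     (\<forall>a\<in>Adn. \<forall>b\<in>Adn. \<forall>f\<in>V. rho (\<lambda>r. a r + b r) f = vadd (rho a f) (rho b f)) \<and>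
     (\<forall>c. \<forall>a\<in>Adn. \<forall>f\<in>V. rho (\<lambda>r. c * a r) f = vscale c (rho a f)) \<and>
     (\<forall>f\<in>V. rho unitA f = f) \<and>
     (\<forall>a\<in>Adn. \<forall>b\<in>Adn. \<forall>f\<in>V. rho (star_h h a b) f = rho a (rho b f)) \<and>
     (\<forall>a\<in>Adn. \<forall>f\<in>V. \<forall>g\<in>V. ip f (rho (invol a) g) = ip (rho a f) g) \<and>
     (\<forall>f\<in>V. \<forall>g\<in>V. \<exists>K C. compact K \<and> K \<subseteq> Zhat \<and>
         (\<forall>a\<in>Adn. cmod (ip f (rho a g)) \<le> C * snorm K a))"

definition faithful_rep :: "vec set \<Rightarrow> ((('n::finite) pt \<Rightarrow> complex) \<Rightarrow> vec \<Rightarrow> vec) \<Rightarrow> bool" where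
  "faithful_rep V rho \<longleftrightarrow> (\<forall>a\<in>Adn. \<forall>b\<in>Adn. (\<forall>f\<in>V. rho a f = rho b f) \<longrightarrow> a = b)"

end

theory Submission
  imports Defs "HOL-Complex_Analysis.Complex_Analysis"
begin

text \<open>
  For \<open>\<hbar> = 0\<close> the algebra acts by multiplication on finitely supported functions on a countable
  dense subset of the disc.

  For \<open>\<hbar> > 0\<close> put \<open>l = 1/(2\<hbar>)\<close>. The two entire charts \<open>(u,v) \<mapsto> ((1,u),(1+uv,v))\<close> and
  \<open>(u,v) \<mapsto> ((1+uv,u),(1,v))\<close> of \<open>Zhat\<close> show, by Cauchy estimates, that every element of the algebra
  is a series \<open>\<Sum> a_{PQ} f_{P,Q}\<close> over the reduced pairs \<open>min(P_0,Q_0) = 0\<close>, with coefficients that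
  decrease faster than every geometric sequence and depend continuously on the element. The
  evaluation at the origin is a positive functional, and its GNS representation acts on the
  entire functions on \<open>C^n\<close>, with \<open>|e_J|^2 = J!/(l)_{|J|}\<close>, by
  \<open>f_{P,Q} e_J = (l)_{P_0+|J|} / ((l)_{|P|} (l)_{|J|}) J!/(J-P)! e_{J-P+Q}\<close>. These operators
  respect the relation of \<open>Zhat\<close>, and Chu-Vandermonde turns their composition into the reduced Wick
  product. The matrix of an element depends on its reduced coefficients in a triangular way, so
  the representation is faithful; this injectivity also shows that the product of polynomials
  depends only on the polynomials as functions, which yields its continuous extension.
\<close>


text \<open>In the chart p_0 = 1 the function q_0 becomes 1 + uv, so only the reduced monomials free
  of q_0 can be read off there as Taylor coefficients; the others are monomials in the chart q_0 =
  1. One chart does not suffice, and the two expansions have to be glued.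

  The product formula is bilinear in formal coefficient families, but p_0 q_0 = 1 + \<Sum> p_j q_j
  makes the f_{P,Q} linearly dependent. The formula is never compared with this relation directly:
  matrix elements are defined on functions through reduced coefficients, and the much simpler action
  on e_J is checked against the relation instead.

  Positivity holds for every \<hbar> > 0 because it only needs (l)_k > 0. The operators are
  unbounded: for P = Q = (1,0,...,0) the vector e_J is multiplied by (l + |J|)/l. Moreover an
  infinite series can spread e_0 over infinitely many e_M, so finite sequences are not invariant.
  Entire functions are: their coefficients absorb the geometric growth of the matrix in J, and each
  column decreases fast enough to be entire again.\<close>

section \<open>Geometric series over multi-indices, and Taylor coefficients in one variable\<close>

lemma geometric_multiindex_summable:
  fixes q :: real
  assumes "0 \<le> q" "q < 1"
  shows "(\<lambda>\<alpha>::'i::finite \<Rightarrow> nat. q ^ sum \<alpha> UNIV) summable_on UNIV"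
proof (rule nonneg_bounded_partial_sums_imp_summable_on)
  show "\<forall>\<^sub>F X in finite_subsets_at_top (UNIV :: ('i \<Rightarrow> nat) set).
    (\<Sum>\<alpha>\<in>X. q ^ sum \<alpha> UNIV) \<le> (1 / (1 - q)) ^ card (UNIV :: 'i set)"
  proof (rule eventually_finite_subsets_at_top_weakI)
    fix X :: "('i \<Rightarrow> nat) set"
    assume X: "finite X"
    \<comment> \<open>A finite set of multi-indices lies in the box of entries at most N, over which
      the sum factors into truncated geometric series.\<close>
    define N where "N = Max (insert 0 ((\<lambda>\<alpha>. sum \<alpha> UNIV) ` X))"
    have N: "\<alpha> i \<le> N" if "\<alpha> \<in> X" for \<alpha> i
    proof -
      have "\<alpha> i \<le> sum \<alpha> UNIV" by (rule member_le_sum) auto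
      also have "\<dots> \<le> N" unfolding N_def using X that by (intro Max_ge) auto
      finally show ?thesis .
    qed
    have "(\<Sum>\<alpha>\<in>X. q ^ sum \<alpha> UNIV) \<le> (\<Sum>\<alpha>\<in>PiE (UNIV::'i set) (\<lambda>_. {..N}). q ^ sum \<alpha> UNIV)"
    proof (rule sum_mono2)
      show "finite (PiE (UNIV::'i set) (\<lambda>_. {..N}))" by (intro finite_PiE) auto
      show "X \<subseteq> PiE UNIV (\<lambda>_. {..N})" using N by auto
    qed (use assms in auto)
    also have "\<dots> = (\<Sum>\<alpha>\<in>PiE (UNIV::'i set) (\<lambda>_. {..N}). \<Prod>i\<in>UNIV. q ^ \<alpha> i)"
      by (simp add: power_sum)
    also have "\<dots> = (\<Prod>i\<in>(UNIV::'i set). \<Sum>k\<in>{..N}. q ^ k)"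
      by (rule prod_sum_PiE [symmetric]) auto
    also have "\<dots> \<le> (\<Prod>i\<in>(UNIV::'i set). 1 / (1 - q))"
    proof (rule prod_mono, rule conjI)
      fix i :: 'i
      show "0 \<le> (\<Sum>k\<in>{..N}. q ^ k)" using assms by (intro sum_nonneg) auto
      have "(\<Sum>k\<in>{..N}. q ^ k) = (\<Sum>k<Suc N. q ^ k)" by (simp add: lessThan_Suc_atMost)
      also have "\<dots> \<le> (\<Sum>k. q ^ k)"
        using assms by (intro sum_le_suminf summable_geometric) auto
      also have "\<dots> = 1 / (1 - q)" using assms by (intro suminf_geometric) auto
      finally show "(\<Sum>k\<in>{..N}. q ^ k) \<le> 1 / (1 - q)" .
    qed
    finally show "(\<Sum>\<alpha>\<in>X. q ^ sum \<alpha> UNIV) \<le> (1 / (1 - q)) ^ card (UNIV :: 'i set)"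
      by simp
  qed
qed (use assms in auto)

definition tcoef :: "(complex \<Rightarrow> complex) \<Rightarrow> nat \<Rightarrow> complex" where
  "tcoef f k = (deriv ^^ k) f 0 / fact k"

lemma tcoef_bound:
  assumes "f holomorphic_on UNIV" "0 < R" "\<And>t. cmod t \<le> R \<Longrightarrow> cmod (f t) \<le> M"
  shows "cmod (tcoef f k) \<le> M / R ^ k"
proof -
  have "cmod ((deriv ^^ k) f 0) \<le> fact k * M / R ^ k"
    using assms by (intro Cauchy_inequality)
      (auto intro: holomorphic_on_subset holomorphic_on_imp_continuous_on)
  then show ?thesis by (simp add: tcoef_def norm_divide field_simps)
qed

lemma tcoef_sums:
  assumes "f holomorphic_on UNIV"
  shows "(\<lambda>k. tcoef f k * t ^ k) sums f t"
  using holomorphic_power_series [of f 0 "cmod t + 1" t] assms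
  by (auto simp: tcoef_def intro: holomorphic_on_subset)

lemma tcoef_abs_summable:
  assumes "f holomorphic_on UNIV"
  shows "summable (\<lambda>k. cmod (tcoef f k * t ^ k))"
proof -
  have "summable (\<lambda>k. tcoef f k * (of_real (cmod t + 1)) ^ k)"
    using tcoef_sums [OF assms] sums_summable by blast
  then have "summable (\<lambda>k. cmod (tcoef f k * t ^ k))"
    by (rule powser_insidea) (simp add: norm_of_real del: of_real_add)
  then show ?thesis .
qed

lemma tcoef_has_sum:
  assumes "f holomorphic_on UNIV"
  shows "((\<lambda>k. tcoef f k * t ^ k) has_sum f t) UNIV"
  by (intro norm_summable_imp_has_sum tcoef_abs_summable tcoef_sums assms)

lemma tcoef_add:
  assumes "f holomorphic_on UNIV" "g holomorphic_on UNIV"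
  shows "tcoef (\<lambda>t. f t + g t) k = tcoef f k + tcoef g k"
  using higher_deriv_add [OF assms] by (simp add: tcoef_def add_divide_distrib)

lemma tcoef_cmult:
  assumes "f holomorphic_on UNIV"
  shows "tcoef (\<lambda>t. c * f t) k = c * tcoef f k"
  using higher_deriv_cmult [OF assms _ open_UNIV, of 0] by (simp add: tcoef_def)

lemma tcoef_power: "tcoef (\<lambda>t. c * t ^ b) k = (if b = k then c else 0)"
proof -
  have "tcoef (\<lambda>t. t ^ b) k = (if b = k then 1 else 0)"
  proof (cases "k \<le> b")
    case True
    then show ?thesis
      using higher_deriv_power [of k 0 b "0::complex"]
      by (auto simp: tcoef_def simp flip: pochhammer_fact)
  next
    case False
    then have "Suc b - k = 0" "k \<noteq> 0" by auto
    then show ?thesis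
      using higher_deriv_power [of k 0 b "0::complex"] False
      by (simp add: tcoef_def pochhammer_0_left)
  qed
  then show ?thesis
    by (subst tcoef_cmult) (auto intro!: holomorphic_intros)
qed

text \<open>Only separate holomorphy and local bounds are available. By induction on k, the
  remainder after the terms below k, divided by t^k at the fixed small t = 1/(m+1), is holomorphic
  in w; by Cauchy's estimate it converges to the coefficient locally uniformly as m grows.\<close>

lemma tcoef_holomorphic:
  fixes f :: "complex \<Rightarrow> complex \<Rightarrow> complex"
  assumes hol: "\<And>w. f w holomorphic_on UNIV" "\<And>t. (\<lambda>w. f w t) holomorphic_on UNIV"
    and bdd: "\<And>R. \<exists>M. \<forall>w t. cmod w \<le> R \<and> cmod t \<le> R \<longrightarrow> cmod (f w t) \<le> M"
  shows "(\<lambda>w. tcoef (f w) k) holomorphic_on UNIV"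
proof (induction k rule: less_induct)
  case (less k)
  define t where "t m = complex_of_real (1 / (real m + 1))" for m
  have t: "cmod (t m) \<le> 1" "t m \<noteq> 0" "cmod (t m) = 1 / (real m + 1)" for m
  proof -
    show e: "cmod (t m) = 1 / (real m + 1)"
      unfolding t_def norm_of_real by simp
    then show "cmod (t m) \<le> 1" by simp
    show "t m \<noteq> 0" using e by (metis norm_zero divide_eq_0_iff of_nat_0_le_iff
      add_nonneg_eq_0_iff zero_le_one one_neq_zero)
  qed
  define g where "g m w = (f w (t m) - (\<Sum>i<k. tcoef (f w) i * t m ^ i)) / t m ^ k" for m w
  show ?case
  proof (rule holomorphic_uniform_sequence [where f = g])
    show "g m holomorphic_on UNIV" for m
      unfolding g_def using t(2)[of m] less by (intro holomorphic_intros hol) auto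
    fix x :: complex
    show "\<exists>d. 0 < d \<and> cball x d \<subseteq> UNIV \<and>
      uniform_limit (cball x d) g (\<lambda>w. tcoef (f w) k) sequentially"
    proof (intro exI [of _ 1] conjI)
      \<comment> \<open>Large enough for all w in the unit ball around x and for the circle of
        radius 2 in t. Cauchy's estimate on radius 2 against |t m| \<le> 1 leaves a geometric series
        of ratio 1/2.\<close>
      define R where "R = cmod x + 2"
      obtain M where M: "\<And>w t. cmod w \<le> R \<Longrightarrow> cmod t \<le> R \<Longrightarrow> cmod (f w t) \<le> M"
        using bdd by blast
      have "M \<ge> 0" using M[of 0 0] by (auto simp: R_def intro: order_trans [OF norm_ge_zero])
      have est: "cmod (g m w - tcoef (f w) k) \<le> 2 * M * cmod (t m)" if w: "w \<in> cball x 1" for m w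
      proof -
        have wR: "cmod w \<le> R" using w norm_triangle_ineq2[of w x]
          by (simp add: R_def dist_norm norm_minus_commute)
        have c: "cmod (tcoef (f w) j) \<le> M / 2 ^ j" for j
          using wR by (intro tcoef_bound hol M) (auto simp: R_def intro: order_trans)
        define S where "S = (\<Sum>j. tcoef (f w) (j + Suc k) * t m ^ j)"
        have sm: "(\<lambda>j. tcoef (f w) (j + Suc k) * t m ^ (j + Suc k)) sums
            (f w (t m) - (\<Sum>i<Suc k. tcoef (f w) i * t m ^ i))"
          by (rule sums_split_initial_segment [OF tcoef_sums [OF hol(1)]])
        have b: "cmod (tcoef (f w) (j + Suc k) * t m ^ j) \<le> M * (1/2) ^ j" for j
        proof -
          have "cmod (tcoef (f w) (j + Suc k) * t m ^ j) \<le> (M / 2 ^ (j + Suc k)) * 1"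
            unfolding norm_mult using c[of "j + Suc k"] t(1)[of m] \<open>M \<ge> 0\<close>
            by (intro mult_mono) (auto simp: norm_power power_le_one)
          also have "\<dots> \<le> M / 2 ^ j"
            unfolding mult_1_right using \<open>M \<ge> 0\<close>
            by (intro divide_left_mono power_increasing) auto
          finally show ?thesis by (simp add: power_divide)
        qed
        have sg: "(\<lambda>j. M * (1/2) ^ j) sums (M * 2)"
          using geometric_sums[of "1/2::real"] by (intro sums_mult) auto
        have ss: "summable (\<lambda>j. tcoef (f w) (j + Suc k) * t m ^ j)"
          by (rule summable_comparison_test [OF _ sums_summable [OF sg]]) (use b in blast)
        have S2: "cmod S \<le> M * 2"
          unfolding S_def by (rule norm_sums_le [OF summable_sums [OF ss] sg b])
        have "(\<lambda>j. t m ^ Suc k * (tcoef (f w) (j + Suc k) * t m ^ j)) sums (t m ^ Suc k * S)"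
          unfolding S_def by (intro sums_mult summable_sums ss)
        moreover have "t m ^ Suc k * (tcoef (f w) (j + Suc k) * t m ^ j) =
            tcoef (f w) (j + Suc k) * t m ^ (j + Suc k)" for j
          unfolding power_add by (simp only: mult_ac)
        ultimately have "t m ^ Suc k * S = f w (t m) - (\<Sum>i<Suc k. tcoef (f w) i * t m ^ i)"
          using sums_unique2 [OF _ sm] by (simp only:)
        then have "g m w - tcoef (f w) k = t m * S"
          using t(2)[of m] by (simp add: g_def field_simps)
        then show ?thesis using S2 mult_right_mono [OF S2 norm_ge_zero [of "t m"]]
          by (simp add: norm_mult mult_ac)
      qed
      show "uniform_limit (cball x 1) g (\<lambda>w. tcoef (f w) k) sequentially"
      proof (rule uniform_limitI)
        fix e :: real assume "e > 0"
        have "(\<lambda>m. 2 * M * (1 / (real m + 1))) \<longlonglongrightarrow> 2 * M * 0"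
          using LIMSEQ_inverse_real_of_nat
          by (intro tendsto_mult_left) (simp add: inverse_eq_divide add.commute)
        then have "\<forall>\<^sub>F m in sequentially. 2 * M * (1 / (real m + 1)) < e"
          using \<open>e > 0\<close> by (intro order_tendstoD) auto
        then show "\<forall>\<^sub>F m in sequentially. \<forall>w\<in>cball x 1. dist (g m w) (tcoef (f w) k) < e"
        proof eventually_elim
          case (elim m)
          show ?case
          proof
            fix w assume "w \<in> cball x 1"
            from est [OF this, of m] elim t(3)[of m] show "dist (g m w) (tcoef (f w) k) < e"
              by (simp add: dist_norm)
          qed
        qed
      qed
    qed auto
  qed auto
qed

subsection \<open>Taylor expansion in several variables\<close>

text \<open>Separate holomorphy together with bounds on polydiscs is inherited by the coefficient
  functions \<open>dcoef i k g\<close>, so one variable can be expanded after the other.\<close>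

definition sep_entire :: "(('i \<Rightarrow> complex) \<Rightarrow> complex) \<Rightarrow> bool" where
  "sep_entire g \<longleftrightarrow> (\<forall>z i. (\<lambda>t. g (z(i := t))) holomorphic_on UNIV) \<and>
     (\<forall>R. \<exists>M. \<forall>z. (\<forall>i. cmod (z i) \<le> R) \<longrightarrow> cmod (g z) \<le> M)"

definition dcoef :: "'i \<Rightarrow> nat \<Rightarrow> (('i \<Rightarrow> complex) \<Rightarrow> complex) \<Rightarrow> ('i \<Rightarrow> complex) \<Rightarrow> complex" where
  "dcoef i k g z = tcoef (\<lambda>t. g (z(i := t))) k"

lemma sep_entireD:
  "sep_entire g \<Longrightarrow> (\<lambda>t. g (z(i := t))) holomorphic_on UNIV"
  by (simp add: sep_entire_def)

lemma sep_entire_bound: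
  assumes "sep_entire g"
  obtains M where "\<And>z. (\<And>i. cmod (z i) \<le> R) \<Longrightarrow> cmod (g z) \<le> M"
  using assms unfolding sep_entire_def by blast

lemma dcoef_bound:
  assumes "sep_entire g" "0 < R" "\<And>z. (\<And>j. cmod (z j) \<le> R) \<Longrightarrow> cmod (g z) \<le> M"
    and "\<And>j. cmod (z j) \<le> R"
  shows "cmod (dcoef i k g z) \<le> M / R ^ k"
  unfolding dcoef_def
  by (intro tcoef_bound sep_entireD assms) (use assms(4) in auto)

text \<open>In the expanded variable the coefficient is constant; in any other variable the claim is
  \<open>tcoef_holomorphic\<close> for a two-variable slice of g.\<close>

lemma sep_entire_dcoef:
  fixes g :: "('a::finite \<Rightarrow> complex) \<Rightarrow> complex"
  assumes g: "sep_entire g"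
  shows "sep_entire (dcoef i k g)"
  unfolding sep_entire_def
proof (intro conjI allI)
  fix z :: "'a \<Rightarrow> complex" and j :: 'a
  show "(\<lambda>t. dcoef i k g (z(j := t))) holomorphic_on UNIV"
  proof (cases "j = i")
    case True
    then show ?thesis by (simp add: dcoef_def)
  next
    case False
    have upd: "z(j := w, i := t) = z(i := t, j := w)" for w t
      using False by (simp add: fun_upd_twist)
    define f where "f w t = g (z(j := w, i := t))" for w t
    have "(\<lambda>w. tcoef (f w) k) holomorphic_on UNIV"
    proof (rule tcoef_holomorphic)
      show "f w holomorphic_on UNIV" for w
        unfolding f_def by (rule sep_entireD [OF g])
      show "(\<lambda>w. f w t) holomorphic_on UNIV" for t
        unfolding f_def upd by (rule sep_entireD [OF g])
      fix R :: real
      define R' where "R' = max R (Max (range (\<lambda>j. cmod (z j))))"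
      obtain M where M: "\<And>z. (\<And>i. cmod (z i) \<le> R') \<Longrightarrow> cmod (g z) \<le> M"
        using sep_entire_bound [OF g] by blast
      show "\<exists>M. \<forall>w t. cmod w \<le> R \<and> cmod t \<le> R \<longrightarrow> cmod (f w t) \<le> M"
      proof (intro exI allI impI)
        fix w t assume "cmod w \<le> R \<and> cmod t \<le> R"
        then show "cmod (f w t) \<le> M"
          unfolding f_def by (intro M) (auto simp: R'_def le_max_iff_disj)
      qed
    qed
    then show ?thesis by (simp add: f_def [abs_def] dcoef_def)
  qed
next
  fix R :: real
  define R' where "R' = max R 1"
  obtain M where M: "\<And>z. (\<And>i. cmod (z i) \<le> R') \<Longrightarrow> cmod (g z) \<le> M"
    using sep_entire_bound [OF g] by blast
  show "\<exists>M. \<forall>z. (\<forall>i. cmod (z i) \<le> R) \<longrightarrow> cmod (dcoef i k g z) \<le> M"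
  proof (intro exI allI impI)
    fix z :: "'a \<Rightarrow> complex" assume "\<forall>i. cmod (z i) \<le> R"
    then show "cmod (dcoef i k g z) \<le> M / R' ^ k"
      by (intro dcoef_bound g M) (auto simp: R'_def max_def intro: order_trans)
  qed
qed

lemma dcoef_add:
  assumes "sep_entire f" "sep_entire g"
  shows "dcoef i k (\<lambda>z. f z + g z) = (\<lambda>z. dcoef i k f z + dcoef i k g z)"
  unfolding dcoef_def by (rule ext, rule tcoef_add) (intro sep_entireD assms)+

lemma dcoef_cmult:
  assumes "sep_entire f"
  shows "dcoef i k (\<lambda>z. c * f z) = (\<lambda>z. c * dcoef i k f z)"
  unfolding dcoef_def by (rule ext, rule tcoef_cmult) (intro sep_entireD assms)

lemma sep_entire_add:
  assumes "sep_entire f" "sep_entire g"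
  shows "sep_entire (\<lambda>z. f z + g z)"
  unfolding sep_entire_def
proof (intro conjI allI)
  fix R
  obtain M N where "\<And>z. (\<And>i. cmod (z i) \<le> R) \<Longrightarrow> cmod (f z) \<le> M"
     "\<And>z. (\<And>i. cmod (z i) \<le> R) \<Longrightarrow> cmod (g z) \<le> N"
    using sep_entire_bound assms by metis
  then show "\<exists>M. \<forall>z. (\<forall>i. cmod (z i) \<le> R) \<longrightarrow> cmod (f z + g z) \<le> M"
    by (intro exI [of _ "M + N"]) (auto intro: norm_triangle_mono)
qed (intro holomorphic_intros sep_entireD assms)

lemma sep_entire_const: "sep_entire (\<lambda>z. c)"
  unfolding sep_entire_def by (auto intro: holomorphic_intros)

lemma sep_entire_mult:
  assumes "sep_entire f" "sep_entire g"
  shows "sep_entire (\<lambda>z. f z * g z)"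
  unfolding sep_entire_def
proof (intro conjI allI)
  fix R
  obtain M N where MN: "\<And>z. (\<And>i. cmod (z i) \<le> R) \<Longrightarrow> cmod (f z) \<le> M"
     "\<And>z. (\<And>i. cmod (z i) \<le> R) \<Longrightarrow> cmod (g z) \<le> N"
    using sep_entire_bound assms by metis
  show "\<exists>M. \<forall>z. (\<forall>i. cmod (z i) \<le> R) \<longrightarrow> cmod (f z * g z) \<le> M"
  proof (intro exI allI impI)
    fix z :: "'a \<Rightarrow> complex" assume z: "\<forall>i. cmod (z i) \<le> R"
    then show "cmod (f z * g z) \<le> M * N" unfolding norm_mult
      using MN order_trans [OF norm_ge_zero MN(1), of z] by (intro mult_mono) auto
  qed
qed (intro holomorphic_intros sep_entireD assms)

lemma sep_entire_coord: "sep_entire (\<lambda>z. z i)"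
  unfolding sep_entire_def
proof (intro conjI allI)
  fix z :: "'a \<Rightarrow> complex" and j
  show "(\<lambda>t. (z(j := t)) i) holomorphic_on UNIV"
    by (cases "i = j") (auto intro: holomorphic_intros)
qed auto

lemma sep_entire_power: "sep_entire f \<Longrightarrow> sep_entire (\<lambda>z. f z ^ k)"
  by (induction k) (auto intro: sep_entire_const sep_entire_mult)

lemma sep_entire_sum: "(\<And>x. x \<in> A \<Longrightarrow> sep_entire (f x)) \<Longrightarrow> sep_entire (\<lambda>z. \<Sum>x\<in>A. f x z)"
  by (induction A rule: infinite_finite_induct) (auto intro: sep_entire_const sep_entire_add)

lemma sep_entire_prod: "(\<And>x. x \<in> A \<Longrightarrow> sep_entire (f x)) \<Longrightarrow> sep_entire (\<lambda>z. \<Prod>x\<in>A. f x z)"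
  by (induction A rule: infinite_finite_induct) (auto intro: sep_entire_const sep_entire_mult)

text \<open>The argument z is kept: coordinates already expanded no longer matter, the others are
  still free. Once all coordinates are listed the value is a constant.\<close>

fun taylor_coefs :: "'i list \<Rightarrow> ('i \<Rightarrow> nat) \<Rightarrow> (('i \<Rightarrow> complex) \<Rightarrow> complex) \<Rightarrow> ('i \<Rightarrow> complex) \<Rightarrow> complex" where
  "taylor_coefs [] \<alpha> g = g"
| "taylor_coefs (i # is) \<alpha> g = taylor_coefs is \<alpha> (dcoef i (\<alpha> i) g)"

lemma taylor_coefs_add:
  fixes f g :: "('a::finite \<Rightarrow> complex) \<Rightarrow> complex"
  shows
  "sep_entire f \<Longrightarrow> sep_entire g \<Longrightarrow>
    taylor_coefs is \<alpha> (\<lambda>z. f z + g z) = (\<lambda>z. taylor_coefs is \<alpha> f z + taylor_coefs is \<alpha> g z)"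
  by (induction "is" arbitrary: f g) (simp_all add: dcoef_add sep_entire_dcoef)

lemma taylor_coefs_cmult:
  fixes f :: "('a::finite \<Rightarrow> complex) \<Rightarrow> complex"
  shows
  "sep_entire f \<Longrightarrow> taylor_coefs is \<alpha> (\<lambda>z. c * f z) = (\<lambda>z. c * taylor_coefs is \<alpha> f z)"
  by (induction "is" arbitrary: f) (simp_all add: dcoef_cmult sep_entire_dcoef)

lemma taylor_coefs_bound:
  fixes g :: "('a::finite \<Rightarrow> complex) \<Rightarrow> complex"
  assumes "sep_entire g" "0 < R" "\<And>z. (\<And>j. cmod (z j) \<le> R) \<Longrightarrow> cmod (g z) \<le> M"
    and "\<And>j. cmod (z j) \<le> R" "distinct is"
  shows "cmod (taylor_coefs is \<alpha> g z) \<le> M / R ^ sum \<alpha> (set is)"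
  using assms
proof (induction "is" arbitrary: g M)
  case (Cons i "is")
  have "cmod (taylor_coefs is \<alpha> (dcoef i (\<alpha> i) g) z) \<le> (M / R ^ \<alpha> i) / R ^ sum \<alpha> (set is)"
    using Cons.prems by (intro Cons.IH sep_entire_dcoef dcoef_bound) auto
  then show ?case using Cons.prems by (simp add: power_add)
qed auto

lemma taylor_coefs_cong_index:
  "(\<And>j. j \<in> set is \<Longrightarrow> \<alpha> j = \<beta> j) \<Longrightarrow> taylor_coefs is \<alpha> g = taylor_coefs is \<beta> g"
  by (induction "is" arbitrary: g) auto

text \<open>The prefactor \<open>w\<close>, independent of the listed variables, strengthens the
  claim for the induction: extracting one variable either keeps \<open>w\<close> or replaces it by
  0.\<close>

lemma taylor_coefs_monomial:
  assumes "distinct is" "\<And>z j t. j \<in> set is \<Longrightarrow> w (z(j := t)) = w z"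
  shows "taylor_coefs is \<alpha> (\<lambda>z. w z * (\<Prod>j\<in>set is. z j ^ \<beta> j)) z =
    (if \<forall>j\<in>set is. \<alpha> j = \<beta> j then w z else 0)"
  using assms
proof (induction "is" arbitrary: w)
  case (Cons i "is")
  have "dcoef i (\<alpha> i) (\<lambda>z. w z * (\<Prod>j\<in>set (i # is). z j ^ \<beta> j)) =
     (\<lambda>z. (if \<beta> i = \<alpha> i then w z else 0) * (\<Prod>j\<in>set is. z j ^ \<beta> j))"
  proof
    fix z
    have "(\<lambda>t. w (z(i := t)) * (\<Prod>j\<in>set (i # is). (z(i := t)) j ^ \<beta> j)) =
      (\<lambda>t. (w z * (\<Prod>j\<in>set is. z j ^ \<beta> j)) * t ^ \<beta> i)"
    proof
      fix t
      have "(\<Prod>j\<in>set is. (z(i := t)) j ^ \<beta> j) = (\<Prod>j\<in>set is. z j ^ \<beta> j)"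
        using Cons.prems by (intro prod.cong) auto
      moreover have "w (z(i := t)) = w z" by (rule Cons.prems) simp
      ultimately show "w (z(i := t)) * (\<Prod>j\<in>set (i # is). (z(i := t)) j ^ \<beta> j) =
        (w z * (\<Prod>j\<in>set is. z j ^ \<beta> j)) * t ^ \<beta> i"
        using Cons.prems by (simp del: fun_upd_apply) simp
    qed
    then show "dcoef i (\<alpha> i) (\<lambda>z. w z * (\<Prod>j\<in>set (i # is). z j ^ \<beta> j)) z =
     (if \<beta> i = \<alpha> i then w z else 0) * (\<Prod>j\<in>set is. z j ^ \<beta> j)"
      unfolding dcoef_def by (simp add: tcoef_power)
  qed
  moreover have "taylor_coefs is \<alpha> (\<lambda>z. (if \<beta> i = \<alpha> i then w z else 0) * (\<Prod>j\<in>set is. z j ^ \<beta> j)) z =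
      (if \<forall>j\<in>set is. \<alpha> j = \<beta> j then if \<beta> i = \<alpha> i then w z else 0 else 0)"
  proof (rule Cons.IH)
    show "distinct is" using Cons.prems by simp
    fix z j t assume "j \<in> set is"
    then have "w (z(j := t)) = w z" by (intro Cons.prems) simp
    then show "(if \<beta> i = \<alpha> i then w (z(j := t)) else 0) = (if \<beta> i = \<alpha> i then w z else 0)" by simp
  qed
  ultimately show ?case by auto
qed auto

text \<open>The one-variable expansions are iterated. Absolute summability, from Cauchy's estimate
  on a polydisc of twice the size, merges the iterated sums into a single unordered one.\<close>

lemma taylor_coefs_has_sum:
  fixes g :: "('i::finite \<Rightarrow> complex) \<Rightarrow> complex"
  assumes "distinct is" "sep_entire g"
  shows "((\<lambda>\<alpha>. taylor_coefs is \<alpha> g z * (\<Prod>j\<in>set is. z j ^ \<alpha> j)) has_sum g z)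
    {\<alpha>. \<forall>j. j \<notin> set is \<longrightarrow> \<alpha> j = 0}"
  using assms
proof (induction "is" arbitrary: g)
  case Nil
  have "{\<alpha>. \<forall>j. \<alpha> j = 0} = {\<lambda>j::'i. 0::nat}" by auto
  then show ?case using has_sum_finite [of "{\<lambda>j::'i. 0::nat}" "\<lambda>_. g z"] by simp
next
  case (Cons i "is")
  define A where "A = {\<alpha>::'i\<Rightarrow>nat. \<forall>j. j \<notin> set is \<longrightarrow> \<alpha> j = 0}"
  define A' where "A' = {\<alpha>::'i\<Rightarrow>nat. \<forall>j. j \<notin> set (i # is) \<longrightarrow> \<alpha> j = 0}"
  let ?T = "\<lambda>\<alpha>. taylor_coefs (i # is) \<alpha> g z * (\<Prod>j\<in>set (i # is). z j ^ \<alpha> j)"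
  let ?f = "\<lambda>(k, \<alpha>). ?T (\<alpha>(i := k))"
  have i: "i \<notin> set is" "distinct is" using Cons.prems by auto
  have T: "?T (\<alpha>(i := k)) = taylor_coefs is \<alpha> (dcoef i k g) z * (\<Prod>j\<in>set is. z j ^ \<alpha> j) * z i ^ k" for \<alpha> k
  proof -
    have "taylor_coefs is (\<alpha>(i := k)) (dcoef i k g) = taylor_coefs is \<alpha> (dcoef i k g)"
      using i by (intro taylor_coefs_cong_index) auto
    moreover have "(\<Prod>j\<in>set is. z j ^ (\<alpha>(i := k)) j) = (\<Prod>j\<in>set is. z j ^ \<alpha> j)"
      using i by (intro prod.cong) auto
    ultimately show ?thesis using i by simp
  qed
  \<comment> \<open>At least twice every |z j|, so that the terms are bounded by M (1/2)^|\<alpha>|;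
    the summand 1 keeps R positive when z = 0.\<close>
  define R where "R = 2 * (\<Sum>j\<in>UNIV. cmod (z j)) + 1"
  have zR: "cmod (z j) \<le> R / 2" for j
  proof -
    have "cmod (z j) \<le> (\<Sum>j\<in>UNIV. cmod (z j))" by (rule member_le_sum) auto
    then show ?thesis by (simp add: R_def)
  qed
  have R: "R > 0" unfolding R_def by (intro add_nonneg_pos mult_nonneg_nonneg sum_nonneg) auto
  obtain M where M: "\<And>z. (\<And>i. cmod (z i) \<le> R) \<Longrightarrow> cmod (g z) \<le> M"
    using sep_entire_bound [OF Cons.prems(2)] by blast
  have "M \<ge> 0" using M[of "\<lambda>_. 0"] R by (auto intro: order_trans [OF norm_ge_zero])
  have bij: "bij_betw (\<lambda>(k, \<alpha>). \<alpha>(i := k)) (UNIV \<times> A) A'"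
    by (rule bij_betwI [where g = "\<lambda>\<alpha>. (\<alpha> i, \<alpha>(i := 0))"]) (use i in \<open>auto simp: A_def A'_def\<close>)
  have "(\<lambda>\<alpha>. norm (?T \<alpha>)) summable_on A'"
  proof (rule Infinite_Sum.abs_summable_on_comparison_test')
    show "(\<lambda>\<alpha>. M * (1/2) ^ sum \<alpha> UNIV) summable_on A'"
      by (intro summable_on_cmult_right summable_on_subset_banach
        [OF geometric_multiindex_summable]) auto
    fix \<alpha> assume "\<alpha> \<in> A'"
    then have "sum \<alpha> (set (i # is)) = sum \<alpha> UNIV"
      by (intro sum.mono_neutral_left) (auto simp: A'_def)
    moreover have "cmod (taylor_coefs (i # is) \<alpha> g z) \<le> M / R ^ sum \<alpha> (set (i # is))"
    proof (intro taylor_coefs_bound Cons.prems M R)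
      show "cmod (z j) \<le> R" for j using zR [of j] R by simp
    qed
    moreover have "cmod (\<Prod>j\<in>set (i # is). z j ^ \<alpha> j) \<le> (R / 2) ^ sum \<alpha> (set (i # is))"
      unfolding prod_norm [symmetric] power_sum norm_power using zR
      by (intro prod_mono) (auto intro: power_mono)
    ultimately have "cmod (?T \<alpha>) \<le> M / R ^ sum \<alpha> UNIV * (R / 2) ^ sum \<alpha> UNIV"
      unfolding norm_mult using \<open>M \<ge> 0\<close> R by (intro mult_mono) auto
    also have "\<dots> = M * (1/2) ^ sum \<alpha> UNIV"
      using R by (simp add: power_divide)
    finally show "cmod (?T \<alpha>) \<le> M * (1/2) ^ sum \<alpha> UNIV" .
  qed
  then have "?T summable_on A'" by (rule abs_summable_summable)
  then have "?f summable_on UNIV \<times> A"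
    using summable_on_reindex_bij_betw [OF bij, of ?T] by (simp only: case_prod_beta')
  moreover have "((\<lambda>\<alpha>. ?f (k, \<alpha>)) has_sum dcoef i k g z * z i ^ k) A" for k
    unfolding prod.case T A_def
    by (intro has_sum_cmult_left Cons.IH i sep_entire_dcoef Cons.prems)
  moreover have "((\<lambda>k. dcoef i k g z * z i ^ k) has_sum g z) UNIV"
    using tcoef_has_sum [OF sep_entireD [OF Cons.prems(2)], of z i "z i"]
    unfolding dcoef_def fun_upd_triv .
  ultimately have "(?f has_sum g z) (UNIV \<times> A)"
    by (intro has_sum_SigmaI [where g = "\<lambda>k. dcoef i k g z * z i ^ k"]) auto
  then have "(?T has_sum g z) A'"
    using has_sum_reindex_bij_betw [OF bij, of ?T] by (simp only: case_prod_beta')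
  then show ?case unfolding A'_def .
qed

definition coord_list :: "'i::finite list" where
  "coord_list = (SOME xs. set xs = UNIV \<and> distinct xs)"

lemma coord_list: "set (coord_list :: 'i::finite list) = UNIV" "distinct (coord_list :: 'i::finite list)"
proof -
  obtain xs where xs: "set xs = (UNIV :: 'i set)" "distinct xs"
    using finite_distinct_list [of "UNIV :: 'i set"] by auto
  show "set (coord_list :: 'i::finite list) = UNIV" "distinct (coord_list :: 'i::finite list)"
    using someI [of "\<lambda>xs. set xs = (UNIV :: 'i set) \<and> distinct xs", OF conjI [OF xs]]
    unfolding coord_list_def by auto
qed

definition multi_monom :: "('i::finite \<Rightarrow> nat) \<Rightarrow> ('i \<Rightarrow> complex) \<Rightarrow> complex" where
  "multi_monom \<alpha> z = (\<Prod>j\<in>UNIV. z j ^ \<alpha> j)"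

definition taylor_coef :: "('i::finite \<Rightarrow> nat) \<Rightarrow> (('i \<Rightarrow> complex) \<Rightarrow> complex) \<Rightarrow> complex" where
  "taylor_coef \<alpha> g = taylor_coefs coord_list \<alpha> g (\<lambda>_. 0)"

text \<open>Induction from the end of the list: the variable listed last is the outermost
  \<open>dcoef\<close>, which overwrites that coordinate of z.\<close>

lemma taylor_coefs_coord_list_const:
  fixes g :: "('i::finite \<Rightarrow> complex) \<Rightarrow> complex"
  shows "taylor_coefs coord_list \<alpha> g z = taylor_coef \<alpha> g"
proof -
  have "taylor_coefs is \<alpha> g z = taylor_coefs is \<alpha> g z'"
    if "\<And>j. j \<notin> set is \<Longrightarrow> z j = z' j" for "is" and z z' :: "'i \<Rightarrow> complex" and g
    using that
  proof (induction "is" arbitrary: g z z' rule: rev_induct)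
    case Nil
    then have "z = z'" by auto
    then show ?case by simp
  next
    case (snoc i "is")
    have knorm: "taylor_coefs (is @ [i]) \<alpha> g z = dcoef i (\<alpha> i) (taylor_coefs is \<alpha> g) z" for z g
      by (induction "is" arbitrary: g) auto
    have "taylor_coefs is \<alpha> g (z(i := t)) = taylor_coefs is \<alpha> g (z'(i := t))" for t
      using snoc.prems by (intro snoc.IH) auto
    then show ?case unfolding knorm dcoef_def by simp
  qed
  from this [of coord_list] show ?thesis by (simp add: coord_list taylor_coef_def)
qed

lemma taylor_coef_has_sum:
  assumes "sep_entire g"
  shows "((\<lambda>\<alpha>. taylor_coef \<alpha> g * multi_monom \<alpha> z) has_sum g z) UNIV"
  using taylor_coefs_has_sum [OF coord_list(2) assms, of z]
  by (simp add: taylor_coefs_coord_list_const coord_list multi_monom_def)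

lemma taylor_coef_bound:
  assumes "sep_entire g" "0 < R" "\<And>z. (\<And>j. cmod (z j) \<le> R) \<Longrightarrow> cmod (g z) \<le> M"
  shows "cmod (taylor_coef \<alpha> g) \<le> M / R ^ sum \<alpha> UNIV"
  using taylor_coefs_bound [OF assms(1,2,3), of "\<lambda>_. 0" coord_list \<alpha>] assms(2)
  by (simp add: taylor_coef_def coord_list)

lemma taylor_coef_add:
  "sep_entire f \<Longrightarrow> sep_entire g \<Longrightarrow> taylor_coef \<alpha> (\<lambda>z. f z + g z) = taylor_coef \<alpha> f + taylor_coef \<alpha> g"
  by (simp add: taylor_coef_def taylor_coefs_add)

lemma taylor_coef_cmult: "sep_entire f \<Longrightarrow> taylor_coef \<alpha> (\<lambda>z. c * f z) = c * taylor_coef \<alpha> f"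
  by (simp add: taylor_coef_def taylor_coefs_cmult)

lemma taylor_coef_multi_monom: "taylor_coef \<alpha> (multi_monom \<beta>) = (if \<alpha> = \<beta> then 1 else 0)"
  using taylor_coefs_monomial [OF coord_list(2), of "\<lambda>_. 1" \<alpha> \<beta> "\<lambda>_. 0"]
  by (simp add: taylor_coef_def coord_list multi_monom_def [abs_def] fun_eq_iff)

lemma sep_entire_multi_monom: "sep_entire (multi_monom \<beta>)"
  unfolding multi_monom_def [abs_def] by (intro sep_entire_prod sep_entire_power sep_entire_coord)

text \<open>The identity theorem releases one variable at a time from the reals, which accumulate at
  0; the set S collects the released variables.\<close>

lemma zero_if_zero_on_reals:
  fixes g :: "('i::finite \<Rightarrow> complex) \<Rightarrow> complex"
  assumes hol: "\<And>z i. (\<lambda>t. g (z(i := t))) holomorphic_on UNIV"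
    and zero: "\<And>z. (\<And>i. z i \<in> \<real>) \<Longrightarrow> g z = 0"
  shows "g z = 0"
proof -
  have "\<forall>z. (\<forall>i. i \<notin> S \<longrightarrow> z i \<in> \<real>) \<longrightarrow> g z = 0" if "finite S" for S
    using that
  proof (induction S rule: finite_induct)
    case empty
    then show ?case using zero by auto
  next
    case (insert i S)
    show ?case
    proof (intro allI impI)
      fix z :: "'i \<Rightarrow> complex"
      assume z: "\<forall>j. j \<notin> insert i S \<longrightarrow> z j \<in> \<real>"
      have "g (z(i := t)) = 0" if "t \<in> \<real>" for t
        using insert.IH z that by auto
      moreover have "(0::complex) islimpt \<real>"
        unfolding islimpt_approachable
      proof safe
        fix e :: real assume "e > 0"
        then show "\<exists>x'\<in>\<real>. x' \<noteq> 0 \<and> dist x' (0::complex) < e"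
          by (intro bexI [of _ "of_real (e/2)"]) auto
      qed
      ultimately have "g (z(i := z i)) = 0"
        using analytic_continuation [OF hol [of z i] open_UNIV connected_UNIV subset_UNIV [of \<real>]
          UNIV_I _ _ UNIV_I, of 0 "z i"] by blast
      then show "g z = 0" by simp
    qed
  qed
  from this [of UNIV] show ?thesis by auto
qed

subsection \<open>Complex differentiability and holomorphic functions on the quadric\<close>

text \<open>The derivative clause of \<open>holo_Zhat\<close> at one point. Real linearity is part
  of \<open>has_derivative\<close>, so homogeneity under \<open>csc\<close> is all that complex
  linearity adds.\<close>

definition cdiff :: "(('n::finite) pt \<times> 'n pt \<Rightarrow> complex) \<Rightarrow> 'n pt \<times> 'n pt \<Rightarrow> bool" where
  "cdiff G w \<longleftrightarrow> (\<exists>D. (G has_derivative D) (at w) \<and>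
     (\<forall>c v. D (csc c (fst v), csc c (snd v)) = c * D v))"

lemma vec_eq_sum_axis:
  fixes p :: "complex ^ 'i::finite"
  shows "p = (\<Sum>i\<in>UNIV. axis i (p $ i))"
  by (simp add: vec_eq_iff axis_def if_distrib cong: if_cong)

lemma bounded_linear_axis: "bounded_linear (axis i :: complex \<Rightarrow> complex ^ 'i::finite)"
proof (rule bounded_linear_intro [where K = 1])
  show "axis i (x + y) = axis i x + (axis i y :: complex ^ 'i)" for x y
    by (simp add: vec_eq_iff axis_def)
  show "axis i (r *\<^sub>R x) = r *\<^sub>R (axis i x :: complex ^ 'i)" for r x
    by (simp add: vec_eq_iff axis_def)
  show "norm (axis i x :: complex ^ 'i) \<le> norm x * 1" for x
  proof -
    have "norm (axis i x :: complex ^ 'i) \<le> (\<Sum>j\<in>UNIV. norm ((axis i x :: complex ^ 'i) $ j))"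
      unfolding norm_vec_def by (rule L2_set_le_sum) simp
    also have "\<dots> = norm x"
      by (simp add: axis_def if_distrib cong: if_cong)
    finally show ?thesis by simp
  qed
qed

lemma has_derivative_vec_curve:
  fixes p :: "complex \<Rightarrow> complex ^ 'i::finite"
  assumes "\<And>i. ((\<lambda>s. p s $ i) has_field_derivative p' i) (at t)"
  shows "(p has_derivative (\<lambda>h. \<chi> i. h * p' i)) (at t)"
proof -
  have "((\<lambda>s. \<Sum>i\<in>UNIV. axis i (p s $ i)) has_derivative (\<lambda>h. \<Sum>i\<in>UNIV. axis i (p' i * h))) (at t)"
    by (intro has_derivative_sum bounded_linear.has_derivative [OF bounded_linear_axis]
      has_field_derivative_imp_has_derivative assms)
  moreover have "(\<lambda>h. \<Sum>i\<in>UNIV. axis i (p' i * h)) = (\<lambda>h. \<chi> i. h * p' i)"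
    by (rule ext) (simp add: vec_eq_iff axis_def if_distrib mult.commute cong: if_cong)
  moreover have "(\<lambda>s. \<Sum>i\<in>UNIV. axis i (p s $ i)) = p"
    by (rule ext) (rule vec_eq_sum_axis [symmetric])
  ultimately show ?thesis by simp
qed

lemma has_derivative_pair_curve:
  fixes \<gamma> :: "complex \<Rightarrow> ('n::finite) pt \<times> 'n pt"
  assumes "\<And>i. (\<lambda>s. fst (\<gamma> s) $ i) field_differentiable (at t)"
    and "\<And>i. (\<lambda>s. snd (\<gamma> s) $ i) field_differentiable (at t)"
  obtains v where "(\<gamma> has_derivative (\<lambda>h. (csc h (fst v), csc h (snd v)))) (at t)"
proof -
  obtain p' where p': "\<And>i. ((\<lambda>s. fst (\<gamma> s) $ i) has_field_derivative p' i) (at t)"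
    using assms(1) unfolding field_differentiable_def by metis
  obtain q' where q': "\<And>i. ((\<lambda>s. snd (\<gamma> s) $ i) has_field_derivative q' i) (at t)"
    using assms(2) unfolding field_differentiable_def by metis
  have "((\<lambda>s. (fst (\<gamma> s), snd (\<gamma> s))) has_derivative
      (\<lambda>h. (\<chi> i. h * p' i, \<chi> i. h * q' i))) (at t)"
    by (intro has_derivative_Pair has_derivative_vec_curve p' q')
  then show thesis by (intro that [of "(\<chi> i. p' i, \<chi> i. q' i)"]) (simp add: csc_def)
qed

lemma cdiff_curve:
  fixes \<gamma> :: "complex \<Rightarrow> ('n::finite) pt \<times> 'n pt"
  assumes "cdiff G (\<gamma> t)"
    and "\<And>i. (\<lambda>s. fst (\<gamma> s) $ i) field_differentiable (at t)"
    and "\<And>i. (\<lambda>s. snd (\<gamma> s) $ i) field_differentiable (at t)"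
  shows "(\<lambda>s. G (\<gamma> s)) field_differentiable (at t)"
proof -
  obtain v where v: "(\<gamma> has_derivative (\<lambda>h. (csc h (fst v), csc h (snd v)))) (at t)"
    using has_derivative_pair_curve assms(2,3) by blast
  obtain D where D: "(G has_derivative D) (at (\<gamma> t))"
      "\<And>c v. D (csc c (fst v), csc c (snd v)) = c * D v"
    using assms(1) unfolding cdiff_def by blast
  have "((\<lambda>s. G (\<gamma> s)) has_derivative (\<lambda>h. D (csc h (fst v), csc h (snd v)))) (at t)"
    using has_derivative_compose [OF v D(1)] .
  then have "((\<lambda>s. G (\<gamma> s)) has_derivative (\<lambda>h. D v * h)) (at t)"
    by (simp add: D(2) mult.commute)
  then show ?thesis unfolding field_differentiable_def has_field_derivative_def by blast
qed

lemma holo_Zhat_iff_cdiff: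
  "holo_Zhat F \<longleftrightarrow> (\<forall>z\<in>Zhat. \<exists>U G. open U \<and> z \<in> U \<and> (\<forall>w\<in>U. cdiff G w) \<and>
     (\<forall>w\<in>U \<inter> Zhat. G w = F w))"
  unfolding holo_Zhat_def cdiff_def by simp

text \<open>The working form of holomorphy on the quadric: along a curve inside \<open>Zhat\<close>,
  F agrees near each parameter with an ambient holomorphic G, to which the chain rule
  applies.\<close>

lemma holo_Zhat_curve:
  fixes \<gamma> :: "complex \<Rightarrow> ('n::finite) pt \<times> 'n pt"
  assumes F: "holo_Zhat F" and S: "open S" "\<And>s. s \<in> S \<Longrightarrow> \<gamma> s \<in> Zhat"
    and hol: "\<And>i. (\<lambda>s. fst (\<gamma> s) $ i) holomorphic_on S" "\<And>i. (\<lambda>s. snd (\<gamma> s) $ i) holomorphic_on S"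
  shows "(\<lambda>s. F (\<gamma> s)) holomorphic_on S"
  unfolding holomorphic_on_def
proof
  fix t assume t: "t \<in> S"
  obtain U G where U: "open U" "\<gamma> t \<in> U" "\<And>w. w \<in> U \<Longrightarrow> cdiff G w" "\<And>w. w \<in> U \<inter> Zhat \<Longrightarrow> G w = F w"
    using bspec [OF iffD1 [OF holo_Zhat_iff_cdiff F] S(2) [OF t]] by blast
  have d: "(\<lambda>s. fst (\<gamma> s) $ i) field_differentiable (at t)"
      "(\<lambda>s. snd (\<gamma> s) $ i) field_differentiable (at t)" for i
    using hol t S(1) holomorphic_on_imp_differentiable_at by blast+
  have G: "(\<lambda>s. G (\<gamma> s)) field_differentiable (at t)"
    by (rule cdiff_curve [OF U(3) [OF U(2)] d])
  obtain v where "(\<gamma> has_derivative (\<lambda>h. (csc h (fst v), csc h (snd v)))) (at t)"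
    using has_derivative_pair_curve d by blast
  then have "isCont \<gamma> t" by (rule has_derivative_continuous)
  then have "\<forall>\<^sub>F s in at t. \<gamma> s \<in> U"
    using U(1,2) unfolding isCont_def by (rule topological_tendstoD)
  then have "\<forall>\<^sub>F s in nhds t. \<gamma> s \<in> U"
    using U(2) by (simp add: eventually_nhds_conv_at)
  moreover have "\<forall>\<^sub>F s in nhds t. s \<in> S" using S(1) t by (rule eventually_nhds_in_open)
  ultimately have "\<forall>\<^sub>F s in nhds t. G (\<gamma> s) = F (\<gamma> s)"
    by eventually_elim (use U(4) S(2) in auto)
  then have "(\<lambda>s. F (\<gamma> s)) field_differentiable (at t)"
    using G DERIV_cong_ev [OF refl _ refl, of "\<lambda>s. G (\<gamma> s)" "\<lambda>s. F (\<gamma> s)" t]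
    unfolding field_differentiable_def by metis
  then show "(\<lambda>s. F (\<gamma> s)) field_differentiable at t within S"
    by (rule field_differentiable_at_within)
qed

lemma holo_Zhat_continuous:
  fixes F :: "('n::finite) pt \<times> 'n pt \<Rightarrow> complex"
  assumes "holo_Zhat F"
  shows "continuous_on Zhat F"
  unfolding continuous_on_eq_continuous_within
proof
  fix z :: "'n pt \<times> 'n pt" assume z: "z \<in> Zhat"
  obtain U G where U: "open U" "z \<in> U" "\<And>w. w \<in> U \<Longrightarrow> cdiff G w" "\<And>w. w \<in> U \<inter> Zhat \<Longrightarrow> G w = F w"
    using bspec [OF iffD1 [OF holo_Zhat_iff_cdiff assms] z] by blast
  obtain D where "(G has_derivative D) (at z)"
    using U(2,3) unfolding cdiff_def by blast
  then have "continuous (at z within Zhat) G"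
    by (meson continuous_at_imp_continuous_at_within has_derivative_continuous)
  then have "(G \<longlongrightarrow> G z) (at z within Zhat)" by (simp add: continuous_within)
  moreover have "\<forall>\<^sub>F w in at z within Zhat. G w = F w"
    unfolding eventually_at_topological using U by blast
  moreover have "G z = F z" using U z by blast
  ultimately show "continuous (at z within Zhat) F"
    unfolding continuous_within using Lim_transform_eventually by fastforce
qed

subsection \<open>Power series in the ambient coordinates\<close>

text \<open>A quantitative \<open>cdiff\<close> for an expression of degree N. The factor N in the
  derivative bound is the one that the Leibniz rule produces, so that degrees simply add under
  products.\<close>

definition deriv_bounded :: "real \<Rightarrow> (('n::finite) pt \<times> 'n pt \<Rightarrow> complex) \<Rightarrow> nat \<Rightarrow> 'n pt \<times> 'n pt \<Rightarrow> bool" where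
  "deriv_bounded R f N w \<longleftrightarrow> cmod (f w) \<le> R ^ N \<and> (\<exists>D. (f has_derivative D) (at w) \<and>
     (\<forall>c v. D (csc c (fst v), csc c (snd v)) = c * D v) \<and>
     (\<forall>v. cmod (D v) \<le> real N * R ^ N * norm v))"

lemma deriv_bounded_mult:
  assumes "deriv_bounded R f N w" "deriv_bounded R g M w" "R \<ge> 1"
  shows "deriv_bounded R (\<lambda>w. f w * g w) (N + M) w"
proof -
  obtain D where D: "(f has_derivative D) (at w)"
     "\<And>c v. D (csc c (fst v), csc c (snd v)) = c * D v"
     "\<And>v. cmod (D v) \<le> real N * R ^ N * norm v" "cmod (f w) \<le> R ^ N"
    using assms(1) unfolding deriv_bounded_def by blast
  obtain E where E: "(g has_derivative E) (at w)"
     "\<And>c v. E (csc c (fst v), csc c (snd v)) = c * E v"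
     "\<And>v. cmod (E v) \<le> real M * R ^ M * norm v" "cmod (g w) \<le> R ^ M"
    using assms(2) unfolding deriv_bounded_def by blast
  show ?thesis unfolding deriv_bounded_def
  proof (intro conjI exI allI)
    show "cmod (f w * g w) \<le> R ^ (N + M)"
      unfolding norm_mult power_add using D(4) E(4) assms(3) by (intro mult_mono) auto
    show "((\<lambda>w. f w * g w) has_derivative (\<lambda>h. f w * E h + D h * g w)) (at w)"
      by (rule has_derivative_mult [OF D(1) E(1)])
    show "f w * E (csc c (fst v), csc c (snd v)) + D (csc c (fst v), csc c (snd v)) * g w =
      c * (f w * E v + D v * g w)" for c v
      by (simp add: D(2) E(2) algebra_simps)
    fix v
    have "cmod (f w * E v + D v * g w) \<le> cmod (f w) * cmod (E v) + cmod (D v) * cmod (g w)"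
      by (metis norm_mult norm_triangle_ineq)
    also have "\<dots> \<le> R ^ N * (real M * R ^ M * norm v) + (real N * R ^ N * norm v) * R ^ M"
      using D(3,4) E(3,4) assms(3) by (intro add_mono mult_mono) auto
    finally show "cmod (f w * E v + D v * g w) \<le> real (N + M) * R ^ (N + M) * norm v"
      by (simp add: power_add algebra_simps)
  qed
qed

lemma deriv_bounded_one: "deriv_bounded R (\<lambda>w. 1) 0 w"
  unfolding deriv_bounded_def by (auto intro!: exI [of _ "\<lambda>_. 0"])

lemma deriv_bounded_power: "deriv_bounded R f N w \<Longrightarrow> R \<ge> 1 \<Longrightarrow> deriv_bounded R (\<lambda>w. f w ^ k) (k * N) w"
  by (induction k) (auto intro: deriv_bounded_one deriv_bounded_mult)

lemma deriv_bounded_prod: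
  "finite A \<Longrightarrow> (\<And>i. i \<in> A \<Longrightarrow> deriv_bounded R (f i) (N i) w) \<Longrightarrow> R \<ge> 1 \<Longrightarrow>
    deriv_bounded R (\<lambda>w. \<Prod>i\<in>A. f i w) (\<Sum>i\<in>A. N i) w"
  by (induction A rule: finite_induct) (auto intro: deriv_bounded_one deriv_bounded_mult)

lemma norm_pair_components:
  fixes v :: "('n::finite) pt \<times> 'n pt"
  shows "cmod (fst v $ i) \<le> norm v" "cmod (snd v $ i) \<le> norm v"
  using Finite_Cartesian_Product.norm_nth_le [of "fst v" i] norm_fst_le [of "fst v" "snd v"]
    Finite_Cartesian_Product.norm_nth_le [of "snd v" i] norm_snd_le [of "snd v" "fst v"] by auto

lemma deriv_bounded_coord:
  fixes w :: "('n::finite) pt \<times> 'n pt"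
  assumes "R \<ge> 1" "norm w \<le> R"
  shows "deriv_bounded R (\<lambda>w. fst w $ i) 1 w" "deriv_bounded R (\<lambda>w. snd w $ i) 1 w"
proof -
  have le: "cmod (fst v $ i) \<le> real 1 * R ^ 1 * norm v" "cmod (snd v $ i) \<le> real 1 * R ^ 1 * norm v"
    for v :: "'n pt \<times> 'n pt"
    using norm_pair_components [of v i] mult_right_mono [OF assms(1) norm_ge_zero [of v]] by auto
  have le': "cmod (fst w $ i) \<le> R ^ 1" "cmod (snd w $ i) \<le> R ^ 1"
    using norm_pair_components [of w i] assms(2) by auto
  show "deriv_bounded R (\<lambda>w. fst w $ i) 1 w"
    unfolding deriv_bounded_def
  proof (intro conjI exI allI)
    show "((\<lambda>w. fst w $ i) has_derivative (\<lambda>w. fst w $ i)) (at w)"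
      by (intro bounded_linear_imp_has_derivative bounded_linear_compose [OF bounded_linear_vec_nth bounded_linear_fst])
  qed (rule le le' | simp add: csc_def)+
  show "deriv_bounded R (\<lambda>w. snd w $ i) 1 w"
    unfolding deriv_bounded_def
  proof (intro conjI exI allI)
    show "((\<lambda>w. snd w $ i) has_derivative (\<lambda>w. snd w $ i)) (at w)"
      by (intro bounded_linear_imp_has_derivative bounded_linear_compose [OF bounded_linear_vec_nth bounded_linear_snd])
  qed (rule le le' | simp add: csc_def)+
qed

lemma deriv_bounded_mpow:
  fixes w :: "('n::finite) pt \<times> 'n pt"
  assumes "R \<ge> 1" "norm w \<le> R"
  shows "deriv_bounded R (\<lambda>w. mpow (fst w) P * mpow (snd w) Q) (mabs P + mabs Q) w"
proof -
  have "deriv_bounded R (\<lambda>w. (fst w $ i) ^ P i) (P i) w" "deriv_bounded R (\<lambda>w. (snd w $ i) ^ Q i) (Q i) w" for i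
    using deriv_bounded_power [OF deriv_bounded_coord(1) [OF assms] assms(1), of i "P i"]
      deriv_bounded_power [OF deriv_bounded_coord(2) [OF assms] assms(1), of i "Q i"] by auto
  then show ?thesis
    unfolding mpow_def mabs_def using assms by (intro deriv_bounded_mult deriv_bounded_prod) auto
qed

text \<open>Turns an unordered sum over a countable type into a sum over nat, the form in which
  \<open>has_derivative_series\<close> can be applied.\<close>

lemma has_sum_countable_nat:
  fixes f :: "'x::countable \<Rightarrow> 'b::{comm_monoid_add,t2_space}"
  shows "(f has_sum S) UNIV \<longleftrightarrow>
    ((\<lambda>n. if n \<in> range (to_nat :: 'x \<Rightarrow> nat) then f (from_nat n) else 0) has_sum S) UNIV"
  (is "_ \<longleftrightarrow> (?g has_sum S) UNIV")
proof -
  have "(?g has_sum S) UNIV \<longleftrightarrow> (?g has_sum S) (range (to_nat :: 'x \<Rightarrow> nat))"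
    by (rule has_sum_cong_neutral) auto
  also have "\<dots> \<longleftrightarrow> ((?g \<circ> (to_nat :: 'x \<Rightarrow> nat)) has_sum S) UNIV"
    by (rule has_sum_reindex) simp
  also have "?g \<circ> (to_nat :: 'x \<Rightarrow> nat) = f" by auto
  finally show ?thesis by simp
qed

text \<open>Decrease faster than every geometric sequence in the degree \<open>N x\<close>, which is
  absolute convergence of a power series on the whole ambient space.\<close>

definition rapid :: "('x \<Rightarrow> complex) \<Rightarrow> ('x \<Rightarrow> nat) \<Rightarrow> bool" where
  "rapid c N \<longleftrightarrow> (\<forall>R\<ge>1. (\<lambda>x. cmod (c x) * R ^ N x) summable_on UNIV)"

lemma mpow_pair_bound:
  fixes p q :: "('n::finite) pt"
  assumes "\<And>i. cmod (p $ i) \<le> R" "\<And>i. cmod (q $ i) \<le> R"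
  shows "cmod (mpow p P * mpow q Q) \<le> R ^ (mabs P + mabs Q)"
proof -
  have "R \<ge> 0" using assms(1) order_trans [OF norm_ge_zero] by blast
  have "cmod (mpow p P) \<le> R ^ mabs P" "cmod (mpow q Q) \<le> R ^ mabs Q"
    unfolding mpow_def mabs_def power_sum prod_norm [symmetric] norm_power
    using assms by (auto intro!: prod_mono power_mono)
  then show ?thesis unfolding norm_mult power_add using \<open>R \<ge> 0\<close> by (intro mult_mono) auto
qed

lemma rapid_summable:
  fixes p q :: "('n::finite) pt"
  assumes "rapid c (\<lambda>x. mabs (P x) + mabs (Q x))"
  shows "(\<lambda>x. cmod (c x * (mpow p (P x) * mpow q (Q x)))) summable_on UNIV"
proof -
  define R where "R = max 1 (norm (p, q))"
  have R: "R \<ge> 1" "cmod (p $ i) \<le> R" "cmod (q $ i) \<le> R" for i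
    using norm_pair_components [of "(p, q)" i] by (auto simp: R_def)
  show ?thesis
  proof (rule Infinite_Sum.abs_summable_on_comparison_test')
    show "(\<lambda>x. cmod (c x) * R ^ (mabs (P x) + mabs (Q x))) summable_on UNIV"
      using assms R(1) by (simp add: rapid_def)
    show "cmod (c x * (mpow p (P x) * mpow q (Q x))) \<le> cmod (c x) * R ^ (mabs (P x) + mabs (Q x))" for x
      unfolding norm_mult [of "c x"] by (intro mult_left_mono mpow_pair_bound R) auto
  qed
qed

text \<open>Termwise differentiation on a ball of radius R: the derivative of a monomial of degree N
  is at most N R^N \<le> (2R)^N, and \<open>rapid\<close> at 2R dominates the series of
  derivatives.\<close>

lemma cdiff_series:
  fixes c :: "'x::countable \<Rightarrow> complex" and P Q :: "'x \<Rightarrow> ('n::finite) mi"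
  assumes c: "rapid c (\<lambda>x. mabs (P x) + mabs (Q x))"
  shows "cdiff (\<lambda>w. \<Sum>\<^sub>\<infinity>x. c x * (mpow (fst w) (P x) * mpow (snd w) (Q x))) w"
proof -
  define N where "N x = mabs (P x) + mabs (Q x)" for x
  define R where "R = norm w + 1"
  define S where "S = ball (0 :: 'n pt \<times> 'n pt) R"
  have S: "open S" "convex S" "w \<in> S" by (auto simp: S_def R_def)
  have R: "R \<ge> 1" by (simp add: R_def)
  let ?m = "\<lambda>x w. mpow (fst w) (P x) * mpow (snd w) (Q x)"
  define \<Phi> where "\<Phi> x u D \<longleftrightarrow> (?m x has_derivative D) (at u) \<and>
     (\<forall>c v. D (csc c (fst v), csc c (snd v)) = c * D v) \<and>
     (\<forall>v. cmod (D v) \<le> real (N x) * R ^ N x * norm v)" for x u D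
  define D where "D x u = (SOME D. \<Phi> x u D)" for x u
  have "\<Phi> x u (D x u)" if "u \<in> S" for x u
  proof -
    from that have "norm u \<le> R" by (simp add: S_def)
    from deriv_bounded_mpow [OF R this, of "P x" "Q x"]
    have "\<exists>D. \<Phi> x u D"
      unfolding deriv_bounded_def N_def \<Phi>_def by (rule conjunct2)
    then show ?thesis unfolding D_def by (rule someI_ex)
  qed
  then have D: "\<And>x u. u \<in> S \<Longrightarrow> (?m x has_derivative D x u) (at u)"
     "\<And>x u c v. u \<in> S \<Longrightarrow> D x u (csc c (fst v), csc c (snd v)) = c * D x u v"
     "\<And>x u v. u \<in> S \<Longrightarrow> cmod (D x u v) \<le> real (N x) * R ^ N x * norm v"
    unfolding \<Phi>_def by blast+
  define I where "I = range (to_nat :: 'x \<Rightarrow> nat)"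
  define f where "f n u = (if n \<in> I then c (from_nat n) * ?m (from_nat n) u else 0)" for n u
  define f' where "f' n u v = (if n \<in> I then c (from_nat n) * D (from_nat n) u v else 0)" for n u v
  define b where "b n = (if n \<in> I then cmod (c (from_nat n)) * (2 * R) ^ N (from_nat n) else 0)" for n
  have "(\<lambda>x. cmod (c x) * (2 * R) ^ N x) summable_on UNIV"
  proof -
    have "2 * R \<ge> 1" using R by simp
    then show ?thesis using c unfolding rapid_def N_def by blast
  qed
  then have "b summable_on UNIV"
    unfolding summable_on_def b_def I_def
    using has_sum_countable_nat [of "\<lambda>x. cmod (c x) * (2 * R) ^ N x"] by auto
  then have b: "summable b" by (rule summable_on_imp_summable)
  have f'b: "cmod (f' n u v) \<le> b n * norm v" if "u \<in> S" for n u v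
  proof (cases "n \<in> I")
    case True
    let ?x = "from_nat n :: 'x"
    have "real (N ?x) * R ^ N ?x \<le> 2 ^ N ?x * R ^ N ?x"
      using R of_nat_less_two_power [of "N ?x", where 'a = real] by (intro mult_right_mono) auto
    then have "cmod (D ?x u v) \<le> (2 * R) ^ N ?x * norm v"
      using D(3) [OF that, of ?x v] mult_right_mono [OF _ norm_ge_zero [of v]]
      by (fastforce simp: power_mult_distrib intro: order_trans)
    then show ?thesis using True
      by (simp add: f'_def b_def norm_mult mult_left_mono mult.assoc)
  qed (simp add: f'_def b_def)
  have sf': "summable (\<lambda>n. f' n u v)" if "u \<in> S" for u v
    by (rule summable_comparison_test [OF _ summable_mult2 [OF b, of "norm v"]])
      (use f'b [OF that] in blast)
  define g' where "g' u v = (\<Sum>n. f' n u v)" for u v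
  have sumsG: "(\<lambda>n. f n u) sums (\<Sum>\<^sub>\<infinity>x. c x * ?m x u)" for u
  proof -
    have "((\<lambda>x. c x * ?m x u) has_sum (\<Sum>\<^sub>\<infinity>x. c x * ?m x u)) UNIV"
      by (rule has_sum_infsum [OF abs_summable_summable [OF rapid_summable [OF c]]])
    then show ?thesis
      unfolding f_def I_def by (intro has_sum_imp_sums iffD1 [OF has_sum_countable_nat])
  qed
  have "\<exists>g. \<forall>x\<in>S. (\<lambda>n. f n x) sums (g x) \<and> (g has_derivative g' x) (at x within S)"
  proof (rule has_derivative_series [OF S(2) _ _ S(3) sumsG])
    fix n u assume u: "u \<in> S"
    show "(f n has_derivative f' n u) (at u within S)"
      using has_derivative_mult_right [OF has_derivative_at_withinI [OF D(1) [OF u]], of "c (from_nat n)" "from_nat n" S]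
      unfolding f_def [abs_def] f'_def [abs_def] by (cases "n \<in> I") auto
  next
    fix e :: real assume e: "e > 0"
    have "\<exists>M. \<forall>n\<ge>M. norm (\<Sum>i. b (i + n)) < e"
      using suminf_exist_split [OF e b] .
    then have "\<forall>\<^sub>F n in sequentially. norm (\<Sum>i. b (i + n)) < e"
      by (simp add: eventually_sequentially)
    then show "\<forall>\<^sub>F n in sequentially. \<forall>x\<in>S. \<forall>h. norm ((\<Sum>i<n. f' i x h) - g' x h) \<le> e * norm h"
    proof eventually_elim
      case (elim n)
      show ?case
      proof (intro ballI allI)
        fix u h assume u: "u \<in> S"
        have s1: "(\<lambda>i. f' (i + n) u h) sums (g' u h - (\<Sum>i<n. f' i u h))"
          unfolding g'_def by (intro sums_split_initial_segment summable_sums sf' u)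
        have s2: "(\<lambda>i. b (i + n) * norm h) sums ((\<Sum>i. b (i + n)) * norm h)"
          using b by (intro sums_mult2 summable_sums) (simp add: summable_iff_shift)
        have "cmod (g' u h - (\<Sum>i<n. f' i u h)) \<le> (\<Sum>i. b (i + n)) * norm h"
          by (rule norm_sums_le [OF s1 s2]) (rule f'b [OF u])
        also have "\<dots> \<le> e * norm h" using elim by (intro mult_right_mono) auto
        finally show "norm ((\<Sum>i<n. f' i u h) - g' u h) \<le> e * norm h"
          by (simp add: norm_minus_commute)
      qed
    qed
  qed
  then obtain g where g: "\<And>u. u \<in> S \<Longrightarrow> (\<lambda>n. f n u) sums (g u)"
      "\<And>u. u \<in> S \<Longrightarrow> (g has_derivative g' u) (at u within S)" by blast
  have gG: "g u = (\<Sum>\<^sub>\<infinity>x. c x * ?m x u)" if "u \<in> S" for u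
    using sums_unique2 [OF g(1) [OF that] sumsG] .
  have "(g has_derivative g' w) (at w)"
    using g(2) [OF S(3)] unfolding at_within_open [OF S(3,1)] .
  then have "((\<lambda>w. \<Sum>\<^sub>\<infinity>x. c x * ?m x w) has_derivative g' w) (at w)"
    by (rule has_derivative_transform_within_open [OF _ S(1,3) gG])
  moreover have "g' w (csc a (fst v), csc a (snd v)) = a * g' w v" for a v
  proof -
    have "f' n w (csc a (fst v), csc a (snd v)) = a * f' n w v" for n
      by (simp add: f'_def D(2) [OF S(3)])
    then show ?thesis unfolding g'_def using suminf_mult [OF sf' [OF S(3)], of a v] by simp
  qed
  ultimately show ?thesis unfolding cdiff_def by blast
qed

subsection \<open>Two charts of the quadric\<close>

text \<open>The part of \<open>Zhat\<close> in a polydisc. These compact sets are cofinal among all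
  compact subsets, so one real parameter indexes the seminorms.\<close>

definition KB :: "real \<Rightarrow> (('n::finite) pt \<times> 'n pt) set" where
  "KB B = {w \<in> Zhat. \<forall>i. cmod (fst w $ i) \<le> B \<and> cmod (snd w $ i) \<le> B}"

lemma KB_Zhat: "KB B \<subseteq> Zhat"
  by (auto simp: KB_def)

lemma Zhat_iff: "w \<in> Zhat \<longleftrightarrow>
  fst w $ None * snd w $ None = 1 + (\<Sum>j\<in>UNIV. fst w $ Some j * snd w $ Some j)"
  for w :: "('n::finite) pt \<times> 'n pt"
proof -
  have eq: "- a + b = -1 \<longleftrightarrow> a = 1 + b" for a b :: complex
    by (metis add.commute add_minus_cancel minus_add_distrib minus_minus)
  show ?thesis unfolding Zhat_def mem_Collect_eq case_prod_beta' eq ..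
qed

lemma closed_Zhat: "closed (Zhat :: (('n::finite) pt \<times> 'n pt) set)"
proof -
  have "Zhat = {w :: 'n pt \<times> 'n pt. fst w $ None * snd w $ None =
      1 + (\<Sum>j\<in>UNIV. fst w $ Some j * snd w $ Some j)}"
    using Zhat_iff by blast
  moreover have "closed \<dots>" by (intro closed_Collect_eq continuous_intros)
  ultimately show ?thesis by (simp only:)
qed

lemma compact_KB: "compact (KB B :: (('n::finite) pt \<times> 'n pt) set)"
proof -
  have "KB B = Zhat \<inter> (\<Inter>i. {w :: 'n pt \<times> 'n pt. cmod (fst w $ i) \<le> B} \<inter> {w. cmod (snd w $ i) \<le> B})"
    by (auto simp: KB_def)
  moreover have "closed \<dots>"
    by (intro closed_Int closed_INT closed_Zhat ballI closed_Collect_le continuous_intros)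
  ultimately have "closed (KB B :: ('n pt \<times> 'n pt) set)" by simp
  moreover have "bounded (KB B :: ('n pt \<times> 'n pt) set)"
  proof (rule boundedI)
    fix w :: "'n pt \<times> 'n pt" assume w: "w \<in> KB B"
    have "norm p \<le> (\<Sum>i\<in>(UNIV :: 'n option set). B)" if "\<And>i. cmod (p $ i) \<le> B" for p :: "'n pt"
    proof -
      have "norm p \<le> (\<Sum>i\<in>UNIV. cmod (p $ i))"
        unfolding norm_vec_def by (rule L2_set_le_sum) simp
      also have "\<dots> \<le> (\<Sum>i\<in>(UNIV :: 'n option set). B)" by (intro sum_mono that)
      finally show ?thesis .
    qed
    then have "norm (fst w) \<le> real CARD('n option) * B" "norm (snd w) \<le> real CARD('n option) * B"
      using w by (auto simp: KB_def)
    then show "norm w \<le> real CARD('n option) * B + real CARD('n option) * B"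
      using norm_Pair_le [of "fst w" "snd w"] unfolding prod.collapse by linarith
  qed
  ultimately show ?thesis by (simp add: compact_eq_bounded_closed)
qed

lemma compact_subset_KB:
  fixes K :: "(('n::finite) pt \<times> 'n pt) set"
  assumes "compact K" "K \<subseteq> Zhat"
  obtains B where "B \<ge> 1" "K \<subseteq> KB B"
proof -
  obtain b where b: "\<And>w. w \<in> K \<Longrightarrow> norm w \<le> b"
    using compact_imp_bounded [OF assms(1)] unfolding bounded_iff by blast
  show thesis
  proof (rule that [of "max 1 b"])
    show "K \<subseteq> KB (max 1 b)"
    proof
      fix w assume w: "w \<in> K"
      have "cmod (fst w $ i) \<le> max 1 b" "cmod (snd w $ i) \<le> max 1 b" for i
        using order_trans [OF norm_pair_components(1) b [OF w]]
          order_trans [OF norm_pair_components(2) b [OF w]] by (auto simp: le_max_iff_disj)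
      then show "w \<in> KB (max 1 b)" using w assms(2) by (auto simp: KB_def)
    qed
  qed simp
qed

definition mkpt :: "complex \<Rightarrow> ('n::finite \<Rightarrow> complex) \<Rightarrow> 'n pt" where
  "mkpt a u = (\<chi> i. case i of None \<Rightarrow> a | Some j \<Rightarrow> u j)"

lemma mkpt_nth [simp]: "mkpt a u $ None = a" "mkpt a u $ Some j = u j"
  by (simp_all add: mkpt_def)

lemma mkpt_eqI: "p $ None = a \<Longrightarrow> (\<And>j. p $ Some j = u j) \<Longrightarrow> p = mkpt a u"
  unfolding vec_eq_iff by (metis mkpt_nth option.exhaust)

definition dotz :: "('n::finite + 'n \<Rightarrow> complex) \<Rightarrow> complex" where
  "dotz z = (\<Sum>j\<in>UNIV. z (Inl j) * z (Inr j))"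

text \<open>The slice p_0 = 1, which every C^*-orbit with p_0 \<noteq> 0 meets exactly once;
  \<open>chart2\<close> is the slice q_0 = 1. In the index type, \<open>Inl\<close> stands for u and
  \<open>Inr\<close> for v.\<close>

definition chart1 :: "('n::finite + 'n \<Rightarrow> complex) \<Rightarrow> 'n pt \<times> 'n pt" where
  "chart1 z = (mkpt 1 (\<lambda>j. z (Inl j)), mkpt (1 + dotz z) (\<lambda>j. z (Inr j)))"

definition chart2 :: "('n::finite + 'n \<Rightarrow> complex) \<Rightarrow> 'n pt \<times> 'n pt" where
  "chart2 z = (mkpt (1 + dotz z) (\<lambda>j. z (Inl j)), mkpt 1 (\<lambda>j. z (Inr j)))"

lemma chart_Zhat: "chart1 z \<in> Zhat" "chart2 z \<in> Zhat"
  by (simp_all add: Zhat_iff chart1_def chart2_def dotz_def)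

lemma mkpt_holomorphic:
  fixes u :: "complex \<Rightarrow> 'n::finite \<Rightarrow> complex"
  assumes "a holomorphic_on S" "\<And>j. (\<lambda>s. u s j) holomorphic_on S"
  shows "(\<lambda>s. mkpt (a s) (u s) $ i) holomorphic_on S"
  by (cases i) (use assms in auto)

lemma holo_chart_curve:
  fixes F :: "('n::finite) pt \<times> 'n pt \<Rightarrow> complex"
  assumes "holo_Zhat F" "open S" "\<And>j. (\<lambda>s. w s j) holomorphic_on S"
  shows "(\<lambda>s. F (chart1 (w s))) holomorphic_on S" "(\<lambda>s. F (chart2 (w s))) holomorphic_on S"
proof -
  have d: "(\<lambda>s. 1 + dotz (w s)) holomorphic_on S"
    unfolding dotz_def by (intro holomorphic_intros assms)
  show "(\<lambda>s. F (chart1 (w s))) holomorphic_on S"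
    by (rule holo_Zhat_curve [OF assms(1,2) chart_Zhat(1)])
      (unfold chart1_def fst_conv snd_conv, (intro mkpt_holomorphic d assms(3) holomorphic_on_const)+)
  show "(\<lambda>s. F (chart2 (w s))) holomorphic_on S"
    by (rule holo_Zhat_curve [OF assms(1,2) chart_Zhat(2)])
      (unfold chart2_def fst_conv snd_conv, (intro mkpt_holomorphic d assms(3) holomorphic_on_const)+)
qed

text \<open>Dominates each kind of coordinate of a chart point whose parameters are at most R: the
  constant 1, the parameters, and 1 + uv with its n products.\<close>

definition chart_radius :: "'n::finite itself \<Rightarrow> real \<Rightarrow> real" where
  "chart_radius _ R = 1 + R + real CARD('n) * R\<^sup>2"

lemma chart_KB:
  fixes z :: "'n::finite + 'n \<Rightarrow> complex"
  assumes "\<And>j. cmod (z j) \<le> R"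
  shows "chart1 z \<in> KB (chart_radius TYPE('n) R)" "chart2 z \<in> KB (chart_radius TYPE('n) R)"
proof -
  have "R \<ge> 0" using assms order_trans [OF norm_ge_zero] by blast
  have "cmod (dotz z) \<le> (\<Sum>j\<in>(UNIV::'n set). R * R)"
    unfolding dotz_def
  proof (rule sum_norm_le)
    show "cmod (z (Inl j) * z (Inr j)) \<le> R * R" for j
      unfolding norm_mult using assms \<open>R \<ge> 0\<close> by (intro mult_mono) auto
  qed
  then have d: "cmod (1 + dotz z) \<le> chart_radius TYPE('n) R"
    using norm_triangle_ineq [of 1 "dotz z"] \<open>R \<ge> 0\<close>
    by (simp add: chart_radius_def power2_eq_square)
  have r: "R \<le> chart_radius TYPE('n) R" "1 \<le> chart_radius TYPE('n) R"
    using \<open>R \<ge> 0\<close> by (simp_all add: chart_radius_def)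
  have mk: "cmod (mkpt a u $ i) \<le> C" if "cmod a \<le> C" "\<And>j. cmod (u j) \<le> C"
    for a C i and u :: "'n \<Rightarrow> complex"
    by (cases i) (use that in auto)
  show "chart1 z \<in> KB (chart_radius TYPE('n) R)" "chart2 z \<in> KB (chart_radius TYPE('n) R)"
    using d r order_trans [OF assms r(1)] chart_Zhat [of z]
    unfolding KB_def chart1_def chart2_def by (auto intro!: mk)
qed

lemma hol_bound_KB:
  fixes F :: "('n::finite) pt \<times> 'n pt \<Rightarrow> complex"
  assumes "holo_Zhat F"
  obtains M where "\<And>w. w \<in> KB B \<Longrightarrow> cmod (F w) \<le> M"
proof -
  have "compact (F ` KB B)"
    by (intro compact_continuous_image compact_KB continuous_on_subset
      [OF holo_Zhat_continuous [OF assms] KB_Zhat])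
  from compact_imp_bounded [OF this] show thesis
    unfolding bounded_iff using that by auto
qed

lemma sep_entire_chart:
  fixes F :: "('n::finite) pt \<times> 'n pt \<Rightarrow> complex"
  assumes "holo_Zhat F"
  shows "sep_entire (\<lambda>z. F (chart1 z))" "sep_entire (\<lambda>z. F (chart2 z))"
proof -
  have upd: "(\<lambda>s. (z(i := s)) j) holomorphic_on UNIV" for z :: "'n + 'n \<Rightarrow> complex" and i j
    by (cases "j = i") auto
  have bd: "\<exists>M. \<forall>z. (\<forall>i. cmod (z i) \<le> R) \<longrightarrow> cmod (F (chart1 z)) \<le> M"
     "\<exists>M. \<forall>z. (\<forall>i. cmod (z i) \<le> R) \<longrightarrow> cmod (F (chart2 z)) \<le> M" for R
  proof -
    obtain M where "\<And>w. w \<in> KB (chart_radius TYPE('n) R) \<Longrightarrow> cmod (F w) \<le> M"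
      using hol_bound_KB [OF assms] by blast
    then show "\<exists>M. \<forall>z. (\<forall>i. cmod (z i) \<le> R) \<longrightarrow> cmod (F (chart1 z)) \<le> M"
      "\<exists>M. \<forall>z. (\<forall>i. cmod (z i) \<le> R) \<longrightarrow> cmod (F (chart2 z)) \<le> M"
      using chart_KB by blast+
  qed
  show "sep_entire (\<lambda>z. F (chart1 z))" "sep_entire (\<lambda>z. F (chart2 z))"
    unfolding sep_entire_def by (intro conjI allI holo_chart_curve [OF assms open_UNIV upd] bd)+
qed

subsection \<open>The expansion into reduced monomials\<close>

definition degL :: "('n::finite + 'n \<Rightarrow> nat) \<Rightarrow> nat" where
  "degL \<alpha> = (\<Sum>j\<in>UNIV. \<alpha> (Inl j))"

definition degR :: "('n::finite + 'n \<Rightarrow> nat) \<Rightarrow> nat" where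
  "degR \<alpha> = (\<Sum>j\<in>UNIV. \<alpha> (Inr j))"

text \<open>The truncated subtractions make \<open>min (redP \<alpha> None) (redQ \<alpha> None) = 0\<close> and
  \<open>mabs (redP \<alpha>) = mabs (redQ \<alpha>)\<close>.\<close>

definition redP :: "('n::finite + 'n \<Rightarrow> nat) \<Rightarrow> 'n mi" where
  "redP \<alpha> i = (case i of None \<Rightarrow> degR \<alpha> - degL \<alpha> | Some j \<Rightarrow> \<alpha> (Inl j))"

definition redQ :: "('n::finite + 'n \<Rightarrow> nat) \<Rightarrow> 'n mi" where
  "redQ \<alpha> i = (case i of None \<Rightarrow> degL \<alpha> - degR \<alpha> | Some j \<Rightarrow> \<alpha> (Inr j))"

lemma sum_UNIV_option: "(\<Sum>i\<in>UNIV. f i) = f None + (\<Sum>j\<in>UNIV. f (Some j))"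
  for f :: "'n::finite option \<Rightarrow> 'b::comm_monoid_add"
  by (simp add: UNIV_option_conv sum.reindex)

lemma prod_UNIV_option: "(\<Prod>i\<in>UNIV. f i) = f None * (\<Prod>j\<in>UNIV. f (Some j))"
  for f :: "'n::finite option \<Rightarrow> 'b::comm_monoid_mult"
  by (simp add: UNIV_option_conv prod.reindex)

lemma sum_UNIV_sum: "(\<Sum>i\<in>UNIV. f i) = (\<Sum>j\<in>UNIV. f (Inl j)) + (\<Sum>j\<in>UNIV. f (Inr j))"
  for f :: "'n::finite + 'n \<Rightarrow> 'b::comm_monoid_add"
  using sum.Plus [of "UNIV::'n set" "UNIV::'n set" f] by (simp add: comp_def)

lemma prod_UNIV_sum: "(\<Prod>i\<in>UNIV. f i) = (\<Prod>j\<in>UNIV. f (Inl j)) * (\<Prod>j\<in>UNIV. f (Inr j))"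
  for f :: "'n::finite + 'n \<Rightarrow> 'b::comm_monoid_mult"
  using prod.Plus [of "UNIV::'n set" "UNIV::'n set" f] by (simp add: comp_def)

lemma deg_sum: "sum \<alpha> UNIV = degL \<alpha> + degR \<alpha>"
  by (simp add: degL_def degR_def sum_UNIV_sum)

lemma mabs_red: "mabs (redP \<alpha>) = max (degL \<alpha>) (degR \<alpha>)" "mabs (redQ \<alpha>) = max (degL \<alpha>) (degR \<alpha>)"
  unfolding mabs_def sum_UNIV_option redP_def redQ_def option.case degL_def [symmetric] degR_def [symmetric]
  by auto

lemma mabs_red_le: "mabs (redP \<alpha>) + mabs (redQ \<alpha>) \<le> 2 * sum \<alpha> UNIV"
  unfolding mabs_red deg_sum by auto

definition pmon :: "('n::finite) pt \<times> 'n pt \<Rightarrow> ('n + 'n \<Rightarrow> nat) \<Rightarrow> complex" where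
  "pmon w \<alpha> = (\<Prod>j\<in>UNIV. (fst w $ Some j) ^ \<alpha> (Inl j)) * (\<Prod>j\<in>UNIV. (snd w $ Some j) ^ \<alpha> (Inr j))"

lemma mpow_red:
  "mpow p (redP \<alpha>) * mpow q (redQ \<alpha>) =
    (p $ None) ^ (degR \<alpha> - degL \<alpha>) * (q $ None) ^ (degL \<alpha> - degR \<alpha>) * pmon (p, q) \<alpha>"
  unfolding mpow_def prod_UNIV_option redP_def redQ_def pmon_def by (simp add: mult_ac)

text \<open>R^N is at most (R^2)^|\<alpha>|, and the assumed bound at the larger radius 2 R^2 leaves
  the summable factor (1/2)^|\<alpha>|.\<close>

lemma rapid_if_bounded:
  fixes c :: "('i::finite \<Rightarrow> nat) \<Rightarrow> complex"
  assumes "\<And>R. R \<ge> 1 \<Longrightarrow> \<exists>M. \<forall>\<alpha>. cmod (c \<alpha>) * R ^ sum \<alpha> UNIV \<le> M"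
    and "\<And>\<alpha>. N \<alpha> \<le> 2 * sum \<alpha> UNIV"
  shows "rapid c N"
  unfolding rapid_def
proof (intro allI impI)
  fix R :: real assume R: "R \<ge> 1"
  then have "R\<^sup>2 \<ge> 1" by (rule one_le_power)
  then have "2 * R\<^sup>2 \<ge> 1" by linarith
  then obtain M where M: "\<And>\<alpha>. cmod (c \<alpha>) * (2 * R\<^sup>2) ^ sum \<alpha> UNIV \<le> M"
    using assms(1) by blast
  have "(\<lambda>\<alpha>. cmod (cmod (c \<alpha>) * R ^ N \<alpha>)) summable_on UNIV"
  proof (rule Infinite_Sum.abs_summable_on_comparison_test')
    show "(\<lambda>\<alpha>. M * (1/2) ^ sum \<alpha> UNIV) summable_on (UNIV :: ('i \<Rightarrow> nat) set)"
      by (intro summable_on_cmult_right geometric_multiindex_summable) auto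
    fix \<alpha> :: "'i \<Rightarrow> nat"
    have "cmod (c \<alpha>) * R ^ N \<alpha> \<le> cmod (c \<alpha>) * R ^ (2 * sum \<alpha> UNIV)"
      using R assms(2) by (intro mult_left_mono power_increasing) auto
    also have "\<dots> = (cmod (c \<alpha>) * (2 * R\<^sup>2) ^ sum \<alpha> UNIV) * (1/2) ^ sum \<alpha> UNIV"
      by (simp add: power_mult power_mult_distrib power_divide)
    also have "\<dots> \<le> M * (1/2) ^ sum \<alpha> UNIV" by (intro mult_right_mono M) auto
    finally show "cmod (cmod (c \<alpha>) * R ^ N \<alpha>) \<le> M * (1/2) ^ sum \<alpha> UNIV"
      using R by (simp add: norm_mult norm_power)
  qed
  then show "(\<lambda>\<alpha>. cmod (c \<alpha>) * R ^ N \<alpha>) summable_on UNIV"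
    using R by (simp add: norm_mult norm_power)
qed

text \<open>For \<open>degL \<alpha> \<le> degR \<alpha>\<close> the reduced monomial contains no
  q_0 and restricts on \<open>chart1\<close>, where p_0 = 1, to a plain monomial in (u,v); in the
  other case the same holds on \<open>chart2\<close>.\<close>

definition hat_coef :: "(('n::finite) pt \<times> 'n pt \<Rightarrow> complex) \<Rightarrow> ('n + 'n \<Rightarrow> nat) \<Rightarrow> complex" where
  "hat_coef F \<alpha> = (if degL \<alpha> \<le> degR \<alpha> then taylor_coef \<alpha> (\<lambda>z. F (chart1 z)) else taylor_coef \<alpha> (\<lambda>z. F (chart2 z)))"

lemma taylor_coef_chart_bound:
  fixes F :: "('n::finite) pt \<times> 'n pt \<Rightarrow> complex"
  assumes "holo_Zhat F" "R \<ge> 1" "\<And>w. w \<in> KB (chart_radius TYPE('n) R) \<Longrightarrow> cmod (F w) \<le> M"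
  shows "cmod (taylor_coef \<alpha> (\<lambda>z. F (chart1 z))) * R ^ sum \<alpha> UNIV \<le> M"
    "cmod (taylor_coef \<alpha> (\<lambda>z. F (chart2 z))) * R ^ sum \<alpha> UNIV \<le> M"
proof -
  have "cmod (taylor_coef \<alpha> (\<lambda>z. F (chart1 z))) \<le> M / R ^ sum \<alpha> UNIV"
    "cmod (taylor_coef \<alpha> (\<lambda>z. F (chart2 z))) \<le> M / R ^ sum \<alpha> UNIV"
    using assms(2) by (auto intro!: taylor_coef_bound sep_entire_chart assms chart_KB)
  then show "cmod (taylor_coef \<alpha> (\<lambda>z. F (chart1 z))) * R ^ sum \<alpha> UNIV \<le> M"
    "cmod (taylor_coef \<alpha> (\<lambda>z. F (chart2 z))) * R ^ sum \<alpha> UNIV \<le> M"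
    using assms(2) by (simp_all add: field_simps)
qed

lemma hat_coef_bound:
  fixes F :: "('n::finite) pt \<times> 'n pt \<Rightarrow> complex"
  assumes "holo_Zhat F" "R \<ge> 1" "\<And>w. w \<in> KB (chart_radius TYPE('n) R) \<Longrightarrow> cmod (F w) \<le> M"
  shows "cmod (hat_coef F \<alpha>) * R ^ sum \<alpha> UNIV \<le> M"
  unfolding hat_coef_def using taylor_coef_chart_bound [OF assms] by auto

lemma rapid_taylor_coef_chart:
  fixes F :: "('n::finite) pt \<times> 'n pt \<Rightarrow> complex"
  assumes "holo_Zhat F"
  shows "rapid (\<lambda>\<alpha>. taylor_coef \<alpha> (\<lambda>z. F (chart1 z))) (\<lambda>\<alpha>. mabs (redP \<alpha>) + mabs (redQ \<alpha>))"
    "rapid (\<lambda>\<alpha>. taylor_coef \<alpha> (\<lambda>z. F (chart2 z))) (\<lambda>\<alpha>. mabs (redP \<alpha>) + mabs (redQ \<alpha>))"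
    "rapid (hat_coef F) (\<lambda>\<alpha>. mabs (redP \<alpha>) + mabs (redQ \<alpha>))"
proof -
  have "\<exists>M. \<forall>w\<in>KB (chart_radius TYPE('n) R). cmod (F w) \<le> M" for R
    using hol_bound_KB [OF assms] by metis
  then show "rapid (\<lambda>\<alpha>. taylor_coef \<alpha> (\<lambda>z. F (chart1 z))) (\<lambda>\<alpha>. mabs (redP \<alpha>) + mabs (redQ \<alpha>))"
    "rapid (\<lambda>\<alpha>. taylor_coef \<alpha> (\<lambda>z. F (chart2 z))) (\<lambda>\<alpha>. mabs (redP \<alpha>) + mabs (redQ \<alpha>))"
    "rapid (hat_coef F) (\<lambda>\<alpha>. mabs (redP \<alpha>) + mabs (redQ \<alpha>))"
    using taylor_coef_chart_bound [OF assms] hat_coef_bound [OF assms]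
    by (intro rapid_if_bounded mabs_red_le; metis)+
qed

text \<open>The regular part in x of a chart expansion along \<open>cslice w x\<close>;
  \<open>sminus\<close> is the principal part. The terms with
  \<open>degL \<alpha> = degR \<alpha>\<close> belong to \<open>splus\<close>, so that
  \<open>sminus\<close> vanishes at infinity.\<close>

definition splus :: "('n::finite) pt \<times> 'n pt \<Rightarrow> (('n + 'n \<Rightarrow> nat) \<Rightarrow> complex) \<Rightarrow> complex \<Rightarrow> ('n + 'n \<Rightarrow> nat) \<Rightarrow> complex" where
  "splus w c x \<alpha> = (if degL \<alpha> \<le> degR \<alpha> then c \<alpha> * x ^ (degR \<alpha> - degL \<alpha>) * pmon w \<alpha> else 0)"

definition sminus :: "('n::finite) pt \<times> 'n pt \<Rightarrow> (('n + 'n \<Rightarrow> nat) \<Rightarrow> complex) \<Rightarrow> complex \<Rightarrow> ('n + 'n \<Rightarrow> nat) \<Rightarrow> complex" where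
  "sminus w c x \<alpha> = (if degL \<alpha> \<le> degR \<alpha> then 0 else c \<alpha> * (1 / x) ^ (degL \<alpha> - degR \<alpha>) * pmon w \<alpha>)"

lemma pmon_mkpt: "pmon (mkpt a (\<lambda>j. fst w $ Some j), mkpt b (\<lambda>j. snd w $ Some j)) \<alpha> = pmon w \<alpha>"
  by (simp add: pmon_def)

text \<open>When only terms with \<open>degL \<alpha> \<le> degR \<alpha>\<close> are kept, q_0
  occurs with exponent 0, and the value 0 chosen for it contributes 0^0 = 1. The regular part thus
  becomes an ambient series in the point, to which \<open>cdiff_series\<close> applies.\<close>

lemma splus_eq_mpow:
  "splus w c x \<alpha> = (if degL \<alpha> \<le> degR \<alpha> then c \<alpha> else 0) *
    (mpow (mkpt x (\<lambda>j. fst w $ Some j)) (redP \<alpha>) * mpow (mkpt 0 (\<lambda>j. snd w $ Some j)) (redQ \<alpha>))"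
  unfolding mpow_red pmon_mkpt by (simp add: splus_def)

lemma sminus_eq_mpow:
  "sminus w c x \<alpha> = (if degL \<alpha> \<le> degR \<alpha> then 0 else c \<alpha>) *
    (mpow (mkpt 0 (\<lambda>j. fst w $ Some j)) (redP \<alpha>) * mpow (mkpt (1 / x) (\<lambda>j. snd w $ Some j)) (redQ \<alpha>))"
  unfolding mpow_red pmon_mkpt by (simp add: sminus_def)

lemma rapid_mono:
  assumes "rapid c N" "\<And>x. cmod (d x) \<le> cmod (c x)"
  shows "rapid d N"
  unfolding rapid_def
proof (intro allI impI)
  fix R :: real assume R: "1 \<le> R"
  show "(\<lambda>x. cmod (d x) * R ^ N x) summable_on UNIV"
  proof (rule summable_on_comparison_test)
    show "(\<lambda>x. cmod (c x) * R ^ N x) summable_on UNIV" using assms(1) R by (simp add: rapid_def)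
    show "cmod (d x) * R ^ N x \<le> cmod (c x) * R ^ N x" for x
      using R by (intro mult_right_mono assms(2)) auto
    show "0 \<le> cmod (d x) * R ^ N x" for x using R by auto
  qed
qed

lemma
  assumes "rapid c (\<lambda>\<alpha>. mabs (redP \<alpha>) + mabs (redQ \<alpha>))"
  shows splus_summable: "(\<lambda>\<alpha>. cmod (splus w c x \<alpha>)) summable_on UNIV"
    and sminus_summable: "(\<lambda>\<alpha>. cmod (sminus w c x \<alpha>)) summable_on UNIV"
    and splus_holomorphic: "(\<lambda>x. \<Sum>\<^sub>\<infinity>\<alpha>. splus w c x \<alpha>) holomorphic_on UNIV"
proof -
  have r: "rapid (\<lambda>\<alpha>. if degL \<alpha> \<le> degR \<alpha> then c \<alpha> else 0) (\<lambda>\<alpha>. mabs (redP \<alpha>) + mabs (redQ \<alpha>))"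
    by (rule rapid_mono [OF assms]) auto
  show "(\<lambda>\<alpha>. cmod (splus w c x \<alpha>)) summable_on UNIV"
    unfolding splus_eq_mpow by (rule rapid_summable [OF r])
  show "(\<lambda>\<alpha>. cmod (sminus w c x \<alpha>)) summable_on UNIV"
    unfolding sminus_eq_mpow by (rule rapid_summable [OF rapid_mono [OF assms]]) auto
  show "(\<lambda>x. \<Sum>\<^sub>\<infinity>\<alpha>. splus w c x \<alpha>) holomorphic_on UNIV"
    unfolding holomorphic_on_def
  proof
    fix x :: complex
    have d: "(\<lambda>s. mkpt s (\<lambda>j. fst w $ Some j) $ i) field_differentiable at x"
       "(\<lambda>s. mkpt 0 (\<lambda>j. snd w $ Some j) $ i) field_differentiable at x" for i
      by (cases i; simp)+
    show "(\<lambda>x. \<Sum>\<^sub>\<infinity>\<alpha>. splus w c x \<alpha>) field_differentiable at x within UNIV"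
      using cdiff_curve [OF cdiff_series [OF r],
        of "\<lambda>x. (mkpt x (\<lambda>j. fst w $ Some j), mkpt 0 (\<lambda>j. snd w $ Some j))" x] d
      unfolding splus_eq_mpow by simp
  qed
qed

text \<open>Every nonzero term has at least one factor 1/x. For |x| \<ge> 1 it can be taken out,
  leaving the absolutely convergent series at x = 1.\<close>

lemma sminus_tendsto:
  fixes w :: "('n::finite) pt \<times> 'n pt"
  assumes "rapid c (\<lambda>\<alpha>. mabs (redP \<alpha>) + mabs (redQ \<alpha>))"
  shows "((\<lambda>x. \<Sum>\<^sub>\<infinity>\<alpha>. sminus w c x \<alpha>) \<longlongrightarrow> 0) at_infinity"
proof -
  define C where "C = (\<Sum>\<^sub>\<infinity>\<alpha>. cmod (sminus w c 1 \<alpha>))"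
  have bound: "cmod (\<Sum>\<^sub>\<infinity>\<alpha>. sminus w c x \<alpha>) \<le> C * cmod (1 / x)" if "cmod x \<ge> 1" for x
  proof -
    have "cmod (\<Sum>\<^sub>\<infinity>\<alpha>. sminus w c x \<alpha>) \<le> (\<Sum>\<^sub>\<infinity>\<alpha>. cmod (sminus w c x \<alpha>))"
      by (intro norm_infsum_bound sminus_summable assms)
    also have "\<dots> \<le> (\<Sum>\<^sub>\<infinity>\<alpha>. cmod (sminus w c 1 \<alpha>) * cmod (1 / x))"
    proof (intro infsum_mono sminus_summable assms summable_on_cmult_left)
      fix \<alpha> :: "'n + 'n \<Rightarrow> nat"
      have "cmod ((1 / x) ^ (degL \<alpha> - degR \<alpha>)) \<le> cmod (1 / x)" if "\<not> degL \<alpha> \<le> degR \<alpha>"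
      proof -
        have "cmod (1 / x) ^ (degL \<alpha> - degR \<alpha>) \<le> cmod (1 / x) ^ 1"
          using that \<open>cmod x \<ge> 1\<close> by (intro power_decreasing) (auto simp: norm_divide divide_le_eq)
        then show ?thesis by (simp add: norm_power)
      qed
      from mult_right_mono [OF mult_left_mono [OF this norm_ge_zero [of "c \<alpha>"]] norm_ge_zero [of "pmon w \<alpha>"]]
      show "cmod (sminus w c x \<alpha>) \<le> cmod (sminus w c 1 \<alpha>) * cmod (1 / x)"
        by (simp add: sminus_def norm_mult mult_ac)
    qed
    also have "\<dots> = C * cmod (1 / x)"
      unfolding C_def by (rule infsum_cmult_left')
    finally show ?thesis .
  qed
  have "((\<lambda>x::complex. C * cmod (1 / x)) \<longlongrightarrow> C * 0) at_infinity"
    using tendsto_norm_zero [OF tendsto_inverse_0 [where 'a = complex]]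
    by (intro tendsto_mult_left) (simp add: inverse_eq_divide)
  then have lim: "((\<lambda>x::complex. C * cmod (1 / x)) \<longlongrightarrow> 0) at_infinity"
    unfolding mult_zero_right .
  show ?thesis
  proof (rule Lim_null_comparison [OF _ lim])
    show "\<forall>\<^sub>F x in at_infinity. cmod (\<Sum>\<^sub>\<infinity>\<alpha>. sminus w c x \<alpha>) \<le> C * cmod (1 / x)"
      unfolding eventually_at_infinity using bound by blast
  qed
qed

text \<open>For x = p_0 these are the \<open>chart1\<close> coordinates of the orbit of w. Leaving x
  free gives the Laurent variable, while the products u_j v_j do not depend on it.\<close>

definition cslice :: "('n::finite) pt \<times> 'n pt \<Rightarrow> complex \<Rightarrow> 'n + 'n \<Rightarrow> complex" where
  "cslice w x = case_sum (\<lambda>j. fst w $ Some j / x) (\<lambda>j. x * snd w $ Some j)"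

lemma cslice_sum:
  assumes g: "sep_entire g" "x \<noteq> 0"
    and "rapid (\<lambda>\<alpha>. taylor_coef \<alpha> g) (\<lambda>\<alpha>. mabs (redP \<alpha>) + mabs (redQ \<alpha>))"
  shows "g (cslice w x) = (\<Sum>\<^sub>\<infinity>\<alpha>. splus w (\<lambda>\<alpha>. taylor_coef \<alpha> g) x \<alpha>) + (\<Sum>\<^sub>\<infinity>\<alpha>. sminus w (\<lambda>\<alpha>. taylor_coef \<alpha> g) x \<alpha>)"
proof -
  have mon: "multi_monom \<alpha> (cslice w x) = x ^ degR \<alpha> / x ^ degL \<alpha> * pmon w \<alpha>" for \<alpha>
    by (simp add: multi_monom_def prod_UNIV_sum cslice_def pmon_def power_divide prod_dividef
      power_mult_distrib prod.distrib power_sum degL_def degR_def)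
  have "x ^ degR \<alpha> / x ^ degL \<alpha> = (if degL \<alpha> \<le> degR \<alpha> then x ^ (degR \<alpha> - degL \<alpha>)
      else (1 / x) ^ (degL \<alpha> - degR \<alpha>))" for \<alpha> :: "'a + 'a \<Rightarrow> nat"
    using assms(2) by (auto simp: power_diff power_one_over field_simps)
  then have "taylor_coef \<alpha> g * multi_monom \<alpha> (cslice w x) =
      splus w (\<lambda>\<alpha>. taylor_coef \<alpha> g) x \<alpha> + sminus w (\<lambda>\<alpha>. taylor_coef \<alpha> g) x \<alpha>" for \<alpha>
    unfolding mon splus_def sminus_def by simp
  then have "((\<lambda>\<alpha>. splus w (\<lambda>\<alpha>. taylor_coef \<alpha> g) x \<alpha> + sminus w (\<lambda>\<alpha>. taylor_coef \<alpha> g) x \<alpha>) has_sum g (cslice w x)) UNIV"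
    using taylor_coef_has_sum [OF g(1), of "cslice w x"] by simp
  then have "g (cslice w x) = (\<Sum>\<^sub>\<infinity>\<alpha>. splus w (\<lambda>\<alpha>. taylor_coef \<alpha> g) x \<alpha> + sminus w (\<lambda>\<alpha>. taylor_coef \<alpha> g) x \<alpha>)"
    by (rule infsumI [symmetric])
  also have "\<dots> = (\<Sum>\<^sub>\<infinity>\<alpha>. splus w (\<lambda>\<alpha>. taylor_coef \<alpha> g) x \<alpha>) + (\<Sum>\<^sub>\<infinity>\<alpha>. sminus w (\<lambda>\<alpha>. taylor_coef \<alpha> g) x \<alpha>)"
    by (rule infsum_add [OF abs_summable_summable [OF splus_summable [OF assms(3)]]
      abs_summable_summable [OF sminus_summable [OF assms(3)]]])
  finally show ?thesis .
qed

lemma dotz_cslice: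
  assumes "w \<in> Zhat" "x \<noteq> 0"
  shows "1 + dotz (cslice w x) = fst w $ None * snd w $ None"
proof -
  have "dotz (cslice w x) = (\<Sum>j\<in>UNIV. fst w $ Some j * snd w $ Some j)"
    unfolding dotz_def cslice_def using assms by (intro sum.cong) auto
  then show ?thesis using assms(1) unfolding Zhat_iff by simp
qed

text \<open>Scaling by 1/p_0 moves w within its orbit into the slice p_0 = 1.\<close>

lemma hol_Dhat_chart1:
  assumes "hol_Dhat F" "w \<in> Zhat" "fst w $ None \<noteq> 0"
  shows "F w = F (chart1 (cslice w (fst w $ None)))"
proof -
  have "chart1 (cslice w (fst w $ None)) = (csc (1 / fst w $ None) (fst w), csc (1 / (1 / fst w $ None)) (snd w))"
    unfolding chart1_def dotz_cslice [OF assms(2,3)]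
    by (intro arg_cong2 [of _ _ _ _ Pair] mkpt_eqI [symmetric]) (use assms in \<open>auto simp: csc_def cslice_def\<close>)
  then show ?thesis
    using assms unfolding hol_Dhat_def cstar_inv_def
    by (metis prod.collapse divide_eq_0_iff one_neq_zero)
qed

text \<open>Rescaling \<open>p \<mapsto> p/x\<close>, \<open>q \<mapsto> xq\<close> away from the index 0 turns both chart expansions into Laurent
  series in \<open>x\<close>. They agree, so their regular parts differ by an entire function that vanishes at
  infinity, and one may take the regular part from the first chart and the principal part from
  the second.\<close>

lemma reduced_expansion_generic:
  fixes F :: "('n::finite) pt \<times> 'n pt \<Rightarrow> complex"
  assumes F: "hol_Dhat F" and w: "w \<in> Zhat" "fst w $ None \<noteq> 0" "snd w $ None \<noteq> 0"
  shows "F w = (\<Sum>\<^sub>\<infinity>\<alpha>. hat_coef F \<alpha> * (mpow (fst w) (redP \<alpha>) * mpow (snd w) (redQ \<alpha>)))"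
proof -
  let ?p0 = "fst w $ None" and ?q0 = "snd w $ None"
  let ?c1 = "\<lambda>\<alpha>. taylor_coef \<alpha> (\<lambda>z. F (chart1 z))" and ?c2 = "\<lambda>\<alpha>. taylor_coef \<alpha> (\<lambda>z. F (chart2 z))"
  define \<kappa> where "\<kappa> = ?p0 * ?q0"
  have hol: "holo_Zhat F" and inv: "cstar_inv F" using F by (auto simp: hol_Dhat_def)
  note r = rapid_taylor_coef_chart [OF hol]
  have \<kappa>0: "\<kappa> \<noteq> 0" using w by (simp add: \<kappa>_def)
  have dot: "1 + dotz (cslice w x) = \<kappa>" if "x \<noteq> 0" for x
    unfolding \<kappa>_def by (rule dotz_cslice [OF w(1) that])
  \<comment> \<open>Both chart points lie on one C^*-orbit: the second is \<kappa> = p_0 q_0 times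
    the first. This accounts for the rescaled argument x/\<kappa> in the second chart.\<close>
  have rel: "F (chart2 (cslice w (x / \<kappa>))) = F (chart1 (cslice w x))" if x: "x \<noteq> 0" for x
  proof -
    have x': "x / \<kappa> \<noteq> 0" using x \<kappa>0 by simp
    have "chart2 (cslice w (x / \<kappa>)) = (csc \<kappa> (fst (chart1 (cslice w x))), csc (1 / \<kappa>) (snd (chart1 (cslice w x))))"
      unfolding chart1_def chart2_def dot [OF x] dot [OF x'] fst_conv snd_conv
      by (intro arg_cong2 [of _ _ _ _ Pair] mkpt_eqI [symmetric]) (use \<kappa>0 in \<open>auto simp: csc_def cslice_def\<close>)
    then show ?thesis
      using inv chart_Zhat(1) [of "cslice w x"] \<kappa>0 unfolding cstar_inv_def by (metis prod.collapse)
  qed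
  have Fw: "F w = F (chart1 (cslice w ?p0))"
    by (rule hol_Dhat_chart1 [OF F w(1,2)])
  define E where "E x = (\<Sum>\<^sub>\<infinity>\<alpha>. splus w ?c1 x \<alpha>) - (\<Sum>\<^sub>\<infinity>\<alpha>. splus w ?c2 (x / \<kappa>) \<alpha>)" for x
  have E: "E x = (\<Sum>\<^sub>\<infinity>\<alpha>. sminus w ?c2 (x / \<kappa>) \<alpha>) - (\<Sum>\<^sub>\<infinity>\<alpha>. sminus w ?c1 x \<alpha>)" if "x \<noteq> 0" for x
  proof -
    have "x / \<kappa> \<noteq> 0" using that \<kappa>0 by simp
    from rel [OF that] cslice_sum [OF sep_entire_chart(2) [OF hol] this r(2)]
      cslice_sum [OF sep_entire_chart(1) [OF hol] that r(1)]
    show ?thesis unfolding E_def by (simp add: algebra_simps)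
  qed
  have div: "filterlim (\<lambda>x. x / \<kappa>) at_infinity at_infinity"
  proof -
    have "filterlim (\<lambda>x. inverse \<kappa> * x) at_infinity at_infinity"
      using \<kappa>0 by (intro tendsto_mult_filterlim_at_infinity [OF tendsto_const _ filterlim_ident]) auto
    then show ?thesis by (simp add: divide_inverse mult.commute)
  qed
  have "E x = 0" for x
  proof (rule Liouville_weak_0 [of E])
    have "(\<lambda>x. (\<Sum>\<^sub>\<infinity>\<alpha>. splus w ?c2 x \<alpha>)) \<circ> (\<lambda>x. x / \<kappa>) holomorphic_on UNIV"
      by (intro holomorphic_on_compose holomorphic_on_subset [OF splus_holomorphic [OF r(2)]] holomorphic_intros)
        (use \<kappa>0 in auto)
    then show "E holomorphic_on UNIV"
      unfolding E_def comp_def by (intro holomorphic_on_diff splus_holomorphic r)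
    have "((\<lambda>x. (\<Sum>\<^sub>\<infinity>\<alpha>. sminus w ?c2 (x / \<kappa>) \<alpha>) - (\<Sum>\<^sub>\<infinity>\<alpha>. sminus w ?c1 x \<alpha>)) \<longlongrightarrow> 0 - 0) at_infinity"
      by (intro tendsto_diff sminus_tendsto r filterlim_compose [OF sminus_tendsto [OF r(2)] div])
    moreover have "\<forall>\<^sub>F x in at_infinity. (\<Sum>\<^sub>\<infinity>\<alpha>. sminus w ?c2 (x / \<kappa>) \<alpha>) - (\<Sum>\<^sub>\<infinity>\<alpha>. sminus w ?c1 x \<alpha>) = E x"
      unfolding eventually_at_infinity
    proof (intro exI [of _ 1] allI impI)
      fix x :: complex assume "1 \<le> norm x"
      then have "x \<noteq> 0" by auto
      from E [OF this] show "(\<Sum>\<^sub>\<infinity>\<alpha>. sminus w ?c2 (x / \<kappa>) \<alpha>) - (\<Sum>\<^sub>\<infinity>\<alpha>. sminus w ?c1 x \<alpha>) = E x" by simp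
    qed
    ultimately show "(E \<longlongrightarrow> 0) at_infinity"
      using Lim_transform_eventually by fastforce
  qed
  then have "(\<Sum>\<^sub>\<infinity>\<alpha>. sminus w ?c1 ?p0 \<alpha>) = (\<Sum>\<^sub>\<infinity>\<alpha>. sminus w ?c2 (?p0 / \<kappa>) \<alpha>)"
    using E [OF w(2)] by simp
  \<comment> \<open>Since \<open>sminus\<close> inverts its argument, evaluation at 1/q_0 produces
    exactly the positive powers of q_0 in the reduced monomials.\<close>
  moreover have "?p0 / \<kappa> = 1 / ?q0" using w by (simp add: \<kappa>_def)
  ultimately have "F w = (\<Sum>\<^sub>\<infinity>\<alpha>. splus w ?c1 ?p0 \<alpha>) + (\<Sum>\<^sub>\<infinity>\<alpha>. sminus w ?c2 (1 / ?q0) \<alpha>)"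
    unfolding Fw cslice_sum [OF sep_entire_chart(1) [OF hol] w(2) r(1)] by simp
  also have "\<dots> = (\<Sum>\<^sub>\<infinity>\<alpha>. splus w ?c1 ?p0 \<alpha> + sminus w ?c2 (1 / ?q0) \<alpha>)"
    by (rule infsum_add [OF abs_summable_summable [OF splus_summable [OF r(1)]]
      abs_summable_summable [OF sminus_summable [OF r(2)]], symmetric])
  also have "\<dots> = (\<Sum>\<^sub>\<infinity>\<alpha>. hat_coef F \<alpha> * (mpow (fst w) (redP \<alpha>) * mpow (snd w) (redQ \<alpha>)))"
    unfolding mpow_red by (intro infsum_cong) (simp add: splus_def sminus_def hat_coef_def)
  finally show ?thesis .
qed

subsection \<open>Uniqueness of the holomorphic extension\<close>

text \<open>Each point of the quadric is a limit of points with no vanishing coordinate: shift all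
  coordinates by t and divide q by the value N t of the quadratic form, which tends to 1, to return
  to \<open>Zhat\<close>.\<close>

lemma generic_dense:
  fixes w :: "('n::finite) pt \<times> 'n pt"
  assumes cont: "continuous_on Zhat F" and w: "w \<in> Zhat"
    and zero: "\<And>w. w \<in> Zhat \<Longrightarrow> (\<And>i. fst w $ i \<noteq> 0 \<and> snd w $ i \<noteq> 0) \<Longrightarrow> F w = (0::complex)"
  shows "F w = 0"
proof -
  define N where "N t = (fst w $ None + t) * (snd w $ None + t) -
    (\<Sum>j\<in>UNIV. (fst w $ Some j + t) * (snd w $ Some j + t))" for t
  define \<gamma> where "\<gamma> t = (\<chi> i. fst w $ i + t, \<chi> i. (snd w $ i + t) / N t)" for t
  have N0: "N 0 = 1" using w unfolding Zhat_iff N_def by simp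
  have "(N \<longlongrightarrow> N 0) (at 0)" unfolding N_def by (intro tendsto_intros)
  then have N: "(N \<longlongrightarrow> 1) (at 0)" using N0 by simp
  have ev: "\<forall>\<^sub>F t in at 0. N t \<noteq> 0"
    using tendsto_imp_eventually_ne [OF N] by simp
  have "(\<gamma> \<longlongrightarrow> \<gamma> 0) (at 0)"
    unfolding \<gamma>_def
  proof (intro tendsto_Pair vec_tendstoI)
    fix i
    show "((\<lambda>t. (\<chi> i. fst w $ i + t) $ i) \<longlongrightarrow> (\<chi> i. fst w $ i + 0) $ i) (at 0)"
      unfolding vec_lambda_beta by (intro tendsto_intros)
    show "((\<lambda>t. (\<chi> i. (snd w $ i + t) / N t) $ i) \<longlongrightarrow> (\<chi> i. (snd w $ i + 0) / N 0) $ i) (at 0)"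
      unfolding vec_lambda_beta N0 by (intro tendsto_intros N) auto
  qed
  moreover have "\<gamma> 0 = w" unfolding \<gamma>_def N0 by (simp add: vec_eq_iff prod_eq_iff)
  ultimately have \<gamma>: "(\<gamma> \<longlongrightarrow> w) (at 0)" by simp
  have Z: "\<gamma> t \<in> Zhat" if "N t \<noteq> 0" for t
  proof -
    have "fst (\<gamma> t) $ None * snd (\<gamma> t) $ None - (\<Sum>j\<in>UNIV. fst (\<gamma> t) $ Some j * snd (\<gamma> t) $ Some j)
      = ((fst w $ None + t) * (snd w $ None + t) - (\<Sum>j\<in>UNIV. (fst w $ Some j + t) * (snd w $ Some j + t))) / N t"
      unfolding \<gamma>_def by (simp add: sum_divide_distrib diff_divide_distrib)
    also have "\<dots> = N t / N t" unfolding N_def ..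
    finally have "fst (\<gamma> t) $ None * snd (\<gamma> t) $ None - (\<Sum>j\<in>UNIV. fst (\<gamma> t) $ Some j * snd (\<gamma> t) $ Some j)
      = N t / N t" .
    then show ?thesis unfolding Zhat_iff using that by (simp add: diff_eq_eq)
  qed
  have "((\<lambda>t. F (\<gamma> t)) \<longlongrightarrow> F w) (at 0)"
  proof (rule continuous_on_tendsto_compose [OF cont \<gamma> w])
    show "\<forall>\<^sub>F t in at 0. \<gamma> t \<in> Zhat" using ev by eventually_elim (rule Z)
  qed
  moreover have "\<forall>\<^sub>F t in at 0. F (\<gamma> t) = 0"
  proof -
    have "\<forall>\<^sub>F t in at 0. \<forall>i\<in>UNIV. t \<noteq> - (fst w $ i) \<and> t \<noteq> - (snd w $ i)"
      by (intro eventually_ball_finite ballI eventually_conj eventually_neq_at_within) simp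
    then show ?thesis using ev
    proof eventually_elim
      case (elim t)
      have "fst w $ i + t \<noteq> 0" "snd w $ i + t \<noteq> 0" for i
        using elim(1) by (auto simp: add_eq_0_iff)
      then show ?case using elim(2) by (intro zero Z) (auto simp: \<gamma>_def)
    qed
  qed
  then have "((\<lambda>t. F (\<gamma> t)) \<longlongrightarrow> 0) (at 0)" by (rule tendsto_eventually)
  ultimately show ?thesis by (rule tendsto_unique [OF at_neq_bot])
qed

lemma DeltaD_Zhat: "r \<in> Zset \<Longrightarrow> DeltaD r \<in> Zhat"
proof -
  assume "r \<in> Zset"
  then have "complex_of_real (- (cmod (r $ None))\<^sup>2 + (\<Sum>i\<in>UNIV. (cmod (r $ Some i))\<^sup>2)) = complex_of_real (-1)"
    by (simp only: Zset_def mem_Collect_eq)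
  then show ?thesis
    unfolding DeltaD_def Zhat_def by (simp add: conjv_def complex_norm_square del: of_real_power)
qed

lemma DeltaD_None_neq_0: "r \<in> Zset \<Longrightarrow> r $ None \<noteq> 0"
proof
  assume "r \<in> Zset" "r $ None = 0"
  then have "(\<Sum>i\<in>UNIV. (cmod (r $ Some i))\<^sup>2) = -1" by (simp add: Zset_def)
  moreover have "(\<Sum>i\<in>UNIV. (cmod (r $ Some i))\<^sup>2) \<ge> 0" by (intro sum_nonneg) auto
  ultimately show False by simp
qed

text \<open>In polar coordinates \<open>r_j = exp (i \<theta>_j) x_j\<close> one continues analytically first in the angles; a
  common imaginary shift of the angles absorbs the square root \<open>r_0\<close>, and what remains is entire
  in the radii.\<close>

lemma hol_Dhat_unique:
  fixes F :: "('n::finite) pt \<times> 'n pt \<Rightarrow> complex"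
  assumes F: "hol_Dhat F" and zero: "\<And>r. r \<in> Zset \<Longrightarrow> F (DeltaD r) = 0" and "w \<in> Zhat"
  shows "F w = 0"
proof (rule generic_dense [OF _ assms(3)])
  have hol: "holo_Zhat F" using F by (simp add: hol_Dhat_def)
  then show "continuous_on Zhat F" by (rule holo_Zhat_continuous)
  \<comment> \<open>The value of F at the chart coordinates u_j = r_j/\<rho>, v_j = \<rho> times the
    conjugate of r_j, of the point with r_0 = \<rho>, radii x and angles \<theta>, all three now
    complex and independent.\<close>
  define g where "g x \<rho> \<theta> = F (chart1 (case_sum (\<lambda>j. exp (\<i> * \<theta> j) * x j / \<rho>) (\<lambda>j. \<rho> * (exp (- \<i> * \<theta> j) * x j))))"
    for x \<theta> :: "'n \<Rightarrow> complex" and \<rho>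
  have upd: "(\<lambda>t. (z(i := t)) j) holomorphic_on UNIV" for z :: "'n \<Rightarrow> complex" and i j
    by (cases "j = i") auto
  have slice: "(\<lambda>t. g x \<rho> (z(i := t))) holomorphic_on UNIV" "(\<lambda>t. g (x(i := t)) 1 z) holomorphic_on UNIV"
    for x \<rho> z i
  proof -
    have "(\<lambda>t. exp (\<i> * (z(i := t)) j) * x j / \<rho>) holomorphic_on UNIV"
      "(\<lambda>t. \<rho> * (exp (- \<i> * (z(i := t)) j) * x j)) holomorphic_on UNIV"
      "(\<lambda>t. exp (\<i> * z j) * (x(i := t)) j / 1) holomorphic_on UNIV"
      "(\<lambda>t. 1 * (exp (- \<i> * z j) * (x(i := t)) j)) holomorphic_on UNIV" for j
      unfolding divide_inverse by (intro holomorphic_intros upd)+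
    then have h: "(\<lambda>t. case_sum (\<lambda>j. exp (\<i> * (z(i := t)) j) * x j / \<rho>) (\<lambda>j. \<rho> * (exp (- \<i> * (z(i := t)) j) * x j)) k) holomorphic_on UNIV"
      "(\<lambda>t. case_sum (\<lambda>j. exp (\<i> * z j) * (x(i := t)) j / 1) (\<lambda>j. 1 * (exp (- \<i> * z j) * (x(i := t)) j)) k) holomorphic_on UNIV"
      for k by (cases k; simp only: sum.case)+
    show "(\<lambda>t. g x \<rho> (z(i := t))) holomorphic_on UNIV"
      unfolding g_def by (rule holo_chart_curve(1) [OF hol open_UNIV h(1)])
    show "(\<lambda>t. g (x(i := t)) 1 z) holomorphic_on UNIV"
      unfolding g_def by (rule holo_chart_curve(1) [OF hol open_UNIV h(2)])
  qed
  have step1: "g (\<lambda>j. of_real (x j)) (of_real \<rho>) (\<lambda>j. of_real (\<theta> j)) = 0"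
    if \<rho>: "\<rho> = sqrt (1 + (\<Sum>j\<in>UNIV. (x j)\<^sup>2))" for x \<theta> :: "'n \<Rightarrow> real" and \<rho>
  proof -
    have s: "(\<Sum>j\<in>UNIV. (x j)\<^sup>2) \<ge> 0" by (intro sum_nonneg) auto
    then have \<rho>2: "\<rho>\<^sup>2 = 1 + (\<Sum>j\<in>UNIV. (x j)\<^sup>2)" "\<rho> > 0"
      unfolding \<rho> by (auto intro: add_pos_nonneg)
    define r where "r = mkpt (of_real \<rho>) (\<lambda>j. exp (\<i> * of_real (\<theta> j)) * of_real (x j))"
    have "cmod (r $ Some j) = \<bar>x j\<bar>" for j by (simp add: r_def norm_mult)
    then have r: "r \<in> Zset" using \<rho>2 by (simp add: Zset_def) (simp add: r_def)
    have "F (DeltaD r) = F (chart1 (cslice (DeltaD r) (of_real \<rho>)))"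
      using hol_Dhat_chart1 [OF F DeltaD_Zhat [OF r]] \<rho>2(2) by (simp add: DeltaD_def r_def)
    also have "cslice (DeltaD r) (of_real \<rho>) =
      case_sum (\<lambda>j. exp (\<i> * of_real (\<theta> j)) * of_real (x j) / of_real \<rho>)
        (\<lambda>j. of_real \<rho> * (exp (- \<i> * of_real (\<theta> j)) * of_real (x j)))"
      unfolding cslice_def DeltaD_def r_def conjv_def by (simp add: exp_cnj)
    finally show ?thesis unfolding g_def using zero [OF r] by (simp only:)
  qed
  have step2: "g (\<lambda>j. of_real (x j)) 1 \<theta> = 0" for x :: "'n \<Rightarrow> real" and \<theta>
  proof -
    define \<rho> where "\<rho> = sqrt (1 + (\<Sum>j\<in>UNIV. (x j)\<^sup>2))"
    have \<rho>: "\<rho> > 0" unfolding \<rho>_def by (intro real_sqrt_gt_zero add_pos_nonneg sum_nonneg) auto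
    have "g (\<lambda>j. of_real (x j)) (of_real \<rho>) \<theta> = 0" for \<theta>
    proof (rule zero_if_zero_on_reals [of "g (\<lambda>j. of_real (x j)) (of_real \<rho>)", OF slice(1)])
      fix z :: "'n \<Rightarrow> complex" assume "\<And>i. z i \<in> \<real>"
      then have "z = (\<lambda>j. of_real (Re (z j)))" by auto
      then show "g (\<lambda>j. of_real (x j)) (of_real \<rho>) z = 0"
        using step1 [OF \<rho>_def, of "\<lambda>j. Re (z j)"] by simp
    qed
    from this [of "\<lambda>j. \<theta> j - \<i> * of_real (ln \<rho>)"]
    have "g (\<lambda>j. of_real (x j)) (of_real \<rho>) (\<lambda>j. \<theta> j - \<i> * of_real (ln \<rho>)) = 0" .
    moreover have "exp (\<i> * (\<theta> j - \<i> * of_real (ln \<rho>))) = exp (\<i> * \<theta> j) * of_real \<rho>"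
      "exp (- \<i> * (\<theta> j - \<i> * of_real (ln \<rho>))) = exp (- \<i> * \<theta> j) / of_real \<rho>" for j
      using \<rho> by (simp_all add: right_diff_distrib exp_add exp_diff exp_of_real flip: mult.assoc)
    ultimately show ?thesis unfolding g_def using \<rho> by simp
  qed
  have step3: "g x 1 \<theta> = 0" for x \<theta>
  proof (rule zero_if_zero_on_reals [of "\<lambda>x. g x 1 \<theta>", OF slice(2)])
    fix z :: "'n \<Rightarrow> complex" assume "\<And>i. z i \<in> \<real>"
    then have "z = (\<lambda>j. of_real (Re (z j)))" by auto
    then show "g z 1 \<theta> = 0" using step2 [of "\<lambda>j. Re (z j)" \<theta>] by simp
  qed
  fix w :: "'n pt \<times> 'n pt"
  assume w: "w \<in> Zhat" "\<And>i. fst w $ i \<noteq> 0 \<and> snd w $ i \<noteq> 0"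
  define u where "u j = cslice w (fst w $ None) (Inl j)" for j
  define v where "v j = cslice w (fst w $ None) (Inr j)" for j
  have uv: "u j \<noteq> 0" "v j \<noteq> 0" for j using w(2) by (auto simp: u_def v_def cslice_def)
  \<comment> \<open>Solves u_j = exp(i \<theta>_j) x_j, v_j = exp(-i \<theta>_j) x_j. The logarithm
    below needs u_j and v_j nonzero, which is the purpose of reducing to generic points.\<close>
  define x where "x j = csqrt (u j * v j)" for j
  have x: "x j \<noteq> 0" "x j * x j = u j * v j" for j
    using uv by (auto simp: x_def simp flip: power2_eq_square)
  define \<theta> where "\<theta> j = - \<i> * Ln (u j / x j)" for j
  have e: "exp (\<i> * \<theta> j) = u j / x j" "exp (- \<i> * \<theta> j) = x j / u j" for j
    using uv x by (simp_all add: \<theta>_def exp_minus flip: mult.assoc)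
  have "cslice w (fst w $ None) = case_sum u v"
    by (auto simp: u_def v_def fun_eq_iff split: sum.split)
  also have "\<dots> = case_sum (\<lambda>j. exp (\<i> * \<theta> j) * x j / 1) (\<lambda>j. 1 * (exp (- \<i> * \<theta> j) * x j))"
    unfolding e using x uv by (intro arg_cong2 [of _ _ _ _ case_sum] ext) (auto simp: field_simps)
  finally have "F (chart1 (cslice w (fst w $ None))) = g x 1 \<theta>" by (simp add: g_def)
  then show "F w = 0"
    using hol_Dhat_chart1 [OF F w(1)] w(2) step3 by simp
qed

subsection \<open>The Frechet space of functions\<close>

lemma csc_nth [simp]: "csc c p $ i = c * p $ i"
  by (simp add: csc_def)

lemma csc_Zhat: "(p, q) \<in> Zhat \<Longrightarrow> z \<noteq> 0 \<Longrightarrow> (csc z p, csc (1 / z) q) \<in> Zhat"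
  unfolding Zhat_iff by simp

lemma hol_Dhat_cong:
  fixes F G :: "('n::finite) pt \<times> 'n pt \<Rightarrow> complex"
  assumes "hol_Dhat F" "\<And>w. w \<in> Zhat \<Longrightarrow> F w = G w"
  shows "hol_Dhat G"
proof -
  have h: "holo_Zhat G"
    unfolding holo_Zhat_iff_cdiff
  proof
    fix z :: "'n pt \<times> 'n pt" assume z: "z \<in> Zhat"
    have hF: "holo_Zhat F" using assms(1) by (simp add: hol_Dhat_def)
    obtain U H where U: "open U" "z \<in> U" "\<forall>w\<in>U. cdiff H w" "\<forall>w\<in>U \<inter> Zhat. H w = F w"
      using bspec [OF iffD1 [OF holo_Zhat_iff_cdiff hF] z] by blast
    then have "\<forall>w\<in>U \<inter> Zhat. H w = G w" using assms(2) by auto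
    with U show "\<exists>U H. open U \<and> z \<in> U \<and> (\<forall>w\<in>U. cdiff H w) \<and> (\<forall>w\<in>U \<inter> Zhat. H w = G w)" by blast
  qed
  have "cstar_inv G" unfolding cstar_inv_def
  proof (intro allI impI)
    fix z and p q :: "'n pt" assume a: "(z::complex) \<noteq> 0 \<and> (p, q) \<in> Zhat"
    then have "F (csc z p, csc (1 / z) q) = F (p, q)"
      using assms(1) unfolding hol_Dhat_def cstar_inv_def by blast
    then show "G (csc z p, csc (1 / z) q) = G (p, q)"
      using assms(2) [OF csc_Zhat, of p q z] assms(2) [of "(p, q)"] a by simp
  qed
  with h show ?thesis by (simp add: hol_Dhat_def)
qed

lemma hol_Dhat_entire:
  assumes "\<And>w. cdiff F w" "cstar_inv F"
  shows "hol_Dhat F"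
  unfolding hol_Dhat_def holo_Zhat_iff_cdiff using assms by (intro conjI ballI exI [of _ UNIV] exI [of _ F]) auto

lemma cdiff_add: "cdiff F w \<Longrightarrow> cdiff G w \<Longrightarrow> cdiff (\<lambda>w. F w + G w) w"
proof -
  assume "cdiff F w" "cdiff G w"
  then obtain D E where "(F has_derivative D) (at w)" "(G has_derivative E) (at w)"
     "\<forall>c v. D (csc c (fst v), csc c (snd v)) = c * D v" "\<forall>c v. E (csc c (fst v), csc c (snd v)) = c * E v"
    unfolding cdiff_def by blast
  then show ?thesis unfolding cdiff_def
    by (intro exI [of _ "\<lambda>v. D v + E v"] conjI has_derivative_add) (auto simp: distrib_left)
qed

lemma cdiff_cmult: "cdiff F w \<Longrightarrow> cdiff (\<lambda>w. k * F w) w"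
proof -
  assume "cdiff F w"
  then obtain D where "(F has_derivative D) (at w)"
     "\<forall>c v. D (csc c (fst v), csc c (snd v)) = c * D v"
    unfolding cdiff_def by blast
  then show ?thesis unfolding cdiff_def
    by (intro exI [of _ "\<lambda>v. k * D v"] conjI has_derivative_mult_right) (auto simp: mult_ac)
qed

lemma hol_Dhat_add:
  fixes F G :: "('n::finite) pt \<times> 'n pt \<Rightarrow> complex"
  assumes "hol_Dhat F" "hol_Dhat G"
  shows "hol_Dhat (\<lambda>w. F w + G w)"
proof -
  have h: "holo_Zhat (\<lambda>w. F w + G w)"
    unfolding holo_Zhat_iff_cdiff
  proof
    fix z :: "'n pt \<times> 'n pt" assume z: "z \<in> Zhat"
    have hh: "holo_Zhat F" "holo_Zhat G" using assms by (simp_all add: hol_Dhat_def)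
    obtain U H where U: "open U" "z \<in> U" "\<forall>w\<in>U. cdiff H w" "\<forall>w\<in>U \<inter> Zhat. H w = F w"
      using bspec [OF iffD1 [OF holo_Zhat_iff_cdiff hh(1)] z] by blast
    obtain V K where V: "open V" "z \<in> V" "\<forall>w\<in>V. cdiff K w" "\<forall>w\<in>V \<inter> Zhat. K w = G w"
      using bspec [OF iffD1 [OF holo_Zhat_iff_cdiff hh(2)] z] by blast
    show "\<exists>U H. open U \<and> z \<in> U \<and> (\<forall>w\<in>U. cdiff H w) \<and> (\<forall>w\<in>U \<inter> Zhat. H w = F w + G w)"
      using U V by (intro exI [of _ "U \<inter> V"] exI [of _ "\<lambda>w. H w + K w"]) (auto intro: cdiff_add)
  qed
  have "cstar_inv (\<lambda>w. F w + G w)"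
    using assms unfolding hol_Dhat_def cstar_inv_def by simp
  with h show ?thesis by (simp add: hol_Dhat_def)
qed

lemma hol_Dhat_cmult:
  fixes F :: "('n::finite) pt \<times> 'n pt \<Rightarrow> complex"
  assumes "hol_Dhat F"
  shows "hol_Dhat (\<lambda>w. k * F w)"
proof -
  have h: "holo_Zhat (\<lambda>w. k * F w)"
    unfolding holo_Zhat_iff_cdiff
  proof
    fix z :: "'n pt \<times> 'n pt" assume z: "z \<in> Zhat"
    have hh: "holo_Zhat F" using assms by (simp_all add: hol_Dhat_def)
    obtain U H where U: "open U" "z \<in> U" "\<forall>w\<in>U. cdiff H w" "\<forall>w\<in>U \<inter> Zhat. H w = F w"
      using bspec [OF iffD1 [OF holo_Zhat_iff_cdiff hh] z] by blast
    show "\<exists>U H. open U \<and> z \<in> U \<and> (\<forall>w\<in>U. cdiff H w) \<and> (\<forall>w\<in>U \<inter> Zhat. H w = k * F w)"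
      using U by (intro exI [of _ U] exI [of _ "\<lambda>w. k * H w"]) (auto intro: cdiff_cmult)
  qed
  have "cstar_inv (\<lambda>w. k * F w)"
    using assms unfolding hol_Dhat_def cstar_inv_def by simp
  with h show ?thesis by (simp add: hol_Dhat_def)
qed

section \<open>Elements of the algebra and their unique holomorphic extensions\<close>

definition restr :: "(('n::finite) pt \<times> 'n pt \<Rightarrow> complex) \<Rightarrow> 'n pt \<Rightarrow> complex" where
  "restr F = (\<lambda>r. if r \<in> Zset then F (DeltaD r) else 0)"

lemma restr_Adn: "hol_Dhat F \<Longrightarrow> restr F \<in> Adn"
  unfolding Adn_def restr_def by blast

text \<open>Makes the definite description in \<open>lift\<close> usable: two candidates differ by
  an invariant holomorphic function that vanishes on the image of \<open>DeltaD\<close>, hence on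
  all of \<open>Zhat\<close>.\<close>

lemma lift_restr:
  fixes F :: "('n::finite) pt \<times> 'n pt \<Rightarrow> complex"
  assumes F: "hol_Dhat F"
  shows "lift (restr F) = (\<lambda>w. if w \<in> Zhat then F w else 0)"
  unfolding lift_def
proof (rule the_equality)
  have "hol_Dhat (\<lambda>w. if w \<in> Zhat then F w else 0)"
    by (rule hol_Dhat_cong [OF F]) simp
  then show "hol_Dhat (\<lambda>w. if w \<in> Zhat then F w else 0) \<and>
    (\<forall>w. w \<notin> Zhat \<longrightarrow> (if w \<in> Zhat then F w else 0) = 0) \<and>
    (\<forall>r\<in>Zset. restr F r = (if DeltaD r \<in> Zhat then F (DeltaD r) else 0))"
    by (auto simp: restr_def DeltaD_Zhat)
next
  fix G assume G: "hol_Dhat G \<and> (\<forall>w. w \<notin> Zhat \<longrightarrow> G w = 0) \<and> (\<forall>r\<in>Zset. restr F r = G (DeltaD r))"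
  have FG: "hol_Dhat (\<lambda>w. F w + (-1) * G w)"
    using F G by (intro hol_Dhat_add hol_Dhat_cmult) auto
  have "F w + (-1) * G w = 0" if "w \<in> Zhat" for w
  proof (rule hol_Dhat_unique [OF FG _ that])
    fix r :: "'n pt" assume "r \<in> Zset"
    then show "F (DeltaD r) + (-1) * G (DeltaD r) = 0" using G by (auto simp: restr_def)
  qed
  then show "G = (\<lambda>w. if w \<in> Zhat then F w else 0)" using G by (auto simp: fun_eq_iff)
qed

lemma
  fixes a :: "('n::finite) pt \<Rightarrow> complex"
  assumes "a \<in> Adn"
  shows hol_lift: "hol_Dhat (lift a)" and restr_lift: "restr (lift a) = a"
    and lift_DeltaD: "r \<in> Zset \<Longrightarrow> lift a (DeltaD r) = a r"
    and lift_outside: "w \<notin> Zhat \<Longrightarrow> lift a w = 0"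
    and Adn_outside: "r \<notin> Zset \<Longrightarrow> a r = 0"
proof -
  obtain F where F: "hol_Dhat F" "a = restr F"
    using assms unfolding Adn_def restr_def by blast
  have l: "lift a = (\<lambda>w. if w \<in> Zhat then F w else 0)" unfolding F(2) by (rule lift_restr [OF F(1)])
  show "hol_Dhat (lift a)" unfolding l by (rule hol_Dhat_cong [OF F(1)]) simp
  have "restr (lift a) = restr F" unfolding l by (auto simp: restr_def DeltaD_Zhat)
  then show "restr (lift a) = a" unfolding F(2) .
  have "a r = restr F r" using F(2) by (rule fun_cong)
  then show "r \<in> Zset \<Longrightarrow> lift a (DeltaD r) = a r" unfolding l by (simp add: restr_def DeltaD_Zhat)
  show "w \<notin> Zhat \<Longrightarrow> lift a w = 0" unfolding l by simp
  show "r \<notin> Zset \<Longrightarrow> a r = 0" unfolding F(2) restr_def by simp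
qed

lemma holo_lift: "a \<in> Adn \<Longrightarrow> holo_Zhat (lift a)"
  using hol_lift unfolding hol_Dhat_def by blast

lemma restr_add: "restr (\<lambda>w. F w + G w) = (\<lambda>r. restr F r + restr G r)"
  and restr_cmult: "restr (\<lambda>w. k * F w) = (\<lambda>r. k * restr F r)"
  by (auto simp: restr_def)

lemma
  assumes "a \<in> Adn" "b \<in> Adn"
  shows Adn_add: "(\<lambda>r. a r + b r) \<in> Adn"
    and lift_add: "lift (\<lambda>r. a r + b r) = (\<lambda>w. lift a w + lift b w)"
proof -
  have r: "(\<lambda>r. a r + b r) = restr (\<lambda>w. lift a w + lift b w)"
    unfolding restr_add restr_lift [OF assms(1)] restr_lift [OF assms(2)] ..
  have h: "hol_Dhat (\<lambda>w. lift a w + lift b w)" by (intro hol_Dhat_add hol_lift assms)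
  show "(\<lambda>r. a r + b r) \<in> Adn" unfolding r by (rule restr_Adn [OF h])
  show "lift (\<lambda>r. a r + b r) = (\<lambda>w. lift a w + lift b w)"
    unfolding r lift_restr [OF h]
    by (rule ext) (simp add: lift_outside [OF assms(1)] lift_outside [OF assms(2)])
qed

lemma
  assumes "a \<in> Adn"
  shows Adn_cmult: "(\<lambda>r. k * a r) \<in> Adn"
    and lift_cmult: "lift (\<lambda>r. k * a r) = (\<lambda>w. k * lift a w)"
proof -
  have r: "(\<lambda>r. k * a r) = restr (\<lambda>w. k * lift a w)"
    unfolding restr_cmult restr_lift [OF assms(1)] ..
  have h: "hol_Dhat (\<lambda>w. k * lift a w)" by (intro hol_Dhat_cmult hol_lift assms)
  show "(\<lambda>r. k * a r) \<in> Adn" unfolding r by (rule restr_Adn [OF h])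
  show "lift (\<lambda>r. k * a r) = (\<lambda>w. k * lift a w)"
    unfolding r lift_restr [OF h] by (rule ext) (simp add: lift_outside [OF assms])
qed

lemma diff_eq_add_cmult: "(\<lambda>r. a r - b r) = (\<lambda>r. a r + (-1) * b r)"
  for a b :: "'x \<Rightarrow> complex"
  by simp

lemma Adn_diff: "a \<in> Adn \<Longrightarrow> b \<in> Adn \<Longrightarrow> (\<lambda>r. a r - b r) \<in> Adn"
  unfolding diff_eq_add_cmult by (intro Adn_add Adn_cmult)

lemma mpow_csc: "mpow (csc z p) P = z ^ mabs P * mpow p P"
  by (simp add: mpow_def mabs_def power_mult_distrib prod.distrib power_sum)

lemma cstar_inv_series:
  assumes "\<And>x. mabs (P x) = mabs (Q x)"
  shows "cstar_inv (\<lambda>w. \<Sum>\<^sub>\<infinity>x. c x * (mpow (fst w) (P x) * mpow (snd w) (Q x)))"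
  unfolding cstar_inv_def
proof (intro allI impI, elim conjE)
  fix z :: complex and p q :: "'b pt" assume z: "z \<noteq> 0"
  have "mpow (csc z p) (P x) * mpow (csc (1 / z) q) (Q x) = mpow p (P x) * mpow q (Q x)" for x
    unfolding mpow_csc assms using z by (simp add: power_one_over)
  then show "(\<Sum>\<^sub>\<infinity>x. c x * (mpow (fst (csc z p, csc (1 / z) q)) (P x) * mpow (snd (csc z p, csc (1 / z) q)) (Q x))) =
    (\<Sum>\<^sub>\<infinity>x. c x * (mpow (fst (p, q)) (P x) * mpow (snd (p, q)) (Q x)))"
    by simp
qed

lemma hol_Dhat_series:
  fixes c :: "'x::countable \<Rightarrow> complex" and P Q :: "'x \<Rightarrow> ('n::finite) mi"
  assumes "rapid c (\<lambda>x. mabs (P x) + mabs (Q x))" "\<And>x. mabs (P x) = mabs (Q x)"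
  shows "hol_Dhat (\<lambda>w. \<Sum>\<^sub>\<infinity>x. c x * (mpow (fst w) (P x) * mpow (snd w) (Q x)))"
  by (intro hol_Dhat_entire cdiff_series cstar_inv_series assms)

definition pair_mon :: "('n::finite) pt \<times> 'n pt \<Rightarrow> 'n mi \<Rightarrow> 'n mi \<Rightarrow> complex" where
  "pair_mon w P Q = mpow (fst w) P * mpow (snd w) Q"

lemma fPQ_restr: "fPQ P Q = restr (\<lambda>w. pair_mon w P Q)"
  by (auto simp: restr_def fPQ_def DeltaD_def pair_mon_def)

lemma hol_Dhat_pair_mon:
  assumes "mabs P = mabs Q"
  shows "hol_Dhat (\<lambda>w. pair_mon w P Q)"
proof (rule hol_Dhat_entire)
  fix w
  show "cdiff (\<lambda>w. pair_mon w P Q) w"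
    using deriv_bounded_mpow [of "max 1 (norm w)" w P Q] unfolding deriv_bounded_def cdiff_def pair_mon_def by auto
  show "cstar_inv (\<lambda>w. pair_mon w P Q)"
    unfolding cstar_inv_def pair_mon_def fst_conv snd_conv mpow_csc assms by (simp add: power_one_over)
qed

lemma fPQ_Adn: "mabs P = mabs Q \<Longrightarrow> fPQ P Q \<in> Adn"
  unfolding fPQ_restr by (intro restr_Adn hol_Dhat_pair_mon)

lemma lift_fPQ: "mabs P = mabs Q \<Longrightarrow> w \<in> Zhat \<Longrightarrow> lift (fPQ P Q) w = pair_mon w P Q"
  unfolding fPQ_restr by (simp add: lift_restr hol_Dhat_pair_mon)

section \<open>Reduced coefficients of elements of the algebra\<close>

definition coef :: "(('n::finite) pt \<Rightarrow> complex) \<Rightarrow> ('n + 'n \<Rightarrow> nat) \<Rightarrow> complex" where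
  "coef a \<alpha> = hat_coef (lift a) \<alpha>"

abbreviation red_mon :: "('n::finite + 'n \<Rightarrow> nat) \<Rightarrow> 'n pt \<Rightarrow> complex" where
  "red_mon \<alpha> \<equiv> fPQ (redP \<alpha>) (redQ \<alpha>)"

lemma rapid_coef: "a \<in> Adn \<Longrightarrow> rapid (coef a) (\<lambda>\<alpha>. mabs (redP \<alpha>) + mabs (redQ \<alpha>))"
  unfolding coef_def [abs_def] using rapid_taylor_coef_chart(3) [OF holo_lift, of a] by simp

text \<open>The generic expansion needs p_0 and q_0 nonzero. It therefore holds on the image of
  \<open>DeltaD\<close>, where q_0 is the conjugate of p_0 \<noteq> 0, and uniqueness of the
  extension carries it to the rest of \<open>Zhat\<close>.\<close>

lemma lift_expansion:
  fixes a :: "('n::finite) pt \<Rightarrow> complex"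
  assumes a: "a \<in> Adn" and w: "w \<in> Zhat"
  shows "lift a w = (\<Sum>\<^sub>\<infinity>\<alpha>. coef a \<alpha> * pair_mon w (redP \<alpha>) (redQ \<alpha>))"
proof -
  define G :: "'n pt \<times> 'n pt \<Rightarrow> complex" where
    "G = (\<lambda>w. \<Sum>\<^sub>\<infinity>\<alpha>. coef a \<alpha> * (mpow (fst w) (redP \<alpha>) * mpow (snd w) (redQ \<alpha>)))"
  have G: "hol_Dhat G" unfolding G_def
    by (rule hol_Dhat_series [OF rapid_coef [OF a]]) (simp add: mabs_red)
  have H: "hol_Dhat (\<lambda>w. lift a w + (-1) * G w)"
    by (intro hol_Dhat_add hol_Dhat_cmult hol_lift a G)
  have "lift a w + (-1) * G w = 0"
  proof (rule hol_Dhat_unique [OF H _ w])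
    fix r :: "'n pt" assume r: "r \<in> Zset"
    have "fst (DeltaD r) $ None \<noteq> 0" "snd (DeltaD r) $ None \<noteq> 0"
      using DeltaD_None_neq_0 [OF r] by (simp_all add: DeltaD_def conjv_def)
    from reduced_expansion_generic [OF hol_lift [OF a] DeltaD_Zhat [OF r] this]
    show "lift a (DeltaD r) + (-1) * G (DeltaD r) = 0"
      unfolding G_def coef_def by simp
  qed
  then show ?thesis unfolding G_def pair_mon_def by simp
qed

lemma Adn_expansion:
  assumes "a \<in> Adn"
  shows "a = (\<lambda>r. \<Sum>\<^sub>\<infinity>\<alpha>. coef a \<alpha> * red_mon \<alpha> r)"
proof
  fix r
  show "a r = (\<Sum>\<^sub>\<infinity>\<alpha>. coef a \<alpha> * red_mon \<alpha> r)"
  proof (cases "r \<in> Zset")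
    case True
    then show ?thesis
      using lift_expansion [OF assms DeltaD_Zhat [OF True]] lift_DeltaD [OF assms True]
      by (simp add: fPQ_def pair_mon_def DeltaD_def)
  qed (simp add: fPQ_def Adn_outside [OF assms])
qed

lemma coef_add:
  assumes "a \<in> Adn" "b \<in> Adn"
  shows "coef (\<lambda>r. a r + b r) \<alpha> = coef a \<alpha> + coef b \<alpha>"
  unfolding coef_def hat_coef_def lift_add [OF assms]
  using assms by (simp add: taylor_coef_add sep_entire_chart holo_lift)

lemma coef_cmult:
  assumes "a \<in> Adn"
  shows "coef (\<lambda>r. k * a r) \<alpha> = k * coef a \<alpha>"
  unfolding coef_def hat_coef_def lift_cmult [OF assms]
  using assms by (simp add: taylor_coef_cmult sep_entire_chart holo_lift)

text \<open>Multiplication by 1 + uv preserves the weight \<open>degL - degR\<close>, because each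
  u_j v_j raises both degrees by one.\<close>

lemma taylor_coef_weight:
  fixes \<alpha> \<beta> :: "'n::finite + 'n \<Rightarrow> nat"
  assumes "int (degL \<alpha>) - int (degR \<alpha>) \<noteq> int (degL \<beta>) - int (degR \<beta>)"
  shows "taylor_coef \<alpha> (\<lambda>z. (1 + dotz z) ^ m * multi_monom \<beta> z) = 0"
  using assms
proof (induction m arbitrary: \<beta>)
  case 0
  then show ?case by (auto simp: taylor_coef_multi_monom)
next
  case (Suc m)
  \<comment> \<open>The exponents after multiplication by u_j v_j.\<close>
  define \<beta>' where "\<beta>' j = \<beta>(Inl j := Suc (\<beta> (Inl j)), Inr j := Suc (\<beta> (Inr j)))" for j
  have up: "(\<Prod>k\<in>UNIV. y k ^ (f(j := Suc (f j))) k) = y j * (\<Prod>k\<in>UNIV. y k ^ f k)"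
    for y :: "'n + 'n \<Rightarrow> complex" and f j
  proof -
    have "(\<Prod>k\<in>UNIV. y k ^ (f(j := Suc (f j))) k) = (\<Prod>k\<in>UNIV. (if k = j then y j else 1) * y k ^ f k)"
      by (intro prod.cong) auto
    then show ?thesis by (simp add: prod.distrib)
  qed
  have m: "multi_monom (\<beta>' j) z = z (Inl j) * z (Inr j) * multi_monom \<beta> z" for j z
    using up [of z "\<beta>(Inl j := Suc (\<beta> (Inl j)))" "Inr j"] up [of z \<beta> "Inl j"]
    by (simp add: multi_monom_def \<beta>'_def)
  have dL: "degL (\<beta>' j) = Suc (degL \<beta>)" "degR (\<beta>' j) = Suc (degR \<beta>)" for j
  proof -
    have "degL (\<beta>' j) = (\<Sum>k\<in>UNIV. (if k = j then 1 else 0) + \<beta> (Inl k))"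
      "degR (\<beta>' j) = (\<Sum>k\<in>UNIV. (if k = j then 1 else 0) + \<beta> (Inr k))"
      unfolding degL_def degR_def \<beta>'_def by (auto intro!: sum.cong)
    then show "degL (\<beta>' j) = Suc (degL \<beta>)" "degR (\<beta>' j) = Suc (degR \<beta>)"
      by (simp_all add: sum.distrib degL_def degR_def)
  qed
  have sd: "sep_entire (\<lambda>z :: 'n + 'n \<Rightarrow> complex. (1 + dotz z) ^ m)"
    unfolding dotz_def
    by (intro sep_entire_power sep_entire_add sep_entire_const sep_entire_sum sep_entire_mult sep_entire_coord)
  have s: "sep_entire (\<lambda>z. (1 + dotz z) ^ m * multi_monom \<beta> z)" for \<beta> :: "'n + 'n \<Rightarrow> nat"
    by (rule sep_entire_mult [OF sd sep_entire_multi_monom])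
  have eq: "(\<lambda>z. (1 + dotz z) ^ Suc m * multi_monom \<beta> z) =
    (\<lambda>z. (1 + dotz z) ^ m * multi_monom \<beta> z + (\<Sum>j\<in>UNIV. (1 + dotz z) ^ m * multi_monom (\<beta>' j) z))"
  proof
    fix z :: "'n + 'n \<Rightarrow> complex"
    have "(\<Sum>j\<in>UNIV. (1 + dotz z) ^ m * multi_monom (\<beta>' j) z) = (1 + dotz z) ^ m * (dotz z * multi_monom \<beta> z)"
      unfolding m dotz_def by (simp add: sum_distrib_left sum_distrib_right)
    then show "(1 + dotz z) ^ Suc m * multi_monom \<beta> z =
      (1 + dotz z) ^ m * multi_monom \<beta> z + (\<Sum>j\<in>UNIV. (1 + dotz z) ^ m * multi_monom (\<beta>' j) z)"
      by (simp add: algebra_simps)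
  qed
  have tsum: "taylor_coef \<alpha> (\<lambda>z. \<Sum>j\<in>A. (1 + dotz z) ^ m * multi_monom (\<beta>' j) z) = 0" if "finite A" for A
    using that
  proof (induction A rule: finite_induct)
    case empty
    have "taylor_coef \<alpha> (\<lambda>z. 0 * 0) = 0 * taylor_coef \<alpha> (\<lambda>z. 0)" by (rule taylor_coef_cmult [OF sep_entire_const])
    then show ?case by simp
  next
    case (insert j A)
    have "taylor_coef \<alpha> (\<lambda>z. (1 + dotz z) ^ m * multi_monom (\<beta>' j) z) = 0"
      using Suc.prems by (intro Suc.IH) (simp add: dL)
    then show ?case using insert
      by (simp add: taylor_coef_add s sep_entire_sum)
  qed
  show ?case unfolding eq
    using tsum [of UNIV] Suc.IH [OF Suc.prems] by (subst taylor_coef_add) (auto intro!: s sep_entire_sum)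
qed

text \<open>If \<alpha> and \<beta> have equal weights \<open>degL - degR\<close>, the coefficient
  is taken in the chart in which the reduced monomial is a plain monomial; if the weights differ, it
  vanishes in either chart.\<close>

lemma coef_red_mon: "coef (red_mon \<beta>) \<alpha> = (if \<alpha> = \<beta> then 1 else 0)"
proof -
  have b: "mabs (redP \<beta>) = mabs (redQ \<beta>)" by (simp add: mabs_red)
  have m: "pmon (chart1 z) \<beta> = multi_monom \<beta> z" "pmon (chart2 z) \<beta> = multi_monom \<beta> z" for z
    by (simp_all add: pmon_def chart1_def chart2_def multi_monom_def prod_UNIV_sum)
  have c1: "lift (red_mon \<beta>) (chart1 z) = (1 + dotz z) ^ (degL \<beta> - degR \<beta>) * multi_monom \<beta> z" for z
    unfolding lift_fPQ [OF b chart_Zhat(1)] pair_mon_def mpow_red prod.collapse m by (simp add: chart1_def)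
  have c2: "lift (red_mon \<beta>) (chart2 z) = (1 + dotz z) ^ (degR \<beta> - degL \<beta>) * multi_monom \<beta> z" for z
    unfolding lift_fPQ [OF b chart_Zhat(2)] pair_mon_def mpow_red prod.collapse m by (simp add: chart2_def)
  show ?thesis
  proof (cases "int (degL \<alpha>) - int (degR \<alpha>) = int (degL \<beta>) - int (degR \<beta>)")
    case True
    then have "degL \<alpha> \<le> degR \<alpha> \<longleftrightarrow> degL \<beta> \<le> degR \<beta>" by linarith
    then show ?thesis
      by (auto simp: coef_def hat_coef_def c1 c2 taylor_coef_multi_monom)
  next
    case False
    then have "\<alpha> \<noteq> \<beta>" by auto
    then show ?thesis using taylor_coef_weight [OF False] by (simp add: coef_def hat_coef_def c1 c2)
  qed
qed

subsection \<open>Seminorms\<close>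

lemma bdd_lift:
  fixes a :: "('n::finite) pt \<Rightarrow> complex"
  assumes "a \<in> Adn" "compact K" "K \<subseteq> Zhat"
  shows "bdd_above ((\<lambda>w. cmod (lift a w)) ` K)"
proof -
  have "compact ((\<lambda>w. cmod (lift a w)) ` K)"
    by (intro compact_continuous_image continuous_on_norm continuous_on_subset
      [OF holo_Zhat_continuous [OF holo_lift [OF assms(1)]]] assms)
  then show ?thesis by (intro bounded_imp_bdd_above compact_imp_bounded)
qed

lemma snorm_ge:
  assumes "a \<in> Adn" "compact K" "K \<subseteq> Zhat" "w \<in> K"
  shows "cmod (lift a w) \<le> snorm K a"
  using cSUP_upper [OF assms(4) bdd_lift [OF assms(1-3)]] assms(4) by (auto simp: snorm_def)

lemma snorm_le:
  assumes "\<And>w. w \<in> K \<Longrightarrow> cmod (lift a w) \<le> M" "0 \<le> M"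
  shows "snorm K a \<le> M"
  unfolding snorm_def using assms by (auto intro: cSUP_least)

lemma snorm_nonneg:
  assumes "a \<in> Adn" "compact K" "K \<subseteq> Zhat"
  shows "0 \<le> snorm K a"
proof (cases "K = {}")
  case False
  then show ?thesis using snorm_ge [OF assms] order_trans [OF norm_ge_zero] by blast
qed (simp add: snorm_def)

definition knorm :: "real \<Rightarrow> (('n::finite) pt \<Rightarrow> complex) \<Rightarrow> real" where
  "knorm B a = snorm (KB B) a"

lemma knorm_ge: "a \<in> Adn \<Longrightarrow> w \<in> KB B \<Longrightarrow> cmod (lift a w) \<le> knorm B a"
  unfolding knorm_def by (intro snorm_ge compact_KB KB_Zhat)

lemma knorm_le: "(\<And>w. w \<in> KB B \<Longrightarrow> cmod (lift a w) \<le> M) \<Longrightarrow> 0 \<le> M \<Longrightarrow> knorm B a \<le> M"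
  unfolding knorm_def by (rule snorm_le)

lemma knorm_nonneg: "a \<in> Adn \<Longrightarrow> 0 \<le> knorm B a"
  unfolding knorm_def by (intro snorm_nonneg compact_KB KB_Zhat)

lemma snorm_le_knorm:
  assumes "a \<in> Adn" "K \<subseteq> KB B"
  shows "snorm K a \<le> knorm B a"
  by (intro snorm_le knorm_ge knorm_nonneg assms) (use assms in auto)

lemma knorm_add: "a \<in> Adn \<Longrightarrow> b \<in> Adn \<Longrightarrow> knorm B (\<lambda>r. a r + b r) \<le> knorm B a + knorm B b"
  by (intro knorm_le) (auto simp: lift_add intro!: norm_triangle_mono knorm_ge add_nonneg_nonneg knorm_nonneg)

lemma knorm_cmult: "a \<in> Adn \<Longrightarrow> knorm B (\<lambda>r. k * a r) \<le> cmod k * knorm B a"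
  by (intro knorm_le) (auto simp: lift_cmult norm_mult intro!: mult_left_mono knorm_ge mult_nonneg_nonneg knorm_nonneg)

text \<open>The sets \<open>KB B\<close> are cofinal and increase with B. Restricting to B \<ge> 1
  makes the powers of B in later bounds increase with the degree.\<close>

lemma conv_A_iff:
  assumes "\<And>k. s k \<in> Adn" "a \<in> Adn"
  shows "conv_A s a \<longleftrightarrow> (\<forall>B\<ge>1. (\<lambda>k. knorm B (\<lambda>r. s k r - a r)) \<longlonglongrightarrow> 0)"
proof
  show "conv_A s a \<Longrightarrow> \<forall>B\<ge>1. (\<lambda>k. knorm B (\<lambda>r. s k r - a r)) \<longlonglongrightarrow> 0"
    unfolding conv_A_def knorm_def using compact_KB KB_Zhat by blast
  assume R: "\<forall>B\<ge>1. (\<lambda>k. knorm B (\<lambda>r. s k r - a r)) \<longlonglongrightarrow> 0"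
  show "conv_A s a" unfolding conv_A_def
  proof (intro allI impI, elim conjE)
    fix K :: "('a pt \<times> 'a pt) set" assume K: "compact K" "K \<subseteq> Zhat"
    obtain B where B: "B \<ge> 1" "K \<subseteq> KB B" using compact_subset_KB [OF K] by blast
    have lim: "(\<lambda>k. knorm B (\<lambda>r. s k r - a r)) \<longlonglongrightarrow> 0" using R B by blast
    show "(\<lambda>k. snorm K (\<lambda>r. s k r - a r)) \<longlonglongrightarrow> 0"
      by (rule tendsto_sandwich [OF _ _ tendsto_const lim])
        (auto intro!: always_eventually snorm_nonneg snorm_le_knorm Adn_diff assms K B)
  qed
qed

text \<open>Cauchy's estimate in the charts, phrased with seminorms; the continuity estimates for
  matrix elements and products below rest on it.\<close>

lemma coef_bound:
  fixes a :: "('n::finite) pt \<Rightarrow> complex"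
  assumes "a \<in> Adn" "R \<ge> 1"
  shows "cmod (coef a \<alpha>) * R ^ sum \<alpha> UNIV \<le> knorm (chart_radius TYPE('n) R) a"
  unfolding coef_def by (intro hat_coef_bound holo_lift knorm_ge assms)

subsection \<open>Summation of series in the Frechet space\<close>

lemma summable_on_product_real:
  fixes u :: "'x \<Rightarrow> real" and v :: "'y \<Rightarrow> real"
  assumes "u summable_on UNIV" "v summable_on UNIV" "\<And>x. 0 \<le> u x" "\<And>y. 0 \<le> v y"
  shows "(\<lambda>(x, y). u x * v y) summable_on UNIV"
proof -
  have "(\<lambda>(x, y). u x * v y) summable_on (UNIV \<times> UNIV)"
  proof (rule summable_on_SigmaI)
    show "((\<lambda>y. case (x, y) of (x, y) \<Rightarrow> u x * v y) has_sum u x * infsum v UNIV) UNIV" for x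
      using has_sum_cmult_right [OF has_sum_infsum [OF assms(2)]] by simp
    show "(\<lambda>x. u x * infsum v UNIV) summable_on UNIV"
      by (intro summable_on_cmult_left assms)
  qed (use assms in auto)
  then show ?thesis by simp
qed

lemma infsum_product:
  fixes u :: "'x \<Rightarrow> complex" and v :: "'y \<Rightarrow> complex"
  assumes "(\<lambda>x. cmod (u x)) summable_on UNIV" "(\<lambda>y. cmod (v y)) summable_on UNIV"
  shows "(\<Sum>\<^sub>\<infinity>(x, y). u x * v y) = infsum u UNIV * infsum v UNIV"
proof -
  have "(\<lambda>(x, y). cmod (u x) * cmod (v y)) summable_on UNIV"
    by (rule summable_on_product_real [OF assms]) auto
  then have "(\<lambda>p. cmod (case p of (x, y) \<Rightarrow> u x * v y)) summable_on UNIV"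
    by (simp add: case_prod_beta' norm_mult)
  then have "(\<lambda>(x, y). u x * v y) summable_on UNIV" by (rule abs_summable_summable)
  then have "(\<lambda>(x, y). u x * v y) summable_on UNIV \<times> UNIV" by simp
  from infsum_Sigma_banach [OF this]
  have "(\<Sum>\<^sub>\<infinity>(x, y). u x * v y) = (\<Sum>\<^sub>\<infinity>x. \<Sum>\<^sub>\<infinity>y. u x * v y)"
    by simp
  also have "\<dots> = infsum u UNIV * infsum v UNIV"
    by (simp add: infsum_cmult_right' infsum_cmult_left')
  finally show ?thesis .
qed

lemma knorm_fPQ:
  assumes "mabs P = mabs Q" "B \<ge> 1"
  shows "knorm B (fPQ P Q) \<le> B ^ (mabs P + mabs Q)"
proof (rule knorm_le)
  fix w :: "'a pt \<times> 'a pt" assume w: "w \<in> KB B"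
  then have "w \<in> Zhat" using KB_Zhat by blast
  then show "cmod (lift (fPQ P Q) w) \<le> B ^ (mabs P + mabs Q)"
    using w unfolding lift_fPQ [OF assms(1) \<open>w \<in> Zhat\<close>] pair_mon_def
    by (intro mpow_pair_bound) (auto simp: KB_def)
qed (use assms in auto)

lemma knorm_red_mon: "B \<ge> 1 \<Longrightarrow> knorm B (red_mon \<alpha>) \<le> (B\<^sup>2) ^ sum \<alpha> UNIV"
proof -
  assume B: "B \<ge> 1"
  have "knorm B (red_mon \<alpha>) \<le> B ^ (mabs (redP \<alpha>) + mabs (redQ \<alpha>))"
    using B by (intro knorm_fPQ) (simp_all add: mabs_red)
  also have "\<dots> \<le> B ^ (2 * sum \<alpha> UNIV)" using B mabs_red_le by (intro power_increasing) auto
  finally show ?thesis by (simp add: power_mult)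
qed

lemma red_mon_Adn: "red_mon \<alpha> \<in> Adn"
  by (intro fPQ_Adn) (simp add: mabs_red)

lemma zero_Adn: "(\<lambda>r. 0) \<in> Adn"
  using Adn_cmult [OF red_mon_Adn, of 0] by simp

lemma lift_zero: "lift (\<lambda>r. 0) w = 0"
  using fun_cong [OF lift_cmult [OF zero_Adn, of 0], of w] by simp

lemma
  assumes "\<And>x. x \<in> S \<Longrightarrow> g x \<in> Adn"
  shows Adn_sum: "(\<lambda>r. \<Sum>x\<in>S. g x r) \<in> Adn"
    and lift_sum: "lift (\<lambda>r. \<Sum>x\<in>S. g x r) w = (\<Sum>x\<in>S. lift (g x) w)"
proof -
  have "(\<lambda>r. \<Sum>x\<in>S. g x r) \<in> Adn \<and> (\<forall>w. lift (\<lambda>r. \<Sum>x\<in>S. g x r) w = (\<Sum>x\<in>S. lift (g x) w))"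
    using assms
  proof (induction S rule: infinite_finite_induct)
    case (insert x S)
    then have "(\<lambda>r. \<Sum>x\<in>S. g x r) \<in> Adn" by auto
    then have "(\<lambda>r. g x r + (\<Sum>x\<in>S. g x r)) \<in> Adn"
      "lift (\<lambda>r. g x r + (\<Sum>x\<in>S. g x r)) = (\<lambda>w. lift (g x) w + lift (\<lambda>r. \<Sum>x\<in>S. g x r) w)"
      using insert.prems by (auto intro!: Adn_add lift_add)
    then show ?case using insert by simp
  qed (auto simp: zero_Adn lift_zero)
  then show "(\<lambda>r. \<Sum>x\<in>S. g x r) \<in> Adn" "lift (\<lambda>r. \<Sum>x\<in>S. g x r) w = (\<Sum>x\<in>S. lift (g x) w)" by blast+
qed

lemma knorm_sum:
  fixes g :: "'x \<Rightarrow> ('n::finite) pt \<Rightarrow> complex"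
  assumes "\<And>x. x \<in> S \<Longrightarrow> g x \<in> Adn"
  shows "knorm B (\<lambda>r. \<Sum>x\<in>S. g x r) \<le> (\<Sum>x\<in>S. knorm B (g x))"
proof (rule knorm_le)
  fix w :: "'n pt \<times> 'n pt" assume w: "w \<in> KB B"
  have "lift (\<lambda>r. \<Sum>x\<in>S. g x r) w = (\<Sum>x\<in>S. lift (g x) w)" by (rule lift_sum) (rule assms)
  then show "cmod (lift (\<lambda>r. \<Sum>x\<in>S. g x r) w) \<le> (\<Sum>x\<in>S. knorm B (g x))"
    using w by (simp only:) (intro sum_norm_le knorm_ge assms)
qed (intro sum_nonneg knorm_nonneg assms)

lemma pair_mon_KB_bound: "w \<in> KB B \<Longrightarrow> B \<ge> 1 \<Longrightarrow> cmod (pair_mon w (redP \<alpha>) (redQ \<alpha>)) \<le> (B\<^sup>2) ^ sum \<alpha> UNIV"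
proof -
  assume w: "w \<in> KB B" and B: "B \<ge> 1"
  have "cmod (pair_mon w (redP \<alpha>) (redQ \<alpha>)) \<le> B ^ (mabs (redP \<alpha>) + mabs (redQ \<alpha>))"
    unfolding pair_mon_def using w by (intro mpow_pair_bound) (auto simp: KB_def)
  also have "\<dots> \<le> B ^ (2 * sum \<alpha> UNIV)" using B mabs_red_le by (intro power_increasing) auto
  finally show ?thesis by (simp add: power_mult)
qed

lemma chart_radius_ge_1: "R \<ge> 0 \<Longrightarrow> chart_radius TYPE('n::finite) R \<ge> 1"
  by (simp add: chart_radius_def)

text \<open>Completeness in the form of a summation theorem: by \<open>coef_bound\<close> the summed
  coefficients are again rapid and define an element, and exchanging the two sums identifies it with
  the pointwise sum.\<close>

lemma
  fixes g :: "'x \<Rightarrow> ('n::finite) pt \<Rightarrow> complex"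
  assumes g: "\<And>x. g x \<in> Adn" and s: "\<And>B. B \<ge> 1 \<Longrightarrow> (\<lambda>x. knorm B (g x)) summable_on UNIV"
  shows Adn_infsum: "(\<lambda>r. \<Sum>\<^sub>\<infinity>x. g x r) \<in> Adn"
    and lift_infsum: "w \<in> Zhat \<Longrightarrow> lift (\<lambda>r. \<Sum>\<^sub>\<infinity>x. g x r) w = (\<Sum>\<^sub>\<infinity>x. lift (g x) w)"
proof -
  define c where "c \<alpha> = (\<Sum>\<^sub>\<infinity>x. coef (g x) \<alpha>)" for \<alpha>
  have c: "cmod (c \<alpha>) * R ^ sum \<alpha> UNIV \<le> (\<Sum>\<^sub>\<infinity>x. knorm (chart_radius TYPE('n) R) (g x))" if R: "R \<ge> 1" for R \<alpha>
  proof -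
    have b: "cmod (coef (g x) \<alpha> * of_real R ^ sum \<alpha> UNIV) \<le> knorm (chart_radius TYPE('n) R) (g x)" for x
      using coef_bound [OF g R, of x \<alpha>] R by (simp add: norm_mult norm_power)
    have ss: "(\<lambda>x. knorm (chart_radius TYPE('n) R) (g x)) summable_on UNIV"
      using R by (intro s chart_radius_ge_1) auto
    have s2: "(\<lambda>x. cmod (coef (g x) \<alpha> * of_real R ^ sum \<alpha> UNIV)) summable_on UNIV"
      by (rule Infinite_Sum.abs_summable_on_comparison_test' [OF ss b])
    have "cmod (c \<alpha>) * R ^ sum \<alpha> UNIV = cmod (\<Sum>\<^sub>\<infinity>x. coef (g x) \<alpha> * of_real R ^ sum \<alpha> UNIV)"
      unfolding c_def infsum_cmult_left' using R by (simp add: norm_mult norm_power)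
    also have "\<dots> \<le> (\<Sum>\<^sub>\<infinity>x. cmod (coef (g x) \<alpha> * of_real R ^ sum \<alpha> UNIV))"
      by (rule norm_infsum_bound [OF s2])
    also have "\<dots> \<le> (\<Sum>\<^sub>\<infinity>x. knorm (chart_radius TYPE('n) R) (g x))"
      by (rule infsum_mono [OF s2 ss b])
    finally show ?thesis .
  qed
  have rc: "rapid c (\<lambda>\<alpha>. mabs (redP \<alpha>) + mabs (redQ \<alpha>))"
    by (rule rapid_if_bounded) (use c mabs_red_le in blast)+
  define F :: "'n pt \<times> 'n pt \<Rightarrow> complex" where
    "F = (\<lambda>w. \<Sum>\<^sub>\<infinity>\<alpha>. c \<alpha> * (mpow (fst w) (redP \<alpha>) * mpow (snd w) (redQ \<alpha>)))"
  have F: "hol_Dhat F" unfolding F_def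
    by (rule hol_Dhat_series [OF rc]) (simp add: mabs_red)
  have Fw: "F w = (\<Sum>\<^sub>\<infinity>x. lift (g x) w)" if w: "w \<in> Zhat" for w
  proof -
    obtain B where B: "B \<ge> 1" "{w} \<subseteq> KB B" using compact_subset_KB [of "{w}"] w by auto
    \<comment> \<open>On \<open>KB B\<close> a reduced monomial is at most (B^2)^|\<alpha>|; the
      additional factor 2 leaves (1/2)^|\<alpha>| for the sum over \<alpha>.\<close>
    define R where "R = 2 * B\<^sup>2"
    have "B\<^sup>2 \<ge> 1" using B(1) by (rule one_le_power)
    then have R: "R \<ge> 1" unfolding R_def by linarith
    have ss: "(\<lambda>x. knorm (chart_radius TYPE('n) R) (g x)) summable_on UNIV"
      using R by (intro s chart_radius_ge_1) auto
    have p: "(\<lambda>(x, \<alpha>). knorm (chart_radius TYPE('n) R) (g x) * (1/2) ^ sum \<alpha> UNIV) summable_on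
        (UNIV :: ('x \<times> ('n + 'n \<Rightarrow> nat)) set)"
      by (rule summable_on_product_real [OF ss geometric_multiindex_summable]) (auto intro: knorm_nonneg g)
    have "cmod (coef (g x) \<alpha> * pair_mon w (redP \<alpha>) (redQ \<alpha>)) \<le> knorm (chart_radius TYPE('n) R) (g x) * (1/2) ^ sum \<alpha> UNIV"
      for x \<alpha>
    proof -
      have "cmod (coef (g x) \<alpha> * pair_mon w (redP \<alpha>) (redQ \<alpha>)) \<le> cmod (coef (g x) \<alpha>) * (B\<^sup>2) ^ sum \<alpha> UNIV"
        unfolding norm_mult using B by (intro mult_left_mono pair_mon_KB_bound) auto
      also have "\<dots> = (cmod (coef (g x) \<alpha>) * R ^ sum \<alpha> UNIV) * (1/2) ^ sum \<alpha> UNIV"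
        unfolding R_def by (simp add: power_mult_distrib power_divide)
      also have "\<dots> \<le> knorm (chart_radius TYPE('n) R) (g x) * (1/2) ^ sum \<alpha> UNIV"
        by (intro mult_right_mono coef_bound g R) auto
      finally show ?thesis .
    qed
    then have "(\<lambda>p. cmod (case p of (x, \<alpha>) \<Rightarrow> coef (g x) \<alpha> * pair_mon w (redP \<alpha>) (redQ \<alpha>))) summable_on UNIV"
      by (intro Infinite_Sum.abs_summable_on_comparison_test' [OF p]) auto
    from abs_summable_summable [OF this]
    have sw: "(\<lambda>(x, \<alpha>). coef (g x) \<alpha> * pair_mon w (redP \<alpha>) (redQ \<alpha>)) summable_on UNIV \<times> UNIV" by simp
    have "F w = (\<Sum>\<^sub>\<infinity>\<alpha>. \<Sum>\<^sub>\<infinity>x. coef (g x) \<alpha> * pair_mon w (redP \<alpha>) (redQ \<alpha>))"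
      unfolding F_def c_def pair_mon_def infsum_cmult_left' ..
    also have "\<dots> = (\<Sum>\<^sub>\<infinity>x. \<Sum>\<^sub>\<infinity>\<alpha>. coef (g x) \<alpha> * pair_mon w (redP \<alpha>) (redQ \<alpha>))"
      by (rule infsum_swap_banach [OF sw, symmetric])
    also have "\<dots> = (\<Sum>\<^sub>\<infinity>x. lift (g x) w)"
      unfolding lift_expansion [OF g w] ..
    finally show ?thesis .
  qed
  have "restr F = (\<lambda>r. \<Sum>\<^sub>\<infinity>x. g x r)"
  proof
    fix r
    show "restr F r = (\<Sum>\<^sub>\<infinity>x. g x r)"
      by (cases "r \<in> Zset")
        (simp_all add: restr_def Fw DeltaD_Zhat lift_DeltaD [OF g] Adn_outside [OF g])
  qed
  then show "(\<lambda>r. \<Sum>\<^sub>\<infinity>x. g x r) \<in> Adn"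
    "w \<in> Zhat \<Longrightarrow> lift (\<lambda>r. \<Sum>\<^sub>\<infinity>x. g x r) w = (\<Sum>\<^sub>\<infinity>x. lift (g x) w)"
    using restr_Adn [OF F] lift_restr [OF F] Fw by auto
qed

lemma knorm_infsum:
  fixes g :: "'x \<Rightarrow> ('n::finite) pt \<Rightarrow> complex"
  assumes g: "\<And>x. g x \<in> Adn" and s: "\<And>B. B \<ge> 1 \<Longrightarrow> (\<lambda>x. knorm B (g x)) summable_on UNIV"
    and B: "B \<ge> 1"
  shows "knorm B (\<lambda>r. \<Sum>\<^sub>\<infinity>x. g x r) \<le> (\<Sum>\<^sub>\<infinity>x. knorm B (g x))"
proof (rule knorm_le)
  fix w :: "'n pt \<times> 'n pt" assume w: "w \<in> KB B"
  have b: "(\<lambda>x. cmod (lift (g x) w)) summable_on UNIV"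
    by (rule Infinite_Sum.abs_summable_on_comparison_test' [OF s [OF B]]) (intro knorm_ge g w)
  have "w \<in> Zhat" using w KB_Zhat by blast
  then have "cmod (lift (\<lambda>r. \<Sum>\<^sub>\<infinity>x. g x r) w) = cmod (\<Sum>\<^sub>\<infinity>x. lift (g x) w)"
    by (simp add: lift_infsum [OF g s])
  also have "\<dots> \<le> (\<Sum>\<^sub>\<infinity>x. cmod (lift (g x) w))" by (rule norm_infsum_bound [OF b])
  also have "\<dots> \<le> (\<Sum>\<^sub>\<infinity>x. knorm B (g x))" by (intro infsum_mono b s B knorm_ge g w)
  finally show "cmod (lift (\<lambda>r. \<Sum>\<^sub>\<infinity>x. g x r) w) \<le> (\<Sum>\<^sub>\<infinity>x. knorm B (g x))" .
qed (intro infsum_nonneg knorm_nonneg g)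

section \<open>Continuous functionals and termwise evaluation\<close>

definition cont_functional :: "((('n::finite) pt \<Rightarrow> complex) \<Rightarrow> complex) \<Rightarrow> bool" where
  "cont_functional l \<longleftrightarrow> (\<forall>a\<in>Adn. \<forall>b\<in>Adn. l (\<lambda>r. a r + b r) = l a + l b) \<and>
     (\<forall>k. \<forall>a\<in>Adn. l (\<lambda>r. k * a r) = k * l a) \<and>
     (\<exists>B\<ge>1. \<exists>C. \<forall>a\<in>Adn. cmod (l a) \<le> C * knorm B a)"

lemma cont_functional_cmult: "cont_functional l \<Longrightarrow> a \<in> Adn \<Longrightarrow> l (\<lambda>r. k * a r) = k * l a"
  unfolding cont_functional_def by blast

lemma cont_functional_zero: "cont_functional l \<Longrightarrow> l (\<lambda>r. 0) = 0"
  using cont_functional_cmult [OF _ zero_Adn, of l 0] by simp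

lemma cont_functional_add: "cont_functional l \<Longrightarrow> a \<in> Adn \<Longrightarrow> b \<in> Adn \<Longrightarrow> l (\<lambda>r. a r + b r) = l a + l b"
  unfolding cont_functional_def by blast

lemma cont_functional_sum:
  assumes l: "cont_functional l" and "\<And>x. x \<in> S \<Longrightarrow> g x \<in> Adn"
  shows "l (\<lambda>r. \<Sum>x\<in>S. g x r) = (\<Sum>x\<in>S. l (g x))"
  using assms(2)
proof (induction S rule: infinite_finite_induct)
  case (insert x S)
  then have "l (\<lambda>r. g x r + (\<Sum>x\<in>S. g x r)) = l (g x) + l (\<lambda>r. \<Sum>x\<in>S. g x r)"
    by (intro cont_functional_add [OF l] Adn_sum) auto
  then show ?case using insert by simp
qed (auto simp: cont_functional_zero [OF l])

lemma knorm_tail: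
  fixes g :: "'x \<Rightarrow> ('n::finite) pt \<Rightarrow> complex"
  assumes g: "\<And>x. g x \<in> Adn" and s: "\<And>B. B \<ge> 1 \<Longrightarrow> (\<lambda>x. knorm B (g x)) summable_on UNIV"
    and B: "B \<ge> 1" and S: "finite S"
  shows "knorm B (\<lambda>r. (\<Sum>x\<in>S. g x r) - (\<Sum>\<^sub>\<infinity>x. g x r)) \<le> (\<Sum>\<^sub>\<infinity>x. knorm B (g x)) - (\<Sum>x\<in>S. knorm B (g x))"
proof (rule knorm_le)
  let ?a = "\<lambda>r. \<Sum>\<^sub>\<infinity>x. g x r"
  let ?s = "\<lambda>x. knorm B (g x)"
  let ?d = "\<lambda>r. (\<Sum>x\<in>S. g x r) - ?a r"
  have a: "?a \<in> Adn" by (rule Adn_infsum [OF g s])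
  have Sg: "(\<lambda>r. \<Sum>x\<in>S. g x r) \<in> Adn" by (intro Adn_sum g)
  have inf: "infsum ?s (UNIV - S) = infsum ?s UNIV - sum ?s S"
    using infsum_Diff [OF s [OF B] summable_on_finite [OF S]] S by simp
  show "0 \<le> infsum ?s UNIV - sum ?s S"
    unfolding inf [symmetric] by (intro infsum_nonneg knorm_nonneg g)
  fix w :: "'n pt \<times> 'n pt" assume w: "w \<in> KB B"
  then have wZ: "w \<in> Zhat" using KB_Zhat by blast
  have b: "(\<lambda>x. cmod (lift (g x) w)) summable_on UNIV"
    by (rule Infinite_Sum.abs_summable_on_comparison_test' [OF s [OF B]]) (intro knorm_ge g w)
  have b': "(\<lambda>x. cmod (lift (g x) w)) summable_on UNIV - S"
    by (rule summable_on_subset_banach [OF b]) auto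
  have "lift ?d w = (\<Sum>x\<in>S. lift (g x) w) - (\<Sum>\<^sub>\<infinity>x. lift (g x) w)"
    unfolding diff_eq_add_cmult lift_add [OF Sg Adn_cmult [OF a]] lift_cmult [OF a]
      lift_sum [of S g, OF g] by (simp add: lift_infsum [OF g s wZ])
  also have "\<dots> = - infsum (\<lambda>x. lift (g x) w) (UNIV - S)"
    using infsum_Diff [OF abs_summable_summable [OF b] summable_on_finite [OF S]] S by simp
  finally have "cmod (lift ?d w) \<le> infsum (\<lambda>x. cmod (lift (g x) w)) (UNIV - S)"
    using norm_infsum_bound [OF b'] by simp
  also have "\<dots> \<le> infsum ?s (UNIV - S)"
    by (intro infsum_mono b' summable_on_subset_banach [OF s [OF B]] knorm_ge g w) auto
  finally show "cmod (lift ?d w) \<le> infsum ?s UNIV - sum ?s S" unfolding inf .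
qed

lemma cont_functional_diff: "cont_functional l \<Longrightarrow> a \<in> Adn \<Longrightarrow> b \<in> Adn \<Longrightarrow> l (\<lambda>r. a r - b r) = l a - l b"
  unfolding diff_eq_add_cmult
  using cont_functional_add [OF _ _ Adn_cmult, of l a b "-1"] cont_functional_cmult [of l b "-1"] by simp

text \<open>The finite partial sums converge in the single seminorm that controls l, with error at
  most the tail of the series of seminorms.\<close>

lemma cont_functional_infsum:
  fixes g :: "'x \<Rightarrow> ('n::finite) pt \<Rightarrow> complex"
  assumes l: "cont_functional l" and g: "\<And>x. g x \<in> Adn"
    and s: "\<And>B. B \<ge> 1 \<Longrightarrow> (\<lambda>x. knorm B (g x)) summable_on UNIV"
  shows "((\<lambda>x. l (g x)) has_sum l (\<lambda>r. \<Sum>\<^sub>\<infinity>x. g x r)) UNIV"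
proof -
  obtain B C where B: "B \<ge> 1" and C0: "\<And>a. a \<in> Adn \<Longrightarrow> cmod (l a) \<le> C * knorm B a"
    using l unfolding cont_functional_def by blast
  define C' where "C' = max C 0"
  have C: "cmod (l a) \<le> C' * knorm B a" if "a \<in> Adn" for a
  proof -
    have "C * knorm B a \<le> C' * knorm B a" by (intro mult_right_mono knorm_nonneg that) (simp add: C'_def)
    then show ?thesis using C0 [OF that] by simp
  qed
  let ?a = "\<lambda>r. \<Sum>\<^sub>\<infinity>x. g x r"
  let ?s = "\<lambda>x. knorm B (g x)"
  have a: "?a \<in> Adn" by (rule Adn_infsum [OF g s])
  have est: "cmod ((\<Sum>x\<in>S. l (g x)) - l ?a) \<le> C' * (infsum ?s UNIV - sum ?s S)" if S: "finite S" for S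
  proof -
    have Sg: "(\<lambda>r. \<Sum>x\<in>S. g x r) \<in> Adn" by (intro Adn_sum g)
    have "cmod ((\<Sum>x\<in>S. l (g x)) - l ?a) = cmod (l (\<lambda>r. (\<Sum>x\<in>S. g x r) - ?a r))"
      unfolding cont_functional_diff [OF l Sg a] cont_functional_sum [of l S g, OF l g] ..
    also have "\<dots> \<le> C' * knorm B (\<lambda>r. (\<Sum>x\<in>S. g x r) - ?a r)" by (intro C Adn_diff Sg a)
    also have "knorm B (\<lambda>r. (\<Sum>x\<in>S. g x r) - ?a r) \<le> infsum ?s UNIV - sum ?s S"
      by (rule knorm_tail [OF g s B S])
    finally show ?thesis by (simp add: C'_def mult_left_mono)
  qed
  have "(sum ?s \<longlongrightarrow> infsum ?s UNIV) (finite_subsets_at_top UNIV)"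
    using has_sum_infsum [OF s [OF B]] unfolding has_sum_def .
  then have "((\<lambda>S. C' * (infsum ?s UNIV - sum ?s S)) \<longlongrightarrow> C' * (infsum ?s UNIV - infsum ?s UNIV)) (finite_subsets_at_top UNIV)"
    by (intro tendsto_intros)
  then have lim: "((\<lambda>S. C' * (infsum ?s UNIV - sum ?s S)) \<longlongrightarrow> 0) (finite_subsets_at_top UNIV)" by simp
  have "((\<lambda>S. (\<Sum>x\<in>S. l (g x)) - l ?a) \<longlongrightarrow> 0) (finite_subsets_at_top UNIV)"
    by (rule Lim_null_comparison [OF eventually_finite_subsets_at_top_weakI lim]) (rule est)
  then show ?thesis unfolding has_sum_def by (rule LIM_zero_cancel)
qed

lemma knorm_coef_red_mon_summable:
  fixes a :: "('n::finite) pt \<Rightarrow> complex"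
  assumes a: "a \<in> Adn" and B: "B \<ge> 1"
  shows "(\<lambda>\<alpha>. knorm B (\<lambda>r. coef a \<alpha> * red_mon \<alpha> r)) summable_on UNIV"
proof -
  define R where "R = 2 * B\<^sup>2"
  have "B\<^sup>2 \<ge> 1" using B(1) by (rule one_le_power)
  then have R: "R \<ge> 1" unfolding R_def by linarith
  let ?M = "knorm (chart_radius TYPE('n) R) a"
  show ?thesis
  proof (rule summable_on_comparison_test)
    show "(\<lambda>\<alpha>. ?M * (1/2) ^ sum \<alpha> UNIV) summable_on (UNIV :: ('n + 'n \<Rightarrow> nat) set)"
      by (intro summable_on_cmult_right geometric_multiindex_summable) auto
    fix \<alpha> :: "'n + 'n \<Rightarrow> nat"
    show "0 \<le> knorm B (\<lambda>r. coef a \<alpha> * red_mon \<alpha> r)" by (intro knorm_nonneg Adn_cmult red_mon_Adn)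
    have "knorm B (\<lambda>r. coef a \<alpha> * red_mon \<alpha> r) \<le> cmod (coef a \<alpha>) * knorm B (red_mon \<alpha>)"
      by (intro knorm_cmult red_mon_Adn)
    also have "\<dots> \<le> cmod (coef a \<alpha>) * (B\<^sup>2) ^ sum \<alpha> UNIV"
      by (intro mult_left_mono knorm_red_mon B) auto
    also have "\<dots> = (cmod (coef a \<alpha>) * R ^ sum \<alpha> UNIV) * (1/2) ^ sum \<alpha> UNIV"
      unfolding R_def by (simp add: power_mult_distrib power_divide)
    also have "\<dots> \<le> ?M * (1/2) ^ sum \<alpha> UNIV"
      by (intro mult_right_mono coef_bound a R) auto
    finally show "knorm B (\<lambda>r. coef a \<alpha> * red_mon \<alpha> r) \<le> ?M * (1/2) ^ sum \<alpha> UNIV" .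
  qed
qed

lemma cont_functional_coef: "cont_functional (\<lambda>a. coef a \<alpha>)"
  unfolding cont_functional_def
proof (intro conjI ballI allI exI)
  fix a :: "'a pt \<Rightarrow> complex" assume "a \<in> Adn"
  then show "cmod (coef a \<alpha>) \<le> 1 * knorm (chart_radius TYPE('a) 1) a"
    using coef_bound [of a 1 \<alpha>] by simp
qed (auto simp: coef_add coef_cmult chart_radius_ge_1)

text \<open>The converse of \<open>Adn_expansion\<close>: elements of the algebra correspond
  bijectively to rapid coefficient families.\<close>

lemma
  fixes c :: "('n::finite + 'n \<Rightarrow> nat) \<Rightarrow> complex"
  assumes c: "rapid c (\<lambda>\<alpha>. mabs (redP \<alpha>) + mabs (redQ \<alpha>))"
  shows series_Adn: "(\<lambda>r. \<Sum>\<^sub>\<infinity>\<alpha>. c \<alpha> * red_mon \<alpha> r) \<in> Adn"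
    and coef_series: "coef (\<lambda>r. \<Sum>\<^sub>\<infinity>\<alpha>. c \<alpha> * red_mon \<alpha> r) \<beta> = c \<beta>"
proof -
  have s: "(\<lambda>\<alpha>. knorm B (\<lambda>r. c \<alpha> * red_mon \<alpha> r)) summable_on UNIV" if "B \<ge> 1" for B
  proof (rule summable_on_comparison_test)
    show "(\<lambda>\<alpha>. cmod (c \<alpha>) * B ^ (mabs (redP \<alpha>) + mabs (redQ \<alpha>))) summable_on UNIV"
      using c that unfolding rapid_def by blast
    fix \<alpha> :: "'n + 'n \<Rightarrow> nat"
    show "0 \<le> knorm B (\<lambda>r. c \<alpha> * red_mon \<alpha> r)" by (intro knorm_nonneg Adn_cmult red_mon_Adn)
    show "knorm B (\<lambda>r. c \<alpha> * red_mon \<alpha> r) \<le> cmod (c \<alpha>) * B ^ (mabs (redP \<alpha>) + mabs (redQ \<alpha>))"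
      by (rule order_trans [OF knorm_cmult [OF red_mon_Adn] mult_left_mono [OF knorm_fPQ]])
        (use that in \<open>auto simp: mabs_red\<close>)
  qed
  note g = Adn_cmult [OF red_mon_Adn]
  show "(\<lambda>r. \<Sum>\<^sub>\<infinity>\<alpha>. c \<alpha> * red_mon \<alpha> r) \<in> Adn" by (rule Adn_infsum [OF g s])
  have "((\<lambda>\<alpha>. coef (\<lambda>r. c \<alpha> * red_mon \<alpha> r) \<beta>) has_sum coef (\<lambda>r. \<Sum>\<^sub>\<infinity>\<alpha>. c \<alpha> * red_mon \<alpha> r) \<beta>) UNIV"
    by (rule cont_functional_infsum [OF cont_functional_coef g s])
  then have "((\<lambda>\<alpha>. if \<beta> = \<alpha> then c \<alpha> else 0) has_sum coef (\<lambda>r. \<Sum>\<^sub>\<infinity>\<alpha>. c \<alpha> * red_mon \<alpha> r) \<beta>) UNIV"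
    by (simp add: coef_cmult [OF red_mon_Adn] coef_red_mon if_distrib cong: if_cong)
  moreover have "((\<lambda>\<alpha>. if \<beta> = \<alpha> then c \<alpha> else 0) has_sum c \<beta>) UNIV"
  proof -
    have "((\<lambda>\<alpha>. if \<beta> = \<alpha> then c \<alpha> else 0) has_sum (\<Sum>\<alpha>\<in>{\<beta>}. if \<beta> = \<alpha> then c \<alpha> else 0)) {\<beta>}"
      by (rule has_sum_finite) simp
    then show ?thesis by (subst has_sum_cong_neutral [where T = "{\<beta>}"]) auto
  qed
  ultimately show "coef (\<lambda>r. \<Sum>\<^sub>\<infinity>\<alpha>. c \<alpha> * red_mon \<alpha> r) \<beta> = c \<beta>" by (rule has_sum_unique)
qed

subsection \<open>The involution\<close>

definition flip :: "('n + 'n \<Rightarrow> nat) \<Rightarrow> 'n + 'n \<Rightarrow> nat" where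
  "flip \<alpha> = case_sum (\<lambda>j. \<alpha> (Inr j)) (\<lambda>j. \<alpha> (Inl j))"

lemma flip_flip [simp]: "flip (flip \<alpha>) = \<alpha>"
  by (auto simp: flip_def fun_eq_iff split: sum.split)

lemma flip_simps [simp]: "flip \<alpha> (Inl j) = \<alpha> (Inr j)" "flip \<alpha> (Inr j) = \<alpha> (Inl j)"
  by (simp_all add: flip_def)

lemma deg_flip [simp]: "degL (flip \<alpha>) = degR \<alpha>" "degR (flip \<alpha>) = degL \<alpha>"
  by (simp_all add: degL_def degR_def flip_def)

lemma red_flip: "redP (flip \<alpha>) = redQ \<alpha>" "redQ (flip \<alpha>) = redP \<alpha>"
  by (auto simp: redP_def redQ_def flip_def degL_def degR_def split: option.split)

lemma bij_flip: "bij flip"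
  by (rule o_bij [of flip]) auto

lemma fPQ_cnj: "cnj (fPQ P Q r) = fPQ Q P r"
  by (simp add: fPQ_def mpow_def conjv_def mult.commute)

text \<open>Conjugation is not holomorphic, so it is handled on the expansion: it conjugates the
  coefficients and exchanges the two halves of the index, which keeps the family rapid.\<close>

lemma
  fixes a :: "('n::finite) pt \<Rightarrow> complex"
  assumes a: "a \<in> Adn"
  shows invol_Adn: "invol a \<in> Adn" and coef_invol: "coef (invol a) \<alpha> = cnj (coef a (flip \<alpha>))"
proof -
  define c where "c \<alpha> = cnj (coef a (flip \<alpha>))" for \<alpha>
  have "rapid c (\<lambda>\<alpha>. mabs (redP \<alpha>) + mabs (redQ \<alpha>))"
    unfolding rapid_def
  proof (intro allI impI)
    fix R :: real assume "R \<ge> 1"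
    then have s: "(\<lambda>\<alpha>. cmod (coef a \<alpha>) * R ^ (mabs (redP \<alpha>) + mabs (redQ \<alpha>))) summable_on UNIV"
      using rapid_coef [OF a] unfolding rapid_def by blast
    have "mabs (redP \<alpha>) + mabs (redQ \<alpha>) = mabs (redP (flip \<alpha>)) + mabs (redQ (flip \<alpha>))"
      for \<alpha> :: "'n + 'n \<Rightarrow> nat"
      by (simp add: mabs_red)
    then show "(\<lambda>\<alpha>. cmod (c \<alpha>) * R ^ (mabs (redP \<alpha>) + mabs (redQ \<alpha>))) summable_on UNIV"
      using iffD2 [OF summable_on_reindex_bij_betw [OF bij_flip] s] unfolding c_def by simp
  qed
  note r = this
  have "invol a = (\<lambda>r. \<Sum>\<^sub>\<infinity>\<alpha>. c \<alpha> * red_mon \<alpha> r)"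
  proof
    fix r
    have "a r = (\<Sum>\<^sub>\<infinity>\<alpha>. coef a \<alpha> * red_mon \<alpha> r)" using Adn_expansion [OF a] by (rule fun_cong)
    then have "invol a r = (\<Sum>\<^sub>\<infinity>\<alpha>. cnj (coef a \<alpha> * red_mon \<alpha> r))"
      unfolding invol_def by (simp only: infsum_cnj)
    also have "\<dots> = (\<Sum>\<^sub>\<infinity>\<alpha>. cnj (coef a (flip \<alpha>) * red_mon (flip \<alpha>) r))"
      by (rule infsum_reindex_bij_betw [OF bij_flip, symmetric])
    also have "\<dots> = (\<Sum>\<^sub>\<infinity>\<alpha>. c \<alpha> * red_mon \<alpha> r)"
      unfolding c_def complex_cnj_mult fPQ_cnj red_flip ..
    finally show "invol a r = (\<Sum>\<^sub>\<infinity>\<alpha>. c \<alpha> * red_mon \<alpha> r)" .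
  qed
  then show "invol a \<in> Adn" "coef (invol a) \<alpha> = cnj (coef a (flip \<alpha>))"
    using series_Adn [OF r] coef_series [OF r] by (auto simp: c_def)
qed

subsection \<open>Matrix elements of the monomials\<close>

text \<open>The falling factorial. At a natural number J it is J!/(J-k)!, and 0 for k > J, so no
  basis vector is lowered below 0. Real arguments are allowed because Vandermonde's identity is
  applied at differences that may be negative.\<close>

definition ffall :: "real \<Rightarrow> nat \<Rightarrow> real" where
  "ffall x k = (\<Prod>i<k. x - real i)"

lemma ffall_Suc: "ffall x (Suc k) = ffall x k * (x - real k)"
  by (simp add: ffall_def)

lemma ffall_0 [simp]: "ffall x 0 = 1"
  by (simp add: ffall_def)

lemma ffall_add: "ffall x (a + b) = ffall x a * ffall (x - real a) b"
  by (induction b) (simp_all add: ffall_Suc algebra_simps)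

lemma ffall_pochhammer: "ffall x k = (-1) ^ k * pochhammer (- x) k"
proof (induction k)
  case (Suc k)
  then show ?case by (simp add: ffall_Suc pochhammer_Suc algebra_simps)
qed simp

lemma ffall_nat: "ffall (real n) k = real (n choose k) * fact k"
proof -
  have "fact k * (real n gchoose k) = (\<Prod>i=0..<k. real n - real i)" by (rule gbinomial_mult_fact)
  then show ?thesis
    by (simp add: ffall_def binomial_gbinomial lessThan_atLeast0 mult.commute)
qed

lemma ffall_nonneg: "0 \<le> ffall (real n) k"
  by (simp add: ffall_nat)

lemma ffall_eq_0: "n < k \<Longrightarrow> ffall (real n) k = 0"
  by (simp add: ffall_nat)

lemma ffall_vandermonde:
  "(\<Sum>t\<le>P. real (P choose t) * ffall x t * ffall y (P - t)) = ffall (x + y) P"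
proof -
  have "(-1) ^ P * pochhammer (- x + - y) P =
    (-1) ^ P * (\<Sum>t\<le>P. real (P choose t) * pochhammer (- x) t * pochhammer (- y) (P - t))"
    by (subst pochhammer_binomial_sum) simp
  also have "\<dots> = (\<Sum>t\<le>P. real (P choose t) * ffall x t * ffall y (P - t))"
    unfolding sum_distrib_left
  proof (intro sum.cong refl)
    fix t assume "t \<in> {..P}"
    then have "(-1 :: real) ^ P = (-1) ^ t * (-1) ^ (P - t)" by (simp flip: power_add)
    then show "(-1) ^ P * (real (P choose t) * pochhammer (- x) t * pochhammer (- y) (P - t)) =
      real (P choose t) * ffall x t * ffall y (P - t)"
      unfolding ffall_pochhammer by (simp add: mult_ac)
  qed
  finally show ?thesis unfolding ffall_pochhammer by simp
qed

text \<open>Normal ordering in one index j \<ge> 1: the right-hand side lowers x by R, raises it by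
  S and lowers it by P, while t counts the contractions of P with S. Since t! (S choose t) is a
  falling factorial of S, the sum is an instance of Vandermonde's identity.\<close>

lemma contraction_sum:
  "(\<Sum>t\<le>min P S. fact t * real (P choose t) * real (S choose t) * ffall x (P + R - t)) =
    ffall x R * ffall (x - real R + real S) P"
proof -
  have "(\<Sum>t\<le>min P S. fact t * real (P choose t) * real (S choose t) * ffall x (P + R - t)) =
    (\<Sum>t\<le>P. fact t * real (P choose t) * real (S choose t) * ffall x (P + R - t))"
    by (rule sum.mono_neutral_left) auto
  also have "\<dots> = (\<Sum>t\<le>P. ffall x R * (real (P choose t) * ffall (real S) t * ffall (x - real R) (P - t)))"
  proof (intro sum.cong refl)
    fix t assume "t \<in> {..P}"
    then have "P + R - t = R + (P - t)" by simp
    then show "fact t * real (P choose t) * real (S choose t) * ffall x (P + R - t) =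
      ffall x R * (real (P choose t) * ffall (real S) t * ffall (x - real R) (P - t))"
      by (simp add: ffall_add ffall_nat)
  qed
  also have "\<dots> = ffall x R * ffall (x - real R + real S) P"
    unfolding sum_distrib_left [symmetric] ffall_vandermonde by (simp add: add.commute)
  finally show ?thesis .
qed

text \<open>The counterpart for the index 0. The sign of this coordinate in the form gives (-1)^t,
  and (-1)^t t! (S choose t) is the Pochhammer symbol of -S, so Vandermonde's identity now holds for
  rising factorials. The shift \<open>j\<close> will be |J|.\<close>

lemma contraction_sum_pochhammer:
  fixes l :: real
  shows "(\<Sum>t\<le>min P S. (-1) ^ t * fact t * real (P choose t) * real (S choose t) * pochhammer l (P + R - t + j)) =
    pochhammer l (R + j) * pochhammer (l + real (R + j) - real S) P"
proof -
  have "(\<Sum>t\<le>min P S. (-1) ^ t * fact t * real (P choose t) * real (S choose t) * pochhammer l (P + R - t + j)) =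
    (\<Sum>t\<le>P. (-1) ^ t * fact t * real (P choose t) * real (S choose t) * pochhammer l (P + R - t + j))"
    by (rule sum.mono_neutral_left) auto
  also have "\<dots> = (\<Sum>t\<le>P. pochhammer l (R + j) * (real (P choose t) * pochhammer (- real S) t * pochhammer (l + real (R + j)) (P - t)))"
  proof (intro sum.cong refl)
    fix t assume "t \<in> {..P}"
    then have "P + R - t + j = (R + j) + (P - t)" by simp
    then have p: "pochhammer l (P + R - t + j) = pochhammer l (R + j) * pochhammer (l + real (R + j)) (P - t)"
      by (simp only: pochhammer_product')
    have q: "pochhammer (- real S) t = (-1) ^ t * (fact t * real (S choose t))"
      using ffall_pochhammer [of "real S" t] by (simp add: ffall_nat mult_ac)
    show "(-1) ^ t * fact t * real (P choose t) * real (S choose t) * pochhammer l (P + R - t + j) =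
       pochhammer l (R + j) * (real (P choose t) * pochhammer (- real S) t * pochhammer (l + real (R + j)) (P - t))"
      unfolding p q by (simp only: mult_ac)
  qed
  also have "\<dots> = pochhammer l (R + j) * pochhammer (- real S + (l + real (R + j))) P"
    unfolding sum_distrib_left [symmetric] pochhammer_binomial_sum ..
  finally show ?thesis by (simp add: algebra_simps)
qed

text \<open>The monomial of exponents \<open>(P, Q)\<close> maps the basis vector \<open>e_J\<close> to \<open>mon_elem l P Q M J\<close> times
  \<open>e_M\<close> with \<open>M = J - P + Q\<close> (away from the index 0); this comes from the GNS representation
  of the evaluation at the origin of the disc.\<close>

definition mon_elem :: "real \<Rightarrow> ('n::finite) mi \<Rightarrow> 'n mi \<Rightarrow> ('n \<Rightarrow> nat) \<Rightarrow> ('n \<Rightarrow> nat) \<Rightarrow> real" where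
  "mon_elem l P Q M J = (if \<forall>j. M j + P (Some j) = J j + Q (Some j)
     then pochhammer l (P None + sum J UNIV) / (pochhammer l (mabs P) * pochhammer l (sum J UNIV)) *
       (\<Prod>j\<in>UNIV. ffall (real (J j)) (P (Some j))) else 0)"

lemma mabs_option: "mabs P = P None + (\<Sum>j\<in>UNIV. P (Some j))"
  by (simp add: mabs_def sum_UNIV_option)

lemma mabs_minus:
  assumes "\<And>i. T i \<le> P i + (R i::nat)"
  shows "mabs (\<lambda>i. P i + R i - T i) + mabs T = mabs P + mabs R"
  unfolding mabs_def sum.distrib [symmetric] by (intro sum.cong) (use assms in auto)

lemma pochhammer_neq_0: "l > 0 \<Longrightarrow> pochhammer (l::real) n \<noteq> 0"
  using pochhammer_pos [of l n] by linarith

text \<open>Only \<open>K0\<close>, that is J - R + S, can occur between the two factors, so no sum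
  over intermediate indices appears. The sum over T factors into one contraction sum for each
  index.\<close>

lemma mon_elem_wick:
  fixes P Q R S :: "('n::finite) mi" and J :: "'n \<Rightarrow> nat"
  assumes l: "l > 0" and RS: "mabs R = mabs S"
  defines "K0 \<equiv> \<lambda>j. J j + S (Some j) - R (Some j)"
  shows "(\<Sum>T\<in>{T. \<forall>i. T i \<le> min (P i) (S i)}. (-1) ^ (T None) *
      (pochhammer l (mabs (\<lambda>i. P i + S i - T i)) * real (mfact T) / (pochhammer l (mabs P) * pochhammer l (mabs S))) *
      real (mbinom P T * mbinom S T) *
      mon_elem l (\<lambda>i. P i + R i - T i) (\<lambda>i. Q i + S i - T i) M J) = mon_elem l P Q M K0 * mon_elem l R S K0 J"
    (is "(\<Sum>T\<in>?TT. ?t T) = _")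
proof (cases "(\<forall>j. R (Some j) \<le> J j + S (Some j)) \<and> (\<forall>j. M j + P (Some j) = K0 j + Q (Some j))")
  case False
  \<comment> \<open>Either the exponents do not match, or the subtraction in \<open>K0\<close> is
    truncated for some j; then T_j \<le> P_j gives J_j < P_j + R_j - T_j and the falling factorial
    vanishes.\<close>
  have "?t T = 0" if T: "T \<in> ?TT" for T
  proof (cases "\<forall>j. M j + (P (Some j) + R (Some j) - T (Some j)) = J j + (Q (Some j) + S (Some j) - T (Some j))")
    case True
    have "\<exists>j. J j + S (Some j) < R (Some j)"
    proof (rule ccontr)
      assume "\<not> ?thesis"
      then have RJ: "R (Some j) \<le> J j + S (Some j)" for j by (meson not_le)
      have "M j + P (Some j) = K0 j + Q (Some j)" for j
      proof -
        have "T (Some j) \<le> P (Some j)" "T (Some j) \<le> S (Some j)" using T by auto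
        then show ?thesis using True [rule_format, of j] RJ [of j] unfolding K0_def by linarith
      qed
      with RJ False show False by blast
    qed
    then obtain j where j: "J j + S (Some j) < R (Some j)" ..
    have "T (Some j) \<le> P (Some j)" using T by auto
    then have "J j < P (Some j) + R (Some j) - T (Some j)" using j by linarith
    then have "ffall (real (J j)) (P (Some j) + R (Some j) - T (Some j)) = 0" by (rule ffall_eq_0)
    then have "mon_elem l (\<lambda>i. P i + R i - T i) (\<lambda>i. Q i + S i - T i) M J = 0"
      unfolding mon_elem_def by (auto intro!: prod_zero)
    then show ?thesis by simp
  next
    case False
    then have "mon_elem l (\<lambda>i. P i + R i - T i) (\<lambda>i. Q i + S i - T i) M J = 0" unfolding mon_elem_def by (rule if_not_P)
    then show ?thesis by simp
  qed
  moreover have "mon_elem l P Q M K0 * mon_elem l R S K0 J = 0"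
  proof (cases "\<forall>j. R (Some j) \<le> J j + S (Some j)")
    case True
    then have "\<not> (\<forall>j. M j + P (Some j) = K0 j + Q (Some j))" using False by blast
    then have "mon_elem l P Q M K0 = 0" unfolding mon_elem_def by (rule if_not_P)
    then show ?thesis by simp
  next
    case False
    then obtain j where "J j + S (Some j) < R (Some j)" by (meson not_le)
    then have "K0 j + R (Some j) \<noteq> J j + S (Some j)" unfolding K0_def by simp
    then have "mon_elem l R S K0 J = 0" unfolding mon_elem_def by auto
    then show ?thesis by simp
  qed
  ultimately show ?thesis by (simp add: sum.neutral)
next
  case True
  then have RJ: "\<And>j. R (Some j) \<le> J j + S (Some j)" and MK: "\<And>j. M j + P (Some j) = K0 j + Q (Some j)" by auto
  have K0: "K0 j + R (Some j) = J j + S (Some j)" for j using RJ [of j] by (simp add: K0_def)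
  \<comment> \<open>The factor of a summand that belongs to the index i, so that the sum over the
    box of all T becomes a product of single sums; \<open>c\<close> collects what does not depend on
    T.\<close>
  define G where "G i t = (case i of
      None \<Rightarrow> (-1) ^ t * fact t * real (P None choose t) * real (S None choose t) * pochhammer l (P None + R None - t + sum J UNIV)
    | Some j \<Rightarrow> fact t * real (P (Some j) choose t) * real (S (Some j) choose t) * ffall (real (J j)) (P (Some j) + R (Some j) - t))"
    for i :: "'n option" and t
  define c where "c = 1 / (pochhammer l (mabs P) * pochhammer l (mabs S) * pochhammer l (sum J UNIV))"
  have TT: "?TT = PiE UNIV (\<lambda>i. {..min (P i) (S i)})" by (auto simp: PiE_def Pi_def extensional_def)
  have "?t T = c * (\<Prod>i\<in>UNIV. G i (T i))" if T: "T \<in> ?TT" for T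
  proof -
    have Ti: "T i \<le> P i" "T i \<le> S i" for i using T by auto
    have "M j + (P (Some j) + R (Some j) - T (Some j)) = J j + (Q (Some j) + S (Some j) - T (Some j))" for j
      using MK [of j] K0 [of j] Ti [of "Some j"] by linarith
    then have r: "mon_elem l (\<lambda>i. P i + R i - T i) (\<lambda>i. Q i + S i - T i) M J =
      pochhammer l (P None + R None - T None + sum J UNIV) /
        (pochhammer l (mabs (\<lambda>i. P i + R i - T i)) * pochhammer l (sum J UNIV)) *
       (\<Prod>j\<in>UNIV. ffall (real (J j)) (P (Some j) + R (Some j) - T (Some j)))"
      unfolding mon_elem_def by simp
    have "mabs (\<lambda>i. P i + S i - T i) + mabs T = mabs P + mabs S"
      "mabs (\<lambda>i. P i + R i - T i) + mabs T = mabs P + mabs R"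
      using Ti by (auto intro!: mabs_minus trans_le_add1)
    then have m: "mabs (\<lambda>i. P i + S i - T i) = mabs (\<lambda>i. P i + R i - T i)" using RS by linarith
    have G: "(\<Prod>i\<in>UNIV. G i (T i)) = (-1) ^ T None * real (mfact T) * real (mbinom P T * mbinom S T) *
      pochhammer l (P None + R None - T None + sum J UNIV) *
      (\<Prod>j\<in>UNIV. ffall (real (J j)) (P (Some j) + R (Some j) - T (Some j)))"
      unfolding prod_UNIV_option G_def mfact_def mbinom_def option.case
      by (simp add: prod.distrib of_nat_prod mult_ac)
    have "pochhammer l (mabs (\<lambda>i. P i + R i - T i)) \<noteq> 0" by (rule pochhammer_neq_0 [OF l])
    then show ?thesis unfolding r m G c_def by (simp add: field_simps)
  qed
  then have "(\<Sum>T\<in>?TT. ?t T) = c * (\<Sum>T\<in>?TT. \<Prod>i\<in>UNIV. G i (T i))"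
    unfolding sum_distrib_left by (intro sum.cong) auto
  also have "(\<Sum>T\<in>?TT. \<Prod>i\<in>UNIV. G i (T i)) = (\<Prod>i\<in>UNIV. \<Sum>t\<le>min (P i) (S i). G i t)"
    unfolding TT by (rule prod_sum_PiE [symmetric]) auto
  also have "\<dots> = pochhammer l (R None + sum J UNIV) * pochhammer l (P None + sum K0 UNIV) / pochhammer l (sum K0 UNIV) *
      ((\<Prod>j\<in>UNIV. ffall (real (J j)) (R (Some j))) * (\<Prod>j\<in>UNIV. ffall (real (K0 j)) (P (Some j))))"
  proof -
    have e: "real (J j) - real (R (Some j)) + real (S (Some j)) = real (K0 j)" for j
      using K0 [of j] by linarith
    have "sum K0 UNIV + (\<Sum>j\<in>UNIV. R (Some j)) = sum J UNIV + (\<Sum>j\<in>UNIV. S (Some j))"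
      unfolding sum.distrib [symmetric] by (simp add: K0)
    \<comment> \<open>The balance of total degrees identifies the shifted argument of the
      contraction at index 0 with l + |K0|, the one occurring in the matrix element that starts from
      \<open>K0\<close>.\<close>
    then have "sum K0 UNIV + S None = sum J UNIV + R None" using RS unfolding mabs_option by linarith
    then have e0: "l + real (R None + sum J UNIV) - real (S None) = l + real (sum K0 UNIV)" by linarith
    have p: "pochhammer (l + real (sum K0 UNIV)) (P None) = pochhammer l (P None + sum K0 UNIV) / pochhammer l (sum K0 UNIV)"
      using pochhammer_product' [of l "sum K0 UNIV" "P None"] l
      by (simp add: add.commute pochhammer_neq_0)
    show ?thesis
      unfolding prod_UNIV_option G_def option.case contraction_sum contraction_sum_pochhammer e e0 p
      by (simp add: prod.distrib)
  qed
  also have "c * \<dots> = mon_elem l P Q M K0 * mon_elem l R S K0 J"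
    unfolding mon_elem_def c_def using MK K0 RS by (simp add: field_simps)
  finally show ?thesis .
qed

lemma mon_elem_support: "mon_elem l R S K J \<noteq> 0 \<Longrightarrow> K = (\<lambda>j. J j + S (Some j) - R (Some j))"
  unfolding mon_elem_def by (auto split: if_splits simp: fun_eq_iff) (metis add_diff_cancel_right')

subsection \<open>Estimates\<close>

definition lupper :: "real \<Rightarrow> real" where "lupper l = max 1 l"
definition llower :: "real \<Rightarrow> real" where "llower l = min 1 l"
text \<open>(l)_n lies between \<open>llower l ^ n\<close> n! and \<open>lupper l ^ n\<close> n!,
  which gives the quotient. One factor 2 comes from (a+b)! \<le> 2^(a+b) a! b!, the other from
  bounding binomial coefficients by powers of 2.\<close>

definition growth :: "real \<Rightarrow> real" where "growth l = 4 * lupper l / llower l"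

lemma growth:
  assumes "l > 0"
  shows "lupper l \<ge> 1" "llower l > 0" "llower l \<le> 1" "growth l \<ge> 1" "lupper l / llower l \<ge> 1"
proof -
  show a: "lupper l \<ge> 1" "llower l > 0" "llower l \<le> 1" using assms by (auto simp: lupper_def llower_def)
  then show "lupper l / llower l \<ge> 1" by (simp add: le_divide_eq)
  then show "growth l \<ge> 1" unfolding growth_def times_divide_eq_right [symmetric] by linarith
qed

lemma pochhammer_bounds:
  assumes "l > 0"
  shows "pochhammer l n \<le> lupper l ^ n * fact n" "llower l ^ n * fact n \<le> pochhammer l n"
proof -
  have f: "x ^ n * fact n = (\<Prod>k<n. x * (1 + real k))" for x :: real
    by (induction n) (simp_all add: algebra_simps)
  have p: "pochhammer l n = (\<Prod>k<n. l + real k)" by (simp add: pochhammer_prod lessThan_atLeast0)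
  have "l + real k \<le> lupper l * (1 + real k)" for k
  proof -
    have "l \<le> lupper l" by (simp add: lupper_def)
    moreover have "real k * 1 \<le> real k * lupper l" by (rule mult_left_mono) (auto simp: lupper_def)
    ultimately show ?thesis by (simp add: algebra_simps)
  qed
  then show "pochhammer l n \<le> lupper l ^ n * fact n"
    unfolding f p using assms by (intro prod_mono) auto
  have "llower l * (1 + real k) \<le> l + real k" for k
  proof -
    have "llower l \<le> l" by (simp add: llower_def)
    moreover have "real k * llower l \<le> real k * 1" by (rule mult_left_mono) (auto simp: llower_def)
    ultimately show ?thesis by (simp add: algebra_simps)
  qed
  then show "llower l ^ n * fact n \<le> pochhammer l n"
    unfolding f p using growth(2) [OF assms] by (intro prod_mono) auto
qed

lemma fact_mult_le: "fact a * fact b \<le> (fact (a + b) :: real)"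
proof -
  have "fact a * fact b \<le> (fact (a + b) :: nat)"
    by (intro dvd_imp_le fact_fact_dvd_fact) simp
  then have "real (fact a * fact b) \<le> real (fact (a + b))" by (simp only: of_nat_le_iff)
  then show ?thesis by simp
qed

lemma fact_add_le: "(fact (a + b) :: real) \<le> 2 ^ (a + b) * (fact a * fact b)"
proof -
  have "(fact (a + b) :: real) = real ((a + b) choose a) * (fact a * fact b)"
    by (subst binomial_fact) auto
  also have "real ((a + b) choose a) \<le> real (2 ^ (a + b))"
    by (simp only: of_nat_le_iff binomial_le_pow2)
  finally show ?thesis by simp
qed

lemma prod_fact_le: "finite A \<Longrightarrow> (\<Prod>i\<in>A. fact (T i)) \<le> (fact (\<Sum>i\<in>A. T i) :: real)"
proof (induction A rule: finite_induct)
  case (insert x A)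
  then have "(\<Prod>i\<in>insert x A. fact (T i)) \<le> fact (T x) * (fact (sum T A) :: real)"
    by (simp add: mult_left_mono)
  also have "\<dots> \<le> fact (T x + sum T A)" by (rule fact_mult_le)
  finally show ?case using insert by simp
qed simp

lemma mfact_le: "real (mfact T) \<le> fact (mabs T)"
  using prod_fact_le [of UNIV T] by (simp add: mfact_def mabs_def)

lemma prod_choose_le: "(\<Prod>i\<in>A. real (P i choose T i)) \<le> 2 ^ (\<Sum>i\<in>A. P i)"
proof -
  have "real (P i choose T i) \<le> 2 ^ P i" for i
    using binomial_le_pow2 [of "P i" "T i"] by (metis of_nat_le_iff of_nat_numeral of_nat_power)
  then show ?thesis unfolding power_sum by (intro prod_mono) auto
qed

lemma mon_elem_nonneg: "l > 0 \<Longrightarrow> 0 \<le> mon_elem l P Q M J"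
  unfolding mon_elem_def
  by (auto intro!: mult_nonneg_nonneg divide_nonneg_nonneg prod_nonneg ffall_nonneg pochhammer_nonneg)

text \<open>Up to geometric factors the numerator is at most P_0! |J|! times the product of the
  P_j!, hence at most |P|! |J|!, which the two Pochhammer symbols in the denominator
  compensate.\<close>

lemma mon_elem_bound:
  assumes l: "l > 0"
  shows "mon_elem l P Q M J \<le> growth l ^ (mabs P + sum J UNIV)"
proof (cases "\<forall>j. M j + P (Some j) = J j + Q (Some j)")
  case True
  let ?u = "lupper l" and ?d = "llower l" and ?j = "sum J UNIV" and ?p = "P None"
  note b = growth [OF l] pochhammer_bounds [OF l]
  have "(\<Prod>j\<in>UNIV. ffall (real (J j)) (P (Some j))) \<le> 2 ^ ?j * (\<Prod>j\<in>UNIV. fact (P (Some j)))"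
    unfolding ffall_nat prod.distrib by (intro mult_right_mono prod_choose_le prod_nonneg) auto
  then have N: "pochhammer l (?p + ?j) * (\<Prod>j\<in>UNIV. ffall (real (J j)) (P (Some j))) \<le>
     (?u ^ (?p + ?j) * fact (?p + ?j)) * (2 ^ ?j * (\<Prod>j\<in>UNIV. fact (P (Some j))))"
    using b l by (intro mult_mono prod_nonneg ffall_nonneg mult_nonneg_nonneg) (auto intro: order_trans)
  also have "\<dots> \<le> (?u ^ (?p + ?j) * (2 ^ (?p + ?j) * (fact ?p * fact ?j))) * (2 ^ ?j * (\<Prod>j\<in>UNIV. fact (P (Some j))))"
    using b by (intro mult_right_mono mult_left_mono fact_add_le mult_nonneg_nonneg prod_nonneg) auto
  also have "\<dots> = (?u ^ (?p + ?j) * 2 ^ (?p + ?j) * 2 ^ ?j) * ((\<Prod>i\<in>UNIV. fact (P i)) * fact ?j)"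
    unfolding prod_UNIV_option by simp
  also have "\<dots> \<le> (?u ^ (mabs P + ?j) * 2 ^ (mabs P + ?j) * 2 ^ (mabs P + ?j)) * (fact (mabs P) * fact ?j)"
    using b prod_fact_le [of UNIV P]
    by (intro mult_mono power_increasing mult_nonneg_nonneg prod_nonneg) (auto simp: mabs_def sum_UNIV_option)
  also have "\<dots> = growth l ^ (mabs P + ?j) * (?d ^ (mabs P + ?j) * (fact (mabs P) * fact ?j))"
    using b(2) by (simp add: growth_def power_divide power_mult_distrib flip: power_mult_distrib [of 2 2])
  also have "\<dots> \<le> growth l ^ (mabs P + ?j) * (pochhammer l (mabs P) * pochhammer l ?j)"
  proof -
    have "?d ^ (mabs P + ?j) * (fact (mabs P) * fact ?j) = (?d ^ mabs P * fact (mabs P)) * (?d ^ ?j * fact ?j)"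
      by (simp add: power_add)
    also have "\<dots> \<le> pochhammer l (mabs P) * pochhammer l ?j"
      using b l by (intro mult_mono) (auto simp: pochhammer_nonneg)
    finally show ?thesis using b by (intro mult_left_mono) auto
  qed
  finally have "pochhammer l (?p + ?j) * (\<Prod>j\<in>UNIV. ffall (real (J j)) (P (Some j))) \<le>
    growth l ^ (mabs P + ?j) * (pochhammer l (mabs P) * pochhammer l ?j)" .
  then show ?thesis using True l
    by (simp add: mon_elem_def pochhammer_pos divide_le_eq mult_pos_pos)
next
  case False
  then have "mon_elem l P Q M J = 0" unfolding mon_elem_def by (rule if_not_P)
  then show ?thesis using growth [OF l] by simp
qed

text \<open>A nonzero entry satisfies |M| \<le> |\<alpha>| + |J|, so an arbitrary weight R^|M| can
  be included. It will provide the decay in the output index.\<close>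

lemma mon_elem_red_bound:
  fixes \<alpha> :: "'n::finite + 'n \<Rightarrow> nat"
  assumes l: "l > 0" and R: "R \<ge> 1"
  shows "mon_elem l (redP \<alpha>) (redQ \<alpha>) M J * R ^ sum M UNIV \<le> (growth l * R) ^ (sum \<alpha> UNIV + sum J UNIV)"
proof (cases "\<forall>j. M j + redP \<alpha> (Some j) = J j + redQ \<alpha> (Some j)")
  case True
  then have "sum M UNIV + degL \<alpha> = sum J UNIV + degR \<alpha>"
    unfolding degL_def degR_def sum.distrib [symmetric] by (simp add: redP_def redQ_def)
  then have M: "sum M UNIV \<le> sum \<alpha> UNIV + sum J UNIV" by (simp add: deg_sum)
  have P: "mabs (redP \<alpha>) \<le> sum \<alpha> UNIV" by (simp add: mabs_red deg_sum)
  have "mon_elem l (redP \<alpha>) (redQ \<alpha>) M J \<le> growth l ^ (mabs (redP \<alpha>) + sum J UNIV)" by (rule mon_elem_bound [OF l])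
  also have "\<dots> \<le> growth l ^ (sum \<alpha> UNIV + sum J UNIV)"
    using growth [OF l] P by (intro power_increasing) auto
  finally show ?thesis unfolding power_mult_distrib
    using R M growth [OF l] by (intro mult_mono power_increasing) auto
next
  case False
  then have "mon_elem l (redP \<alpha>) (redQ \<alpha>) M J = 0" unfolding mon_elem_def by (rule if_not_P)
  then show ?thesis using growth [OF l] R by simp
qed

lemma multiindex_box:
  fixes P :: "'i::finite \<Rightarrow> nat"
  shows "finite {T. \<forall>i. T i \<le> P i}" "card {T. \<forall>i. T i \<le> P i} \<le> 2 ^ sum P UNIV"
proof -
  have e: "{T. \<forall>i. T i \<le> P i} = PiE UNIV (\<lambda>i. {..P i})" by (auto simp: PiE_def Pi_def extensional_def)
  show "finite {T. \<forall>i. T i \<le> P i}" unfolding e by (intro finite_PiE) auto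
  have "card {T. \<forall>i. T i \<le> P i} = (\<Prod>i\<in>UNIV. Suc (P i))" unfolding e by (subst card_PiE) auto
  also have "\<dots> \<le> (\<Prod>i\<in>UNIV. 2 ^ P i)"
    by (intro prod_mono) (auto simp: Suc_le_eq)
  finally show "card {T. \<forall>i. T i \<le> P i} \<le> 2 ^ sum P UNIV" by (simp add: power_sum)
qed

subsection \<open>Matrix elements on the Frechet algebra\<close>

definition geo_sum :: "'i::finite itself \<Rightarrow> real" where
  "geo_sum _ = (\<Sum>\<^sub>\<infinity>\<alpha>::'i \<Rightarrow> nat. (1/2) ^ sum \<alpha> UNIV)"

lemma geo_sum_summable: "(\<lambda>\<alpha>::'i::finite \<Rightarrow> nat. (1/2::real) ^ sum \<alpha> UNIV) summable_on UNIV"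
  by (rule geometric_multiindex_summable) auto

lemma geo_sum_nonneg: "0 \<le> geo_sum TYPE('i::finite)"
  unfolding geo_sum_def by (intro infsum_nonneg) auto

text \<open>Being defined through the reduced coefficients, it depends on the function alone; that
  every monomial f_{P,Q}, reduced or not, has the entry \<open>mon_elem\<close> is
  \<open>mat_elem_fPQ\<close>.\<close>

definition mat_elem :: "real \<Rightarrow> ('n::finite \<Rightarrow> nat) \<Rightarrow> ('n \<Rightarrow> nat) \<Rightarrow> ('n pt \<Rightarrow> complex) \<Rightarrow> complex" where
  "mat_elem l M J a = (\<Sum>\<^sub>\<infinity>\<alpha>. coef a \<alpha> * of_real (mon_elem l (redP \<alpha>) (redQ \<alpha>) M J))"

text \<open>The factor 2 turns the bound on the coefficients at radius \<open>growth l * R\<close>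
  into the summable factor (1/2)^|\<alpha>|.\<close>

definition mat_rad :: "'n::finite itself \<Rightarrow> real \<Rightarrow> real \<Rightarrow> real" where
  "mat_rad _ l R = chart_radius TYPE('n) (2 * (growth l * R))"

lemma growth_mult_ge_1: "l > 0 \<Longrightarrow> R \<ge> 1 \<Longrightarrow> growth l * R \<ge> 1"
  using growth(4) [of l] mult_mono [of 1 "growth l" 1 R] by simp

lemma mat_rad_ge_1: "l > 0 \<Longrightarrow> R \<ge> 1 \<Longrightarrow> mat_rad TYPE('n::finite) l R \<ge> 1"
  unfolding mat_rad_def using growth_mult_ge_1 [of l R] by (intro chart_radius_ge_1) simp

lemma mat_elem_term_bound:
  fixes a :: "('n::finite) pt \<Rightarrow> complex"
  assumes l: "l > 0" and R: "R \<ge> 1" and a: "a \<in> Adn"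
  shows "cmod (coef a \<alpha> * of_real (mon_elem l (redP \<alpha>) (redQ \<alpha>) M J)) * R ^ sum M UNIV \<le>
    knorm (mat_rad TYPE('n) l R) a * (growth l * R) ^ sum J UNIV * (1/2) ^ sum \<alpha> UNIV"
proof -
  note AR = growth_mult_ge_1 [OF l R]
  have "cmod (coef a \<alpha> * of_real (mon_elem l (redP \<alpha>) (redQ \<alpha>) M J)) * R ^ sum M UNIV =
      cmod (coef a \<alpha>) * (mon_elem l (redP \<alpha>) (redQ \<alpha>) M J * R ^ sum M UNIV)"
    using mon_elem_nonneg [OF l, of "redP \<alpha>" "redQ \<alpha>" M J] by (simp add: norm_mult)
  also have "\<dots> \<le> cmod (coef a \<alpha>) * (growth l * R) ^ (sum \<alpha> UNIV + sum J UNIV)"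
    by (intro mult_left_mono mon_elem_red_bound l R) auto
  also have "\<dots> = (cmod (coef a \<alpha>) * (2 * (growth l * R)) ^ sum \<alpha> UNIV) * (growth l * R) ^ sum J UNIV * (1/2) ^ sum \<alpha> UNIV"
    by (simp add: power_add power_mult_distrib [of 2] power_divide)
  also have "\<dots> \<le> knorm (mat_rad TYPE('n) l R) a * (growth l * R) ^ sum J UNIV * (1/2) ^ sum \<alpha> UNIV"
    unfolding mat_rad_def using AR by (intro mult_right_mono coef_bound a) auto
  finally show ?thesis .
qed

lemma mat_elem_summable:
  fixes a :: "('n::finite) pt \<Rightarrow> complex"
  assumes l: "l > 0" and a: "a \<in> Adn"
  shows "(\<lambda>\<alpha>. cmod (coef a \<alpha> * of_real (mon_elem l (redP \<alpha>) (redQ \<alpha>) M J))) summable_on UNIV"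
proof (rule Infinite_Sum.abs_summable_on_comparison_test')
  show "(\<lambda>\<alpha>. knorm (mat_rad TYPE('n) l 1) a * (growth l * 1) ^ sum J UNIV * (1/2) ^ sum \<alpha> UNIV) summable_on
      (UNIV :: ('n + 'n \<Rightarrow> nat) set)"
    by (intro summable_on_cmult_right geo_sum_summable)
  show "cmod (coef a \<alpha> * of_real (mon_elem l (redP \<alpha>) (redQ \<alpha>) M J)) \<le>
    knorm (mat_rad TYPE('n) l 1) a * (growth l * 1) ^ sum J UNIV * (1/2) ^ sum \<alpha> UNIV" for \<alpha>
    using mat_elem_term_bound [OF l order_refl a, of \<alpha> M J] by simp
qed

text \<open>In M the entries decrease faster than every geometric sequence, since R is arbitrary; in
  J they grow at most geometrically. This asymmetry makes matrix products converge.\<close>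

lemma mat_elem_bound:
  fixes a :: "('n::finite) pt \<Rightarrow> complex"
  assumes l: "l > 0" and R: "R \<ge> 1" and a: "a \<in> Adn"
  shows "cmod (mat_elem l M J a) * R ^ sum M UNIV \<le> geo_sum TYPE('n + 'n) * knorm (mat_rad TYPE('n) l R) a * (growth l * R) ^ sum J UNIV"
proof -
  have "cmod (mat_elem l M J a) * R ^ sum M UNIV \<le>
      (\<Sum>\<^sub>\<infinity>\<alpha>. cmod (coef a \<alpha> * of_real (mon_elem l (redP \<alpha>) (redQ \<alpha>) M J))) * R ^ sum M UNIV"
    unfolding mat_elem_def using R by (intro mult_right_mono norm_infsum_bound mat_elem_summable l a) auto
  also have "\<dots> = (\<Sum>\<^sub>\<infinity>\<alpha>. cmod (coef a \<alpha> * of_real (mon_elem l (redP \<alpha>) (redQ \<alpha>) M J)) * R ^ sum M UNIV)"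
    by (rule infsum_cmult_left' [symmetric])
  also have "\<dots> \<le> (\<Sum>\<^sub>\<infinity>\<alpha>::'n + 'n \<Rightarrow> nat. knorm (mat_rad TYPE('n) l R) a * (growth l * R) ^ sum J UNIV * (1/2) ^ sum \<alpha> UNIV)"
    by (intro infsum_mono summable_on_cmult_left mat_elem_summable summable_on_cmult_right geo_sum_summable mat_elem_term_bound l a R)
  also have "\<dots> = geo_sum TYPE('n + 'n) * knorm (mat_rad TYPE('n) l R) a * (growth l * R) ^ sum J UNIV"
    unfolding infsum_cmult_right' geo_sum_def by simp
  finally show ?thesis .
qed

lemma cont_functional_mat_elem:
  fixes M J :: "'n::finite \<Rightarrow> nat"
  assumes l: "l > 0"
  shows "cont_functional (mat_elem l M J)"
  unfolding cont_functional_def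
proof (intro conjI ballI allI exI)
  fix a b :: "'n pt \<Rightarrow> complex" assume ab: "a \<in> Adn" "b \<in> Adn"
  show "mat_elem l M J (\<lambda>r. a r + b r) = mat_elem l M J a + mat_elem l M J b"
    unfolding mat_elem_def coef_add [OF ab] distrib_right
    by (rule infsum_add [OF abs_summable_summable [OF mat_elem_summable [OF l ab(1)]]
      abs_summable_summable [OF mat_elem_summable [OF l ab(2)]]])
next
  fix k and a :: "'n pt \<Rightarrow> complex" assume a: "a \<in> Adn"
  show "mat_elem l M J (\<lambda>r. k * a r) = k * mat_elem l M J a"
    unfolding mat_elem_def coef_cmult [OF a] mult.assoc by (rule infsum_cmult_right')
next
  show "mat_rad TYPE('n) l 1 \<ge> 1" by (rule mat_rad_ge_1 [OF l]) simp
  fix a :: "'n pt \<Rightarrow> complex" assume a: "a \<in> Adn"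
  show "cmod (mat_elem l M J a) \<le> (geo_sum TYPE('n + 'n) * (growth l * 1) ^ sum J UNIV) * knorm (mat_rad TYPE('n) l 1) a"
    using mat_elem_bound [OF l order_refl a, of M J] by (simp add: mult_ac)
qed

lemma infsum_single:
  fixes f :: "'x \<Rightarrow> complex"
  assumes "\<And>x. x \<noteq> y \<Longrightarrow> f x = 0"
  shows "infsum f UNIV = f y"
proof -
  have "infsum f UNIV = infsum f {y}" by (rule infsum_cong_neutral) (use assms in auto)
  then show ?thesis by simp
qed

lemma mat_elem_red_mon: "mat_elem l M J (red_mon \<alpha>) = of_real (mon_elem l (redP \<alpha>) (redQ \<alpha>) M J)"
  unfolding mat_elem_def coef_red_mon by (subst infsum_single [of \<alpha>]) auto

section \<open>Matrix elements respect the relation of the quadric\<close>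

lemma fPQ_relation:
  fixes P Q :: "('n::finite) mi"
  shows "fPQ (P(None := Suc (P None))) (Q(None := Suc (Q None))) =
    (\<lambda>r. fPQ P Q r + (\<Sum>j\<in>UNIV. fPQ (P(Some j := Suc (P (Some j)))) (Q(Some j := Suc (Q (Some j)))) r))"
proof
  fix r :: "'n pt"
  have up: "mpow p (P(i := Suc (P i))) = p $ i * mpow p P" for p :: "'n pt" and P i
  proof -
    have "mpow p (P(i := Suc (P i))) = (\<Prod>k\<in>UNIV. (if k = i then p $ i else 1) * (p $ k) ^ P k)"
      unfolding mpow_def by (intro prod.cong) auto
    then show ?thesis by (simp add: prod.distrib mpow_def)
  qed
  show "fPQ (P(None := Suc (P None))) (Q(None := Suc (Q None))) r =
    fPQ P Q r + (\<Sum>j\<in>UNIV. fPQ (P(Some j := Suc (P (Some j)))) (Q(Some j := Suc (Q (Some j)))) r)"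
  proof (cases "r \<in> Zset")
    case True
    let ?m = "mpow r P * mpow (conjv r) Q"
    have "DeltaD r \<in> Zhat" by (rule DeltaD_Zhat [OF True])
    then have "r $ None * conjv r $ None = 1 + (\<Sum>j\<in>UNIV. r $ Some j * conjv r $ Some j)"
      unfolding Zhat_iff DeltaD_def by simp
    then have "(r $ None * conjv r $ None) * ?m = ?m + (\<Sum>j\<in>UNIV. (r $ Some j * conjv r $ Some j) * ?m)"
      by (simp only: distrib_right sum_distrib_right mult_1_left)
    then show ?thesis using True
      unfolding fPQ_def up by (simp only: if_True mult_ac)
  qed (simp add: fPQ_def)
qed

text \<open>With the common factors removed this is l + P_0 + |J| = (l + |P|) + \<Sum>_j (J_j -
  P_j), where j runs over the indices other than 0.\<close>

lemma mon_elem_relation: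
  fixes P Q :: "('n::finite) mi"
  assumes l: "l > 0"
  shows "mon_elem l (P(None := Suc (P None))) (Q(None := Suc (Q None))) M J =
    mon_elem l P Q M J + (\<Sum>j\<in>UNIV. mon_elem l (P(Some j := Suc (P (Some j)))) (Q(Some j := Suc (Q (Some j)))) M J)"
proof (cases "\<forall>j. M j + P (Some j) = J j + Q (Some j)")
  case True
  let ?F = "\<Prod>k\<in>UNIV. ffall (real (J k)) (P (Some k))"
  let ?p = "pochhammer l (P None + sum J UNIV)" and ?j = "pochhammer l (sum J UNIV)"
  let ?m = "pochhammer l (mabs P)"
  have m: "mabs (P(i := Suc (P i))) = Suc (mabs P)" for i
  proof -
    have "mabs (P(i := Suc (P i))) = (\<Sum>k\<in>UNIV. (if k = i then 1 else 0) + P k)"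
      unfolding mabs_def by (intro sum.cong) auto
    then show ?thesis by (simp add: sum.distrib mabs_def)
  qed
  have ps: "pochhammer l (Suc (mabs P)) = ?m * (l + real (mabs P))"
    "pochhammer l (Suc (P None) + sum J UNIV) = ?p * (l + real (P None + sum J UNIV))"
    by (simp_all add: pochhammer_Suc)
  have nz: "?m \<noteq> 0" "?j \<noteq> 0" "l + real (mabs P) \<noteq> 0"
    using l by (simp_all add: pochhammer_neq_0)
  have F: "(\<Prod>k\<in>UNIV. ffall (real (J k)) ((P(Some j := Suc (P (Some j)))) (Some k))) = ?F * (real (J j) - real (P (Some j)))" for j
  proof -
    have "(\<Prod>k\<in>UNIV. ffall (real (J k)) ((P(Some j := Suc (P (Some j)))) (Some k))) =
      (\<Prod>k\<in>UNIV. ffall (real (J k)) (P (Some k)) * (if k = j then real (J j) - real (P (Some j)) else 1))"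
      by (intro prod.cong) (auto simp: ffall_Suc)
    then show ?thesis by (simp add: prod.distrib)
  qed
  have r0: "mon_elem l (P(None := Suc (P None))) (Q(None := Suc (Q None))) M J =
      ?p * (l + real (P None + sum J UNIV)) / (?m * (l + real (mabs P)) * ?j) * ?F"
    unfolding mon_elem_def m ps(1) using True ps(2) by simp
  have rj: "mon_elem l (P(Some j := Suc (P (Some j)))) (Q(Some j := Suc (Q (Some j)))) M J =
      ?p / (?m * (l + real (mabs P)) * ?j) * (?F * (real (J j) - real (P (Some j))))" for j
  proof -
    have "\<forall>k. M k + (P(Some j := Suc (P (Some j)))) (Some k) = J k + (Q(Some j := Suc (Q (Some j)))) (Some k)"
      using True by auto
    then show ?thesis unfolding mon_elem_def m F ps(1) by simp
  qed
  have r: "mon_elem l P Q M J = ?p / (?m * ?j) * ?F" unfolding mon_elem_def using True by simp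
  have S: "(\<Sum>j\<in>UNIV. real (J j) - real (P (Some j))) = real (sum J UNIV) - (real (mabs P) - real (P None))"
    unfolding mabs_option by (simp add: sum_subtractf)
  have "(\<Sum>j\<in>UNIV. ?p / (?m * (l + real (mabs P)) * ?j) * (?F * (real (J j) - real (P (Some j))))) =
    ?p / (?m * (l + real (mabs P)) * ?j) * (?F * (real (sum J UNIV) - (real (mabs P) - real (P None))))"
    unfolding sum_distrib_left [symmetric] S ..
  then have s: "(\<Sum>j\<in>UNIV. mon_elem l (P(Some j := Suc (P (Some j)))) (Q(Some j := Suc (Q (Some j)))) M J) =
    ?p / (?m * (l + real (mabs P)) * ?j) * (?F * ((l + real (P None + sum J UNIV)) - (l + real (mabs P))))"
    unfolding rj by (simp add: algebra_simps)
  have alg: "p * x / (m * y * j) * F = p / (m * j) * F + p / (m * y * j) * (F * (x - y))"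
    if "m \<noteq> 0" "j \<noteq> 0" "y \<noteq> 0" for p x m y j F :: real
    using that by (simp add: field_simps)
  show ?thesis unfolding r0 r s by (rule alg [OF nz])
next
  case False
  then obtain k where k: "M k + P (Some k) \<noteq> J k + Q (Some k)" by blast
  have "mon_elem l (P(None := Suc (P None))) (Q(None := Suc (Q None))) M J = 0"
    unfolding mon_elem_def by (rule if_not_P) (use k in auto)
  moreover have "mon_elem l P Q M J = 0"
    unfolding mon_elem_def by (rule if_not_P) (use k in auto)
  moreover have "mon_elem l (P(Some j := Suc (P (Some j)))) (Q(Some j := Suc (Q (Some j)))) M J = 0" for j
    unfolding mon_elem_def by (rule if_not_P) (use k in \<open>auto intro!: exI [of _ k]\<close>)
  ultimately show ?thesis by simp
qed

text \<open>Induction on min(P_0, Q_0): the relation of the quadric, which holds both for the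
  functions and for \<open>mon_elem\<close>, trades one factor p_0 q_0 for monomials whose minimum
  is smaller by one. At minimum 0 the monomial is reduced.\<close>

lemma mat_elem_fPQ:
  fixes P Q :: "('n::finite) mi"
  assumes l: "l > 0" and "mabs P = mabs Q"
  shows "mat_elem l M J (fPQ P Q) = of_real (mon_elem l P Q M J)"
  using assms(2)
proof (induction "min (P None) (Q None)" arbitrary: P Q)
  case 0
  define \<alpha> where "\<alpha> = case_sum (\<lambda>j. P (Some j)) (\<lambda>j. Q (Some j))"
  have "redP \<alpha> i = P i" "redQ \<alpha> i = Q i" for i
    using 0 by (cases i; auto simp: redP_def redQ_def \<alpha>_def degL_def degR_def mabs_option)+
  then have "redP \<alpha> = P" "redQ \<alpha> = Q" by auto
  then show ?case using mat_elem_red_mon [of l M J \<alpha>] by simp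
next
  case (Suc m)
  define P' where "P' = P(None := P None - 1)"
  define Q' where "Q' = Q(None := Q None - 1)"
  have n: "P None > 0" "Q None > 0" using Suc.hyps(2) by auto
  then have PQ: "P = P'(None := Suc (P' None))" "Q = Q'(None := Suc (Q' None))"
    by (auto simp: P'_def Q'_def)
  have m: "mabs (P(i := Suc (P i))) = Suc (mabs P)" for i and P :: "'n mi"
  proof -
    have "mabs (P(i := Suc (P i))) = (\<Sum>k\<in>UNIV. (if k = i then 1 else 0) + P k)"
      unfolding mabs_def by (intro sum.cong) auto
    then show ?thesis by (simp add: sum.distrib mabs_def)
  qed
  have e: "mabs P' = mabs Q'" using Suc.prems m [of P' None] m [of Q' None] PQ by simp
  have mn: "m = min (P' None) (Q' None)" using Suc.hyps(2) n by (auto simp: P'_def Q'_def)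
  have i0: "mat_elem l M J (fPQ P' Q') = of_real (mon_elem l P' Q' M J)" by (rule Suc.hyps(1) [OF mn e])
  have ij: "mat_elem l M J (fPQ (P'(Some j := Suc (P' (Some j)))) (Q'(Some j := Suc (Q' (Some j))))) =
    of_real (mon_elem l (P'(Some j := Suc (P' (Some j)))) (Q'(Some j := Suc (Q' (Some j)))) M J)" for j
    by (rule Suc.hyps(1)) (use mn e in \<open>auto simp: m\<close>)
  have A: "fPQ P' Q' \<in> Adn" "fPQ (P'(Some j := Suc (P' (Some j)))) (Q'(Some j := Suc (Q' (Some j)))) \<in> Adn" for j
    by (intro fPQ_Adn; simp add: e m)+
  have "mat_elem l M J (fPQ P Q) = mat_elem l M J (\<lambda>r. fPQ P' Q' r +
    (\<Sum>j\<in>UNIV. fPQ (P'(Some j := Suc (P' (Some j)))) (Q'(Some j := Suc (Q' (Some j)))) r))"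
    unfolding fPQ_relation [symmetric] PQ [symmetric] ..
  also have "\<dots> = mat_elem l M J (fPQ P' Q') +
    (\<Sum>j\<in>UNIV. mat_elem l M J (fPQ (P'(Some j := Suc (P' (Some j)))) (Q'(Some j := Suc (Q' (Some j))))))"
    using A by (subst cont_functional_add [OF cont_functional_mat_elem [OF l]]) (auto intro: Adn_sum simp: cont_functional_sum [OF cont_functional_mat_elem [OF l]])
  also have "\<dots> = of_real (mon_elem l P Q M J)"
    unfolding i0 ij PQ mon_elem_relation [OF l] by simp
  finally show ?case .
qed

text \<open>The matrix element with \<open>J = \<alpha> \<circ> Inl\<close> and \<open>M = \<alpha> \<circ> Inr\<close> involves, besides the coefficient at
  \<open>\<alpha>\<close>, only coefficients at indices of smaller left degree.\<close>

lemma Adn_eq_if_mat_elem: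
  fixes a b :: "('n::finite) pt \<Rightarrow> complex"
  assumes l: "l > 0" and a: "a \<in> Adn" and b: "b \<in> Adn" and eq: "\<And>M J. mat_elem l M J a = mat_elem l M J b"
  shows "a = b"
proof -
  define d where "d r = a r - b r" for r
  have d: "d \<in> Adn" unfolding d_def [abs_def] by (intro Adn_diff a b)
  have z: "mat_elem l M J d = 0" for M J
    unfolding d_def [abs_def] cont_functional_diff [OF cont_functional_mat_elem [OF l] a b] by (simp add: eq)
  have c: "coef d \<alpha> = 0" for \<alpha>
  proof (induction "degL \<alpha>" arbitrary: \<alpha> rule: less_induct)
    case less
    define J where "J j = \<alpha> (Inl j)" for j
    define M where "M j = \<alpha> (Inr j)" for j
    have "coef d \<beta> * of_real (mon_elem l (redP \<beta>) (redQ \<beta>) M J) = 0" if "\<beta> \<noteq> \<alpha>" for \<beta>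
    proof (cases "mon_elem l (redP \<beta>) (redQ \<beta>) M J = 0")
      case False
      then have cond: "\<forall>j. M j + redP \<beta> (Some j) = J j + redQ \<beta> (Some j)"
        unfolding mon_elem_def by (auto split: if_splits)
      have nz: "(\<Prod>j\<in>UNIV. ffall (real (J j)) (redP \<beta> (Some j))) \<noteq> 0"
        using False cond unfolding mon_elem_def by auto
      have le: "\<beta> (Inl j) \<le> \<alpha> (Inl j)" for j
      proof (rule ccontr)
        assume "\<not> ?thesis"
        then have "ffall (real (J j)) (redP \<beta> (Some j)) = 0"
          by (intro ffall_eq_0) (simp add: J_def redP_def)
        then show False using nz by (auto simp: prod_zero_iff)
      qed
      have "\<exists>j. \<beta> (Inl j) \<noteq> \<alpha> (Inl j)"
      proof (rule ccontr)
        assume "\<not> ?thesis"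
        then have L: "\<beta> (Inl j) = \<alpha> (Inl j)" for j by blast
        then have "\<beta> (Inr j) = \<alpha> (Inr j)" for j
          using cond [rule_format, of j] by (simp add: M_def J_def redP_def redQ_def)
        with L have "\<beta> k = \<alpha> k" for k by (cases k) auto
        then show False using that by auto
      qed
      then obtain j where "\<beta> (Inl j) < \<alpha> (Inl j)" using le by (meson le_neq_implies_less)
      then have "degL \<beta> < degL \<alpha>"
        unfolding degL_def using le by (intro sum_strict_mono_ex1) auto
      then show ?thesis using less by simp
    qed simp
    then have "coef d \<alpha> * of_real (mon_elem l (redP \<alpha>) (redQ \<alpha>) M J) = 0"
      using z [of M J] unfolding mat_elem_def by (subst (asm) infsum_single [of \<alpha>]) auto
    \<comment> \<open>The pivot: for this J each falling factorial is J_j!, hence positive, and the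
      coefficient at \<alpha> must vanish.\<close>
    moreover have "mon_elem l (redP \<alpha>) (redQ \<alpha>) M J > 0"
    proof -
      have "\<forall>j. M j + redP \<alpha> (Some j) = J j + redQ \<alpha> (Some j)"
        by (simp add: M_def J_def redP_def redQ_def)
      moreover have "ffall (real (J j)) (redP \<alpha> (Some j)) > 0" for j
        by (simp add: ffall_nat redP_def J_def)
      ultimately show ?thesis unfolding mon_elem_def using l
        by (auto intro!: mult_pos_pos divide_pos_pos prod_pos pochhammer_pos)
    qed
    ultimately show ?case by simp
  qed
  have "d = (\<lambda>r. 0)" by (subst Adn_expansion [OF d]) (simp add: c)
  then show ?thesis by (auto simp: d_def fun_eq_iff)
qed

subsection \<open>The star product\<close>

definition wick_coef :: "real \<Rightarrow> ('n::finite) mi \<Rightarrow> 'n mi \<Rightarrow> 'n mi \<Rightarrow> real" where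
  "wick_coef l P S T = (-1) ^ (T None) *
      (pochhammer l (mabs (\<lambda>i. P i + S i - T i)) * real (mfact T) / (pochhammer l (mabs P) * pochhammer l (mabs S))) *
      real (mbinom P T * mbinom S T)"

lemma wick_basis_eq:
  "wick_basis h P Q R S = (\<lambda>r. \<Sum>T\<in>{T. \<forall>i. T i \<le> min (P i) (S i)}.
     of_real (wick_coef (1 / (2 * h)) P S T) * fPQ (\<lambda>i. P i + R i - T i) (\<lambda>i. Q i + S i - T i) r)"
  unfolding wick_basis_def wick_coef_def by simp

text \<open>As |P+S-T| + |T| = |P| + |S|, the numerator is at most (|P|+|S|)! up to geometric
  factors, and splitting this factorial matches the denominator.\<close>

lemma wick_coef_bound:
  assumes l: "l > 0" and T: "\<And>i. T i \<le> min (P i) (S i)"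
  shows "\<bar>wick_coef l P S T\<bar> \<le> growth l ^ (mabs P + mabs S)"
proof -
  let ?u = "lupper l" and ?d = "llower l" and ?m = "mabs P" and ?s = "mabs S" and ?t = "mabs T"
  let ?k = "mabs (\<lambda>i. P i + S i - T i)"
  note b = growth [OF l] pochhammer_bounds [OF l]
  have "?k + ?t = ?m + ?s" by (rule mabs_minus) (use T in \<open>simp add: trans_le_add1\<close>)
  then have kt: "?k + ?t = ?m + ?s" "?k \<le> ?m + ?s" by auto
  have bin: "real (mbinom P T * mbinom S T) \<le> 2 ^ (?m + ?s)"
    unfolding mbinom_def power_add of_nat_mult of_nat_prod mabs_def
    by (intro mult_mono prod_choose_le prod_nonneg) auto
  have "pochhammer l ?k * real (mfact T) \<le> (?u ^ ?k * fact ?k) * fact ?t"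
    using b l by (intro mult_mono mfact_le) (auto simp: pochhammer_nonneg)
  also have "\<dots> \<le> ?u ^ (?m + ?s) * fact (?m + ?s)"
    using b kt fact_mult_le [of ?k ?t] by (simp add: mult.assoc) (intro mult_mono power_increasing, auto)
  also have "\<dots> \<le> ?u ^ (?m + ?s) * (2 ^ (?m + ?s) * (fact ?m * fact ?s))"
    using b by (intro mult_left_mono fact_add_le) auto
  finally have X: "pochhammer l ?k * real (mfact T) \<le> ?u ^ (?m + ?s) * (2 ^ (?m + ?s) * (fact ?m * fact ?s))" .
  have "(pochhammer l ?k * real (mfact T)) * real (mbinom P T * mbinom S T) \<le>
      (?u ^ (?m + ?s) * (2 ^ (?m + ?s) * (fact ?m * fact ?s))) * 2 ^ (?m + ?s)"
    by (rule mult_mono [OF X bin]) (use b in auto)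
  also have "\<dots> = (?u * 2 * 2) ^ (?m + ?s) * (fact ?m * fact ?s)"
    by (simp only: power_mult_distrib mult_ac)
  also have "\<dots> = growth l ^ (?m + ?s) * (?d ^ (?m + ?s) * (fact ?m * fact ?s))"
  proof -
    have "growth l * ?d = ?u * 2 * 2" using b(2) by (simp add: growth_def)
    then show ?thesis by (simp only: power_mult_distrib [symmetric] mult.assoc [symmetric])
  qed
  also have "\<dots> \<le> growth l ^ (?m + ?s) * (pochhammer l ?m * pochhammer l ?s)"
  proof -
    have "?d ^ (?m + ?s) * (fact ?m * fact ?s) = (?d ^ ?m * fact ?m) * (?d ^ ?s * fact ?s)"
      by (simp add: power_add)
    also have "\<dots> \<le> pochhammer l ?m * pochhammer l ?s"
      using b l by (intro mult_mono) (auto simp: pochhammer_nonneg)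
    finally show ?thesis using b by (intro mult_left_mono) auto
  qed
  finally have main: "(pochhammer l ?k * real (mfact T)) * real (mbinom P T * mbinom S T) \<le>
    growth l ^ (?m + ?s) * (pochhammer l ?m * pochhammer l ?s)" .
  have pos: "pochhammer l ?m * pochhammer l ?s > 0" "pochhammer l ?k \<ge> 0"
    using l by (simp_all add: pochhammer_pos pochhammer_nonneg)
  have "\<bar>wick_coef l P S T\<bar> = (pochhammer l ?k * real (mfact T)) * real (mbinom P T * mbinom S T) / (pochhammer l ?m * pochhammer l ?s)"
    unfolding wick_coef_def using l pos(2) by (simp add: abs_mult power_abs pochhammer_nonneg)
  also have "\<dots> \<le> growth l ^ (?m + ?s)" using main pos by (simp add: divide_le_eq)
  finally show ?thesis .
qed

lemma wick_term_mabs: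
  assumes "mabs P = mabs Q" "mabs R = mabs S" "\<And>i. T i \<le> min (P i) (S i)"
  shows "mabs (\<lambda>i. P i + R i - T i) = mabs (\<lambda>i. Q i + S i - T i)"
    "mabs (\<lambda>i. P i + R i - T i) \<le> mabs P + mabs R"
proof -
  have "T i \<le> P i + R i" "T i \<le> Q i + S i" for i using assms(3) [of i] by auto
  then have "mabs (\<lambda>i. P i + R i - T i) + mabs T = mabs P + mabs R"
     "mabs (\<lambda>i. Q i + S i - T i) + mabs T = mabs Q + mabs S"
    by (auto intro: mabs_minus)
  then show "mabs (\<lambda>i. P i + R i - T i) = mabs (\<lambda>i. Q i + S i - T i)"
    "mabs (\<lambda>i. P i + R i - T i) \<le> mabs P + mabs R" using assms by linarith+
qed

lemma wick_Adn:
  assumes "mabs P = mabs Q" "mabs R = mabs S"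
  shows "wick_basis h P Q R S \<in> Adn"
  unfolding wick_basis_eq
  by (intro Adn_sum Adn_cmult fPQ_Adn wick_term_mabs assms) auto

lemma knorm_wick:
  assumes h: "h > 0" and PQ: "mabs P = mabs Q" and RS: "mabs R = mabs S" and B: "B \<ge> 1"
  shows "knorm B (wick_basis h P Q R S) \<le> (2 * growth (1 / (2 * h)) * B\<^sup>2) ^ (mabs P + mabs R)"
proof -
  let ?l = "1 / (2 * h)" and ?n = "mabs P + mabs R"
  have l: "?l > 0" using h by simp
  let ?TT = "{T. \<forall>i. T i \<le> min (P i) (S i)}"
  let ?f = "\<lambda>T. fPQ (\<lambda>i. P i + R i - T i) (\<lambda>i. Q i + S i - T i)"
  have fA: "?f T \<in> Adn" if "T \<in> ?TT" for T
    using that by (intro fPQ_Adn wick_term_mabs PQ RS) auto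
  have "knorm B (wick_basis h P Q R S) \<le> (\<Sum>T\<in>?TT. knorm B (\<lambda>r. of_real (wick_coef ?l P S T) * ?f T r))"
    unfolding wick_basis_eq by (intro knorm_sum Adn_cmult fA)
  also have "\<dots> \<le> (\<Sum>T\<in>?TT. (growth ?l * B\<^sup>2) ^ ?n)"
  proof (rule sum_mono)
    fix T assume T: "T \<in> ?TT"
    then have T': "T i \<le> min (P i) (S i)" for i by simp
    have "knorm B (\<lambda>r. of_real (wick_coef ?l P S T) * ?f T r) \<le> cmod (of_real (wick_coef ?l P S T)) * knorm B (?f T)"
      by (intro knorm_cmult fA T)
    also have "\<dots> \<le> growth ?l ^ ?n * (B ^ (2 * ?n))"
    proof (intro mult_mono)
      show "cmod (of_real (wick_coef ?l P S T)) \<le> growth ?l ^ ?n"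
        using wick_coef_bound [OF l T'] RS by simp
      have "knorm B (?f T) \<le> B ^ (mabs (\<lambda>i. P i + R i - T i) + mabs (\<lambda>i. Q i + S i - T i))"
        by (intro knorm_fPQ wick_term_mabs PQ RS T' B)
      also have "\<dots> \<le> B ^ (2 * ?n)"
        using wick_term_mabs [OF PQ RS T'] B by (intro power_increasing) auto
      finally show "knorm B (?f T) \<le> B ^ (2 * ?n)" .
      show "0 \<le> knorm B (?f T)" by (intro knorm_nonneg fA T)
    qed (use growth [OF l] in auto)
    finally show "knorm B (\<lambda>r. of_real (wick_coef ?l P S T) * ?f T r) \<le> (growth ?l * B\<^sup>2) ^ ?n"
      by (simp only: power_mult_distrib power_mult)
  qed
  also have "\<dots> = real (card ?TT) * (growth ?l * B\<^sup>2) ^ ?n" by simp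
  also have "\<dots> \<le> 2 ^ ?n * (growth ?l * B\<^sup>2) ^ ?n"
  proof (intro mult_right_mono)
    have "card ?TT \<le> 2 ^ (\<Sum>i\<in>UNIV. min (P i) (S i))" by (rule multiindex_box)
    also have "\<dots> \<le> 2 ^ ?n"
      by (intro power_increasing) (auto simp: mabs_def intro!: trans_le_add1 sum_mono)
    finally have "real (card ?TT) \<le> real (2 ^ ?n)" by (simp only: of_nat_le_iff)
    then show "real (card ?TT) \<le> 2 ^ ?n" by simp
  qed (use growth [OF l] in auto)
  finally show ?thesis by (simp add: power_mult_distrib mult.assoc)
qed

text \<open>Only the intermediate index \<open>?K0\<close> contributes. The result is written as a
  sum over all K so that it can be combined for series of monomials with different
  \<open>?K0\<close>.\<close>

lemma mat_elem_wick:
  assumes h: "h > 0" and PQ: "mabs P = mabs Q" and RS: "mabs R = mabs S"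
  shows "mat_elem (1 / (2 * h)) M J (wick_basis h P Q R S) =
    (\<Sum>\<^sub>\<infinity>K. of_real (mon_elem (1 / (2 * h)) P Q M K) * of_real (mon_elem (1 / (2 * h)) R S K J))"
proof -
  let ?l = "1 / (2 * h)"
  have l: "?l > 0" using h by simp
  let ?TT = "{T. \<forall>i. T i \<le> min (P i) (S i)}"
  let ?f = "\<lambda>T. fPQ (\<lambda>i. P i + R i - T i) (\<lambda>i. Q i + S i - T i)"
  let ?r = "\<lambda>T. mon_elem ?l (\<lambda>i. P i + R i - T i) (\<lambda>i. Q i + S i - T i) M J"
  let ?K0 = "\<lambda>j. J j + S (Some j) - R (Some j)"
  have e: "mabs (\<lambda>i. P i + R i - T i) = mabs (\<lambda>i. Q i + S i - T i)" if "T \<in> ?TT" for T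
    using that by (intro wick_term_mabs PQ RS) auto
  have "mat_elem ?l M J (wick_basis h P Q R S) = (\<Sum>T\<in>?TT. mat_elem ?l M J (\<lambda>r. of_real (wick_coef ?l P S T) * ?f T r))"
    unfolding wick_basis_eq by (intro cont_functional_sum cont_functional_mat_elem l Adn_cmult fPQ_Adn e)
  also have "\<dots> = (\<Sum>T\<in>?TT. of_real (wick_coef ?l P S T) * of_real (?r T))"
    by (intro sum.cong refl) (simp add: cont_functional_cmult [OF cont_functional_mat_elem [OF l]] fPQ_Adn mat_elem_fPQ [OF l] e)
  also have "\<dots> = of_real (\<Sum>T\<in>?TT. wick_coef ?l P S T * ?r T)" by simp
  also have "\<dots> = of_real (mon_elem ?l P Q M ?K0 * mon_elem ?l R S ?K0 J)"
    unfolding wick_coef_def using mon_elem_wick [OF l RS, of P Q M J] by simp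
  also have "\<dots> = (\<Sum>\<^sub>\<infinity>K. of_real (mon_elem ?l P Q M K) * of_real (mon_elem ?l R S K J))"
    by (subst infsum_single [of ?K0]) (use mon_elem_support [of ?l R S _ J] in auto)
  finally show ?thesis .
qed

definition wick_red :: "real \<Rightarrow> ('n::finite + 'n \<Rightarrow> nat) \<Rightarrow> ('n + 'n \<Rightarrow> nat) \<Rightarrow> 'n pt \<Rightarrow> complex" where
  "wick_red h \<alpha> \<beta> = wick_basis h (redP \<alpha>) (redQ \<alpha>) (redP \<beta>) (redQ \<beta>)"

text \<open>An explicit candidate for \<open>star_h\<close>, whose definition offers no formula: the
  formal product extended bilinearly to the reduced expansions.\<close>

definition wick_star :: "real \<Rightarrow> (('n::finite) pt \<Rightarrow> complex) \<Rightarrow> ('n pt \<Rightarrow> complex) \<Rightarrow> 'n pt \<Rightarrow> complex" where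
  "wick_star h a b = (\<lambda>r. \<Sum>\<^sub>\<infinity>x. (coef a (fst x) * coef b (snd x)) * wick_red h (fst x) (snd x) r)"

text \<open>The inner base is the growth rate of products of monomials in \<open>knorm_wick\<close>;
  the outer 2 makes the double series summable.\<close>

definition star_rad :: "'n::finite itself \<Rightarrow> real \<Rightarrow> real \<Rightarrow> real" where
  "star_rad _ h B = chart_radius TYPE('n) (2 * (2 * growth (1 / (2 * h)) * B\<^sup>2))"

lemma wick_red_Adn: "wick_red h \<alpha> \<beta> \<in> Adn"
  unfolding wick_red_def by (rule wick_Adn) (simp_all add: mabs_red)

lemma star_rad_aux:
  assumes "h > 0" "B \<ge> 1"
  shows "2 * growth (1 / (2 * h)) * B\<^sup>2 \<ge> 1"
proof -
  have "growth (1 / (2 * h)) \<ge> 1" using assms by (intro growth) simp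
  moreover have "B\<^sup>2 \<ge> 1" using assms(2) by (rule one_le_power)
  ultimately have "growth (1 / (2 * h)) * B\<^sup>2 \<ge> 1 * 1" by (intro mult_mono) auto
  then show ?thesis by simp
qed

lemma star_rad_ge_1: "h > 0 \<Longrightarrow> B \<ge> 1 \<Longrightarrow> star_rad TYPE('n::finite) h B \<ge> 1"
  unfolding star_rad_def using star_rad_aux [of h B] by (intro chart_radius_ge_1) simp

lemma star_term_bound:
  fixes a b :: "('n::finite) pt \<Rightarrow> complex"
  assumes h: "h > 0" and a: "a \<in> Adn" and b: "b \<in> Adn" and B: "B \<ge> 1"
  shows "knorm B (\<lambda>r. (coef a \<alpha> * coef b \<beta>) * wick_red h \<alpha> \<beta> r) \<le>
    (knorm (star_rad TYPE('n) h B) a * (1/2) ^ sum \<alpha> UNIV) * (knorm (star_rad TYPE('n) h B) b * (1/2) ^ sum \<beta> UNIV)"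
proof -
  let ?E = "2 * growth (1 / (2 * h)) * B\<^sup>2"
  note E = star_rad_aux [OF h B]
  have "knorm B (\<lambda>r. (coef a \<alpha> * coef b \<beta>) * wick_red h \<alpha> \<beta> r) \<le> cmod (coef a \<alpha> * coef b \<beta>) * knorm B (wick_red h \<alpha> \<beta>)"
    by (intro knorm_cmult wick_red_Adn)
  also have "\<dots> \<le> cmod (coef a \<alpha> * coef b \<beta>) * ?E ^ (mabs (redP \<alpha>) + mabs (redP \<beta>))"
    unfolding wick_red_def by (intro mult_left_mono knorm_wick h B) (simp_all add: mabs_red)
  also have "\<dots> \<le> cmod (coef a \<alpha> * coef b \<beta>) * ?E ^ (sum \<alpha> UNIV + sum \<beta> UNIV)"
    using E by (intro mult_left_mono power_increasing add_mono) (auto simp: mabs_red deg_sum)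
  also have "\<dots> = (cmod (coef a \<alpha>) * (2 * ?E) ^ sum \<alpha> UNIV * (1/2) ^ sum \<alpha> UNIV) *
      (cmod (coef b \<beta>) * (2 * ?E) ^ sum \<beta> UNIV * (1/2) ^ sum \<beta> UNIV)"
  proof -
    have "x * y * E ^ (m + n) = (x * (2 * E) ^ m * (1/2) ^ m) * (y * (2 * E) ^ n * (1/2) ^ n)"
      for x y E :: real and m n
      by (simp add: power_add power_mult_distrib power_divide)
    then show ?thesis unfolding norm_mult .
  qed
  also have "\<dots> \<le> (knorm (star_rad TYPE('n) h B) a * (1/2) ^ sum \<alpha> UNIV) * (knorm (star_rad TYPE('n) h B) b * (1/2) ^ sum \<beta> UNIV)"
    unfolding star_rad_def using E
    by (intro mult_mono mult_right_mono coef_bound a b mult_nonneg_nonneg knorm_nonneg) auto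
  finally show ?thesis .
qed

lemma star_summable:
  fixes a b :: "('n::finite) pt \<Rightarrow> complex"
  assumes h: "h > 0" and a: "a \<in> Adn" and b: "b \<in> Adn" and B: "B \<ge> 1"
  shows "(\<lambda>x. knorm B (\<lambda>r. (coef a (fst x) * coef b (snd x)) * wick_red h (fst x) (snd x) r)) summable_on UNIV"
    "(\<lambda>x::('n + 'n \<Rightarrow> nat) \<times> ('n + 'n \<Rightarrow> nat).
      (knorm (star_rad TYPE('n) h B) a * (1/2) ^ sum (fst x) UNIV) * (knorm (star_rad TYPE('n) h B) b * (1/2) ^ sum (snd x) UNIV)) summable_on UNIV"
proof -
  have "(\<lambda>(\<alpha>::'n + 'n \<Rightarrow> nat, \<beta>::'n + 'n \<Rightarrow> nat).
      (knorm (star_rad TYPE('n) h B) a * (1/2) ^ sum \<alpha> UNIV) * (knorm (star_rad TYPE('n) h B) b * (1/2) ^ sum \<beta> UNIV)) summable_on UNIV"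
    by (intro summable_on_product_real summable_on_cmult_right geo_sum_summable mult_nonneg_nonneg knorm_nonneg a b) auto
  then show s: "(\<lambda>x::('n + 'n \<Rightarrow> nat) \<times> ('n + 'n \<Rightarrow> nat).
      (knorm (star_rad TYPE('n) h B) a * (1/2) ^ sum (fst x) UNIV) * (knorm (star_rad TYPE('n) h B) b * (1/2) ^ sum (snd x) UNIV)) summable_on UNIV"
    by (simp only: case_prod_beta')
  show "(\<lambda>x. knorm B (\<lambda>r. (coef a (fst x) * coef b (snd x)) * wick_red h (fst x) (snd x) r)) summable_on UNIV"
    by (rule summable_on_comparison_test [OF s star_term_bound [OF h a b B]])
      (intro knorm_nonneg Adn_cmult wick_red_Adn)
qed

lemma wick_star_Adn: "h > 0 \<Longrightarrow> a \<in> Adn \<Longrightarrow> b \<in> Adn \<Longrightarrow> wick_star h a b \<in> Adn"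
  unfolding wick_star_def by (intro Adn_infsum Adn_cmult wick_red_Adn star_summable)

lemma knorm_wick_star:
  fixes a b :: "('n::finite) pt \<Rightarrow> complex"
  assumes h: "h > 0" and a: "a \<in> Adn" and b: "b \<in> Adn" and B: "B \<ge> 1"
  shows "knorm B (wick_star h a b) \<le> (geo_sum TYPE('n + 'n))\<^sup>2 * knorm (star_rad TYPE('n) h B) a * knorm (star_rad TYPE('n) h B) b"
proof -
  let ?sa = "knorm (star_rad TYPE('n) h B) a" and ?sb = "knorm (star_rad TYPE('n) h B) b"
  have "knorm B (wick_star h a b) \<le> (\<Sum>\<^sub>\<infinity>x. knorm B (\<lambda>r. (coef a (fst x) * coef b (snd x)) * wick_red h (fst x) (snd x) r))"
    unfolding wick_star_def by (intro knorm_infsum Adn_cmult wick_red_Adn star_summable h a b B)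
  also have "\<dots> \<le> (\<Sum>\<^sub>\<infinity>x::('n + 'n \<Rightarrow> nat) \<times> ('n + 'n \<Rightarrow> nat).
      (?sa * (1/2) ^ sum (fst x) UNIV) * (?sb * (1/2) ^ sum (snd x) UNIV))"
    by (intro infsum_mono star_summable star_term_bound h a b B)
  also have "\<dots> = (\<Sum>\<^sub>\<infinity>\<alpha>::'n + 'n \<Rightarrow> nat. \<Sum>\<^sub>\<infinity>\<beta>::'n + 'n \<Rightarrow> nat. (?sa * (1/2) ^ sum \<alpha> UNIV) * (?sb * (1/2) ^ sum \<beta> UNIV))"
    using infsum_Sigma_banach [of "\<lambda>x::('n + 'n \<Rightarrow> nat) \<times> ('n + 'n \<Rightarrow> nat).
      (?sa * (1/2) ^ sum (fst x) UNIV) * (?sb * (1/2) ^ sum (snd x) UNIV)" UNIV "\<lambda>_. UNIV"]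
      star_summable(2) [OF h a b B] by simp
  also have "\<dots> = (geo_sum TYPE('n + 'n))\<^sup>2 * ?sa * ?sb"
    unfolding infsum_cmult_right' infsum_cmult_left' geo_sum_def power2_eq_square by simp
  finally show ?thesis .
qed

text \<open>The identity for pairs of monomials is summed over both expansions. The analytic point
  is the exchange of these sums with the sum over the intermediate index K.\<close>

lemma mat_elem_wick_star:
  fixes a b :: "('n::finite) pt \<Rightarrow> complex"
  assumes h: "h > 0" and a: "a \<in> Adn" and b: "b \<in> Adn"
  shows "mat_elem (1 / (2 * h)) M J (wick_star h a b) = (\<Sum>\<^sub>\<infinity>K. mat_elem (1 / (2 * h)) M K a * mat_elem (1 / (2 * h)) K J b)"
proof -
  define l where "l = 1 / (2 * h)"
  have l: "l > 0" using h by (simp add: l_def)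
  define u where "u K \<alpha> = coef a \<alpha> * of_real (mon_elem l (redP \<alpha>) (redQ \<alpha>) M K)" for K \<alpha>
  define v where "v K \<beta> = coef b \<beta> * of_real (mon_elem l (redP \<beta>) (redQ \<beta>) K J)" for K \<beta>
  have red: "mabs (redP \<alpha>) = mabs (redQ \<alpha>)" for \<alpha> :: "'n + 'n \<Rightarrow> nat" by (simp add: mabs_red)
  have "((\<lambda>x. mat_elem l M J (\<lambda>r. (coef a (fst x) * coef b (snd x)) * wick_red h (fst x) (snd x) r)) has_sum
      mat_elem l M J (wick_star h a b)) UNIV"
    unfolding wick_star_def by (intro cont_functional_infsum cont_functional_mat_elem l Adn_cmult wick_red_Adn star_summable h a b)
  then have "mat_elem l M J (wick_star h a b) = (\<Sum>\<^sub>\<infinity>x. mat_elem l M J (\<lambda>r. (coef a (fst x) * coef b (snd x)) * wick_red h (fst x) (snd x) r))"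
    by (rule infsumI [symmetric])
  also have "\<dots> = (\<Sum>\<^sub>\<infinity>x. \<Sum>\<^sub>\<infinity>K. u K (fst x) * v K (snd x))"
  proof (rule infsum_cong)
    fix x :: "('n + 'n \<Rightarrow> nat) \<times> ('n + 'n \<Rightarrow> nat)"
    have "mat_elem l M J (\<lambda>r. (coef a (fst x) * coef b (snd x)) * wick_red h (fst x) (snd x) r) =
      (coef a (fst x) * coef b (snd x)) * mat_elem l M J (wick_red h (fst x) (snd x))"
      by (rule cont_functional_cmult [OF cont_functional_mat_elem [OF l] wick_red_Adn])
    also have "mat_elem l M J (wick_red h (fst x) (snd x)) =
      (\<Sum>\<^sub>\<infinity>K. of_real (mon_elem l (redP (fst x)) (redQ (fst x)) M K) * of_real (mon_elem l (redP (snd x)) (redQ (snd x)) K J))"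
      unfolding wick_red_def l_def by (rule mat_elem_wick [OF h red red])
    finally show "mat_elem l M J (\<lambda>r. (coef a (fst x) * coef b (snd x)) * wick_red h (fst x) (snd x) r) =
      (\<Sum>\<^sub>\<infinity>K. u K (fst x) * v K (snd x))"
      unfolding u_def v_def infsum_cmult_right' [symmetric] by (simp add: mult_ac)
  qed
  also have "\<dots> = (\<Sum>\<^sub>\<infinity>K. \<Sum>\<^sub>\<infinity>x. u K (fst x) * v K (snd x))"
  proof (rule infsum_swap_banach)
    let ?A = "growth l"
    have A: "?A \<ge> 1" by (rule growth(4) [OF l])
    have A2: "2 * ?A \<ge> 1" using A by simp
    \<comment> \<open>The second factor is estimated at R = \<open>2 * ?A\<close>: its decay
      (2A)^-|K| outweighs the growth A^|K| of the first and leaves 2^-|K|.\<close>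
    let ?sa = "knorm (mat_rad TYPE('n) l 1) a" and ?sb = "knorm (mat_rad TYPE('n) l (2 * ?A)) b"
    let ?c = "(?A * (2 * ?A)) ^ sum J UNIV"
    have bd: "cmod (u K \<alpha> * v K \<beta>) \<le> ((?sa * (1/2) ^ sum \<alpha> UNIV) * ((?sb * ?c) * (1/2) ^ sum \<beta> UNIV)) * (1/2) ^ sum K UNIV" for K \<alpha> \<beta>
    proof -
      have X: "cmod (u K \<alpha>) \<le> ?sa * ?A ^ sum K UNIV * (1/2) ^ sum \<alpha> UNIV"
        using mat_elem_term_bound [OF l order_refl a, of \<alpha> M K] unfolding u_def by simp
      have Y: "cmod (v K \<beta>) * (2 * ?A) ^ sum K UNIV \<le> ?sb * ?c * (1/2) ^ sum \<beta> UNIV"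
        unfolding v_def by (rule mat_elem_term_bound [OF l A2 b])
      have "cmod (u K \<alpha>) * (cmod (v K \<beta>) * (2 * ?A) ^ sum K UNIV) \<le>
        (?sa * ?A ^ sum K UNIV * (1/2) ^ sum \<alpha> UNIV) * (?sb * ?c * (1/2) ^ sum \<beta> UNIV)"
        by (rule mult_mono [OF X Y]) (use A in \<open>auto intro!: mult_nonneg_nonneg knorm_nonneg a\<close>)
      then have "(cmod (u K \<alpha> * v K \<beta>) * 2 ^ sum K UNIV) * ?A ^ sum K UNIV \<le>
        ((?sa * (1/2) ^ sum \<alpha> UNIV) * ((?sb * ?c) * (1/2) ^ sum \<beta> UNIV)) * ?A ^ sum K UNIV"
        unfolding norm_mult power_mult_distrib [of 2] by (simp only: mult_ac)
      then have "cmod (u K \<alpha> * v K \<beta>) * 2 ^ sum K UNIV \<le>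
        (?sa * (1/2) ^ sum \<alpha> UNIV) * ((?sb * ?c) * (1/2) ^ sum \<beta> UNIV)"
        using A by (subst (asm) mult_le_cancel_right_pos) auto
      then show ?thesis unfolding power_one_over [of 2 "sum K UNIV"] by (simp only: pos_le_divide_eq zero_less_power zero_less_numeral times_divide_eq_right mult_1_right)
    qed
    have "(\<lambda>(\<alpha>::'n + 'n \<Rightarrow> nat, \<beta>::'n + 'n \<Rightarrow> nat). (?sa * (1/2) ^ sum \<alpha> UNIV) * ((?sb * ?c) * (1/2) ^ sum \<beta> UNIV)) summable_on UNIV"
      using A by (intro summable_on_product_real summable_on_cmult_right geo_sum_summable mult_nonneg_nonneg knorm_nonneg a b) auto
    then have s1: "(\<lambda>x::('n + 'n \<Rightarrow> nat) \<times> ('n + 'n \<Rightarrow> nat). (?sa * (1/2) ^ sum (fst x) UNIV) * ((?sb * ?c) * (1/2) ^ sum (snd x) UNIV)) summable_on UNIV"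
      by (simp only: case_prod_beta')
    have s2: "(\<lambda>(x::('n + 'n \<Rightarrow> nat) \<times> ('n + 'n \<Rightarrow> nat), K::'n \<Rightarrow> nat).
       ((?sa * (1/2) ^ sum (fst x) UNIV) * ((?sb * ?c) * (1/2) ^ sum (snd x) UNIV)) * (1/2) ^ sum K UNIV) summable_on UNIV"
      by (rule summable_on_product_real [OF s1 geo_sum_summable])
        (use A in \<open>auto intro!: mult_nonneg_nonneg knorm_nonneg a b\<close>)
    have "(\<lambda>p. cmod (case p of (x, K) \<Rightarrow> u K (fst x) * v K (snd x))) summable_on UNIV"
      by (rule Infinite_Sum.abs_summable_on_comparison_test' [OF s2]) (use bd in \<open>simp add: case_prod_beta'\<close>)
    from abs_summable_summable [OF this]
    show "(\<lambda>(x, K). u K (fst x) * v K (snd x)) summable_on UNIV \<times> UNIV" by simp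
  qed
  also have "\<dots> = (\<Sum>\<^sub>\<infinity>K. mat_elem l M K a * mat_elem l K J b)"
  proof (rule infsum_cong)
    fix K
    have "(\<Sum>\<^sub>\<infinity>x. u K (fst x) * v K (snd x)) = (\<Sum>\<^sub>\<infinity>(\<alpha>, \<beta>). u K \<alpha> * v K \<beta>)"
      by (simp only: case_prod_beta')
    also have "\<dots> = infsum (u K) UNIV * infsum (v K) UNIV"
      unfolding u_def v_def by (rule infsum_product [OF mat_elem_summable [OF l a] mat_elem_summable [OF l b]])
    finally show "(\<Sum>\<^sub>\<infinity>x. u K (fst x) * v K (snd x)) = mat_elem l M K a * mat_elem l K J b"
      unfolding mat_elem_def u_def v_def .
  qed
  finally show ?thesis unfolding l_def .
qed

lemma mat_elem_product_summable:
  fixes a b :: "('n::finite) pt \<Rightarrow> complex"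
  assumes l: "l > 0" and a: "a \<in> Adn" and b: "b \<in> Adn"
  shows "(\<lambda>K. cmod (mat_elem l M K a * mat_elem l K J b)) summable_on UNIV"
proof (rule Infinite_Sum.abs_summable_on_comparison_test')
  let ?A = "growth l" and ?g = "geo_sum TYPE('n + 'n)"
  have A: "?A \<ge> 1" by (rule growth(4) [OF l])
  have A2: "2 * ?A \<ge> 1" using A by simp
  let ?sa = "?g * knorm (mat_rad TYPE('n) l 1) a"
  let ?sb = "?g * knorm (mat_rad TYPE('n) l (2 * ?A)) b * (?A * (2 * ?A)) ^ sum J UNIV"
  show "(\<lambda>K::'n \<Rightarrow> nat. (?sa * ?sb) * (1/2) ^ sum K UNIV) summable_on UNIV"
    by (intro summable_on_cmult_right geo_sum_summable)
  fix K
  have X: "cmod (mat_elem l M K a) \<le> ?sa * ?A ^ sum K UNIV"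
    using mat_elem_bound [OF l order_refl a, of M K] by simp
  have Y: "cmod (mat_elem l K J b) * (2 * ?A) ^ sum K UNIV \<le> ?sb"
    by (rule mat_elem_bound [OF l A2 b])
  have "cmod (mat_elem l M K a) * (cmod (mat_elem l K J b) * (2 * ?A) ^ sum K UNIV) \<le> (?sa * ?A ^ sum K UNIV) * ?sb"
    by (rule mult_mono [OF X Y]) (use A in \<open>auto intro!: mult_nonneg_nonneg knorm_nonneg a geo_sum_nonneg\<close>)
  then have "(cmod (mat_elem l M K a * mat_elem l K J b) * 2 ^ sum K UNIV) * ?A ^ sum K UNIV \<le> (?sa * ?sb) * ?A ^ sum K UNIV"
    unfolding norm_mult power_mult_distrib [of 2] by (simp only: mult_ac)
  then have "cmod (mat_elem l M K a * mat_elem l K J b) * 2 ^ sum K UNIV \<le> ?sa * ?sb"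
    using A by (subst (asm) mult_le_cancel_right_pos) auto
  then show "cmod (mat_elem l M K a * mat_elem l K J b) \<le> (?sa * ?sb) * (1/2) ^ sum K UNIV"
    unfolding power_one_over [of 2 "sum K UNIV"] by (simp only: pos_le_divide_eq zero_less_power zero_less_numeral times_divide_eq_right mult_1_right)
qed

lemma infsum_diff:
  fixes f g :: "'x \<Rightarrow> complex"
  assumes "f summable_on A" "g summable_on A"
  shows "(\<Sum>\<^sub>\<infinity>x\<in>A. f x - g x) = infsum f A - infsum g A"
  using infsum_add [OF assms(1) iffD2 [OF summable_on_uminus assms(2)]]
  by (simp add: infsum_uminus)

text \<open>The identity ab - cd = (a - c) b + c (b - d), checked on matrix elements; it reduces
  convergence of products to the bound \<open>knorm_wick_star\<close>.\<close>

lemma wick_star_diff: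
  fixes a b c d :: "('n::finite) pt \<Rightarrow> complex"
  assumes h: "h > 0" and A: "a \<in> Adn" "b \<in> Adn" "c \<in> Adn" "d \<in> Adn"
  shows "(\<lambda>r. wick_star h a b r - wick_star h c d r) =
    (\<lambda>r. wick_star h (\<lambda>r. a r - c r) b r + wick_star h c (\<lambda>r. b r - d r) r)"
proof (rule Adn_eq_if_mat_elem [of "1 / (2 * h)"])
  let ?l = "1 / (2 * h)"
  show l: "0 < ?l" using h by simp
  note dA = Adn_diff [OF A(1) A(3)] Adn_diff [OF A(2) A(4)]
  note sA = wick_star_Adn [OF h A(1,2)] wick_star_Adn [OF h A(3,4)] wick_star_Adn [OF h dA(1) A(2)] wick_star_Adn [OF h A(3) dA(2)]
  show "(\<lambda>r. wick_star h a b r - wick_star h c d r) \<in> Adn" by (intro Adn_diff sA)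
  show "(\<lambda>r. wick_star h (\<lambda>r. a r - c r) b r + wick_star h c (\<lambda>r. b r - d r) r) \<in> Adn" by (intro Adn_add sA)
  fix M J
  note cl = cont_functional_mat_elem [OF l]
  note sm = abs_summable_summable [OF mat_elem_product_summable [OF l]]
  have "mat_elem ?l M J (\<lambda>r. wick_star h (\<lambda>r. a r - c r) b r + wick_star h c (\<lambda>r. b r - d r) r) =
    (\<Sum>\<^sub>\<infinity>K. mat_elem ?l M K (\<lambda>r. a r - c r) * mat_elem ?l K J b) + (\<Sum>\<^sub>\<infinity>K. mat_elem ?l M K c * mat_elem ?l K J (\<lambda>r. b r - d r))"
    unfolding cont_functional_add [OF cl sA(3,4)] mat_elem_wick_star [OF h dA(1) A(2)] mat_elem_wick_star [OF h A(3) dA(2)] ..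
  also have "\<dots> = (\<Sum>\<^sub>\<infinity>K. mat_elem ?l M K (\<lambda>r. a r - c r) * mat_elem ?l K J b + mat_elem ?l M K c * mat_elem ?l K J (\<lambda>r. b r - d r))"
    by (rule infsum_add [symmetric]) (intro sm dA A)+
  also have "\<dots> = (\<Sum>\<^sub>\<infinity>K. mat_elem ?l M K a * mat_elem ?l K J b - mat_elem ?l M K c * mat_elem ?l K J d)"
    unfolding cont_functional_diff [OF cl A(1,3)] cont_functional_diff [OF cl A(2,4)] by (simp add: algebra_simps)
  also have "\<dots> = (\<Sum>\<^sub>\<infinity>K. mat_elem ?l M K a * mat_elem ?l K J b) - (\<Sum>\<^sub>\<infinity>K. mat_elem ?l M K c * mat_elem ?l K J d)"
    by (rule infsum_diff) (intro sm A)+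
  also have "\<dots> = mat_elem ?l M J (\<lambda>r. wick_star h a b r - wick_star h c d r)"
    unfolding cont_functional_diff [OF cl sA(1,2)] mat_elem_wick_star [OF h A(1,2)] mat_elem_wick_star [OF h A(3,4)] ..
  finally show "mat_elem ?l M J (\<lambda>r. wick_star h a b r - wick_star h c d r) =
    mat_elem ?l M J (\<lambda>r. wick_star h (\<lambda>r. a r - c r) b r + wick_star h c (\<lambda>r. b r - d r) r)" by simp
qed

section \<open>Polynomials and the continuous extension of the product\<close>

lemma valid_coefD: "valid_coef c \<Longrightarrow> c x \<noteq> 0 \<Longrightarrow> mabs (fst x) = mabs (snd x)"
  unfolding valid_coef_def by (cases x) auto

lemma poly_of_Adn: "valid_coef c \<Longrightarrow> poly_of c \<in> Adn"
  unfolding poly_of_def by (intro Adn_sum Adn_cmult fPQ_Adn) (auto dest: valid_coefD)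

lemma mat_elem_poly_of:
  assumes l: "l > 0" and c: "valid_coef c"
  shows "mat_elem l M J (poly_of c) = (\<Sum>x\<in>{x. c x \<noteq> 0}. c x * of_real (mon_elem l (fst x) (snd x) M J))"
proof -
  have m: "mabs (fst x) = mabs (snd x)" if "x \<in> {x. c x \<noteq> 0}" for x
    using valid_coefD [OF c] that by simp
  have "mat_elem l M J (poly_of c) = (\<Sum>x\<in>{x. c x \<noteq> 0}. mat_elem l M J (\<lambda>r. c x * fPQ (fst x) (snd x) r))"
    unfolding poly_of_def by (intro cont_functional_sum cont_functional_mat_elem l Adn_cmult fPQ_Adn m)
  also have "\<dots> = (\<Sum>x\<in>{x. c x \<noteq> 0}. c x * of_real (mon_elem l (fst x) (snd x) M J))"
    by (intro sum.cong refl) (simp add: cont_functional_cmult [OF cont_functional_mat_elem [OF l]] fPQ_Adn m mat_elem_fPQ [OF l])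
  finally show ?thesis .
qed

lemma mon_elem_product_summable:
  "(\<lambda>K. k * (complex_of_real (mon_elem l P Q M K) * complex_of_real (mon_elem l R S K J))) summable_on UNIV"
proof -
  let ?K0 = "\<lambda>j. J j + S (Some j) - R (Some j)"
  have "(\<lambda>K. k * (complex_of_real (mon_elem l P Q M K) * complex_of_real (mon_elem l R S K J))) summable_on {?K0}"
    by (rule summable_on_finite) simp
  then show ?thesis
    by (rule iffD1 [OF summable_on_cong_neutral, rotated -1]) (use mon_elem_support [of l R S _ J] in auto)
qed

lemma infsum_sum_finite:
  fixes f :: "'x \<Rightarrow> 'y \<Rightarrow> complex"
  assumes "\<And>x. x \<in> A \<Longrightarrow> f x summable_on UNIV"
  shows "(\<Sum>\<^sub>\<infinity>y. \<Sum>x\<in>A. f x y) = (\<Sum>x\<in>A. \<Sum>\<^sub>\<infinity>y. f x y) \<and> (\<lambda>y. \<Sum>x\<in>A. f x y) summable_on UNIV"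
  using assms
proof (induction A rule: infinite_finite_induct)
  case (insert x A)
  then have "(\<lambda>y. \<Sum>x\<in>A. f x y) summable_on UNIV" "f x summable_on UNIV" by auto
  then show ?case using insert by (simp add: infsum_add summable_on_add)
qed auto

text \<open>Independence of the presentation: \<open>pstar\<close> is computed from formal families,
  but its matrix is the product of the matrices of the functions they represent, and the matrix
  determines the element.\<close>

lemma pstar_eq_wick_star:
  fixes c d :: "('n::finite) mi \<times> 'n mi \<Rightarrow> complex"
  assumes h: "h > 0" and c: "valid_coef c" and d: "valid_coef d"
  shows "pstar h c d \<in> Adn" "pstar h c d = wick_star h (poly_of c) (poly_of d)"
proof -
  define l where "l = 1 / (2 * h)"
  have l: "l > 0" using h by (simp add: l_def)
  let ?C = "{x. c x \<noteq> 0}" and ?D = "{y. d y \<noteq> 0}"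
  have mc: "mabs (fst x) = mabs (snd x)" if "x \<in> ?C" for x using valid_coefD [OF c] that by simp
  have md: "mabs (fst x) = mabs (snd x)" if "x \<in> ?D" for x using valid_coefD [OF d] that by simp
  have wA: "wick_basis h (fst x) (snd x) (fst y) (snd y) \<in> Adn" if "x \<in> ?C" "y \<in> ?D" for x y
    by (intro wick_Adn mc md that)
  show pA: "pstar h c d \<in> Adn"
    unfolding pstar_def by (intro Adn_sum Adn_cmult wA)
  show "pstar h c d = wick_star h (poly_of c) (poly_of d)"
  proof (rule Adn_eq_if_mat_elem [OF l pA])
    show "wick_star h (poly_of c) (poly_of d) \<in> Adn" by (intro wick_star_Adn h poly_of_Adn c d)
    fix M J
    let ?t = "\<lambda>x y K. c x * d y * (of_real (mon_elem l (fst x) (snd x) M K) * of_real (mon_elem l (fst y) (snd y) K J))"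
    have "mat_elem l M J (pstar h c d) = (\<Sum>x\<in>?C. mat_elem l M J (\<lambda>r. \<Sum>y\<in>?D. c x * d y * wick_basis h (fst x) (snd x) (fst y) (snd y) r))"
      unfolding pstar_def by (intro cont_functional_sum cont_functional_mat_elem l Adn_sum Adn_cmult wA)
    also have "\<dots> = (\<Sum>x\<in>?C. \<Sum>y\<in>?D. mat_elem l M J (\<lambda>r. c x * d y * wick_basis h (fst x) (snd x) (fst y) (snd y) r))"
      by (rule sum.cong [OF refl], rule cont_functional_sum [OF cont_functional_mat_elem [OF l]]) (intro Adn_cmult wA)
    also have "\<dots> = (\<Sum>x\<in>?C. \<Sum>y\<in>?D. c x * d y * mat_elem l M J (wick_basis h (fst x) (snd x) (fst y) (snd y)))"
      by (rule sum.cong [OF refl], rule sum.cong [OF refl], rule cont_functional_cmult [OF cont_functional_mat_elem [OF l]]) (intro wA)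
    also have "\<dots> = (\<Sum>x\<in>?C. \<Sum>y\<in>?D. \<Sum>\<^sub>\<infinity>K. ?t x y K)"
      unfolding infsum_cmult_right' l_def
      by (rule sum.cong [OF refl], rule sum.cong [OF refl], subst mat_elem_wick [OF h]) (auto intro: mc md)
    also have "\<dots> = (\<Sum>x\<in>?C. \<Sum>\<^sub>\<infinity>K. \<Sum>y\<in>?D. ?t x y K)"
      by (intro sum.cong refl infsum_sum_finite [THEN conjunct1, symmetric] mon_elem_product_summable)
    also have "\<dots> = (\<Sum>\<^sub>\<infinity>K. \<Sum>x\<in>?C. \<Sum>y\<in>?D. ?t x y K)"
      by (intro infsum_sum_finite [THEN conjunct1, symmetric] infsum_sum_finite [THEN conjunct2] mon_elem_product_summable)
    also have "\<dots> = (\<Sum>\<^sub>\<infinity>K. mat_elem l M K (poly_of c) * mat_elem l K J (poly_of d))"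
      unfolding mat_elem_poly_of [OF l c] mat_elem_poly_of [OF l d] sum_product
      by (intro infsum_cong sum.cong refl) (simp only: mult_ac)
    also have "\<dots> = mat_elem l M J (wick_star h (poly_of c) (poly_of d))"
      unfolding l_def by (rule mat_elem_wick_star [OF h poly_of_Adn [OF c] poly_of_Adn [OF d], symmetric])
    finally show "mat_elem l M J (pstar h c d) = mat_elem l M J (wick_star h (poly_of c) (poly_of d))" .
  qed
qed

lemma conv_A_wick_star:
  fixes a b :: "('n::finite) pt \<Rightarrow> complex"
  assumes h: "h > 0" and A: "\<And>k. s k \<in> Adn" "\<And>k. t k \<in> Adn" "a \<in> Adn" "b \<in> Adn"
    and "conv_A s a" "conv_A t b"
  shows "conv_A (\<lambda>k. wick_star h (s k) (t k)) (wick_star h a b)"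
proof (subst conv_A_iff)
  show "wick_star h (s k) (t k) \<in> Adn" for k by (intro wick_star_Adn h A)
  show "wick_star h a b \<in> Adn" by (intro wick_star_Adn h A)
  show "\<forall>B\<ge>1. (\<lambda>k. knorm B (\<lambda>r. wick_star h (s k) (t k) r - wick_star h a b r)) \<longlonglongrightarrow> 0"
  proof (intro allI impI)
    fix B :: real assume B: "B \<ge> 1"
    define B' where "B' = star_rad TYPE('n) h B"
    define G where "G = (geo_sum TYPE('n + 'n))\<^sup>2"
    have B': "B' \<ge> 1" unfolding B'_def by (rule star_rad_ge_1 [OF h B])
    have s: "(\<lambda>k. knorm B' (\<lambda>r. s k r - a r)) \<longlonglongrightarrow> 0" and t: "(\<lambda>k. knorm B' (\<lambda>r. t k r - b r)) \<longlonglongrightarrow> 0"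
      using assms(6,7) B' conv_A_iff [of s a, OF A(1,3)] conv_A_iff [of t b, OF A(2,4)] by auto
    have bd: "knorm B (\<lambda>r. wick_star h (s k) (t k) r - wick_star h a b r) \<le>
      G * knorm B' (\<lambda>r. s k r - a r) * (knorm B' (\<lambda>r. t k r - b r) + knorm B' b) + G * knorm B' a * knorm B' (\<lambda>r. t k r - b r)" for k
    proof -
      have dA: "(\<lambda>r. s k r - a r) \<in> Adn" "(\<lambda>r. t k r - b r) \<in> Adn" by (intro Adn_diff A)+
      have "knorm B' (t k) = knorm B' (\<lambda>r. (t k r - b r) + b r)" by simp
      also have "\<dots> \<le> knorm B' (\<lambda>r. t k r - b r) + knorm B' b" by (intro knorm_add dA A)
      finally have tk: "knorm B' (t k) \<le> knorm B' (\<lambda>r. t k r - b r) + knorm B' b" .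
      have "knorm B (\<lambda>r. wick_star h (s k) (t k) r - wick_star h a b r) \<le>
        knorm B (wick_star h (\<lambda>r. s k r - a r) (t k)) + knorm B (wick_star h a (\<lambda>r. t k r - b r))"
        unfolding wick_star_diff [OF h A(1,2,3,4)] by (intro knorm_add wick_star_Adn h dA A)
      also have "\<dots> \<le> G * knorm B' (\<lambda>r. s k r - a r) * knorm B' (t k) + G * knorm B' a * knorm B' (\<lambda>r. t k r - b r)"
        unfolding G_def B'_def by (intro add_mono knorm_wick_star h dA A B)
      also have "\<dots> \<le> G * knorm B' (\<lambda>r. s k r - a r) * (knorm B' (\<lambda>r. t k r - b r) + knorm B' b) + G * knorm B' a * knorm B' (\<lambda>r. t k r - b r)"
        using tk by (intro add_right_mono mult_left_mono mult_nonneg_nonneg knorm_nonneg dA) (simp_all add: G_def)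
      finally show ?thesis .
    qed
    have "(\<lambda>k. G * knorm B' (\<lambda>r. s k r - a r) * (knorm B' (\<lambda>r. t k r - b r) + knorm B' b) + G * knorm B' a * knorm B' (\<lambda>r. t k r - b r))
      \<longlonglongrightarrow> G * 0 * (0 + knorm B' b) + G * knorm B' a * 0"
      by (intro tendsto_intros s t)
    then have lim: "(\<lambda>k. G * knorm B' (\<lambda>r. s k r - a r) * (knorm B' (\<lambda>r. t k r - b r) + knorm B' b) + G * knorm B' a * knorm B' (\<lambda>r. t k r - b r))
      \<longlonglongrightarrow> 0" by simp
    show "(\<lambda>k. knorm B (\<lambda>r. wick_star h (s k) (t k) r - wick_star h a b r)) \<longlonglongrightarrow> 0"
      by (rule tendsto_sandwich [OF _ _ tendsto_const lim])
        (auto intro!: always_eventually knorm_nonneg Adn_diff wick_star_Adn h A bd)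
  qed
qed

lemma conv_A_unique:
  fixes e e' :: "('n::finite) pt \<Rightarrow> complex"
  assumes A: "\<And>k. s k \<in> Adn" "e \<in> Adn" "e' \<in> Adn" and "conv_A s e" "conv_A s e'"
  shows "e = e'"
proof
  fix r :: "'n pt"
  show "e r = e' r"
  proof (cases "r \<in> Zset")
    case True
    define w where "w = DeltaD r"
    have w: "w \<in> Zhat" unfolding w_def by (rule DeltaD_Zhat [OF True])
    obtain B where B: "B \<ge> 1" "{w} \<subseteq> KB B" using compact_subset_KB [of "{w}"] w by auto
    have lim: "(\<lambda>k. knorm B (\<lambda>r. s k r - e r)) \<longlonglongrightarrow> 0" "(\<lambda>k. knorm B (\<lambda>r. s k r - e' r)) \<longlonglongrightarrow> 0"
      using assms(4,5) B(1) conv_A_iff [of s e, OF A(1,2)] conv_A_iff [of s e', OF A(1,3)] by auto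
    have bd: "cmod (e' r - e r) \<le> knorm B (\<lambda>r. s k r - e r) + knorm B (\<lambda>r. s k r - e' r)" for k
    proof -
      have v: "cmod (s k r - f r) \<le> knorm B (\<lambda>r. s k r - f r)" if "f \<in> Adn" for f
      proof -
        have d: "(\<lambda>r. s k r - f r) \<in> Adn" by (intro Adn_diff A that)
        have "cmod (lift (\<lambda>r. s k r - f r) w) \<le> knorm B (\<lambda>r. s k r - f r)" by (intro knorm_ge d) (use B in auto)
        then show ?thesis unfolding w_def lift_DeltaD [OF d True] .
      qed
      have "cmod (e' r - e r) = cmod ((s k r - e r) - (s k r - e' r))" by simp
      also have "\<dots> \<le> cmod (s k r - e r) + cmod (s k r - e' r)" by (rule norm_triangle_ineq4)
      also have "\<dots> \<le> knorm B (\<lambda>r. s k r - e r) + knorm B (\<lambda>r. s k r - e' r)" by (intro add_mono v A)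
      finally show ?thesis .
    qed
    have "(\<lambda>k. knorm B (\<lambda>r. s k r - e r) + knorm B (\<lambda>r. s k r - e' r)) \<longlonglongrightarrow> 0 + 0"
      by (intro tendsto_add lim)
    then have "cmod (e' r - e r) \<le> 0 + 0"
      by (rule tendsto_lowerbound) (auto intro: always_eventually bd)
    then show ?thesis by simp
  next
    case False
    then show ?thesis using Adn_outside A by metis
  qed
qed

definition unred :: "('n::finite) mi \<times> 'n mi \<Rightarrow> 'n + 'n \<Rightarrow> nat" where
  "unred x = case_sum (\<lambda>j. fst x (Some j)) (\<lambda>j. snd x (Some j))"

lemma unred_red [simp]: "unred (redP \<alpha>, redQ \<alpha>) = \<alpha>"
  by (auto simp: unred_def redP_def redQ_def fun_eq_iff split: sum.split)

text \<open>The reduced expansion is truncated along an enumeration of the multi-indices. Such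
  sequences also keep the condition under \<open>THE\<close> in \<open>star_h\<close> from being
  vacuous.\<close>

lemma polynomials_dense:
  fixes a :: "('n::finite) pt \<Rightarrow> complex"
  assumes a: "a \<in> Adn"
  obtains cs where "\<And>k. valid_coef (cs k)" "conv_A (\<lambda>k. poly_of (cs k)) a"
proof
  define S where "S k = {\<alpha>::'n + 'n \<Rightarrow> nat. to_nat \<alpha> < k}" for k
  \<comment> \<open>A family over all pairs (P, Q) supported on reduced ones: a pair is reduced
    exactly if it is recovered from its entries away from the index 0.\<close>
  define cs where "cs k x = (if x = (redP (unred x), redQ (unred x)) \<and> unred x \<in> S k then coef a (unred x) else 0)" for k x
  have fS: "finite (S k)" for k
    unfolding S_def by (rule finite_subset [OF _ finite_imageI [of "{..<k}" from_nat]]) (auto intro!: image_eqI [of _ _ "to_nat _"])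
  have sub: "{x. cs k x \<noteq> 0} \<subseteq> (\<lambda>\<alpha>. (redP \<alpha>, redQ \<alpha>)) ` S k" for k
    unfolding cs_def by (auto split: if_splits)
  show "valid_coef (cs k)" for k
    unfolding valid_coef_def
  proof (intro conjI allI impI)
    show "finite {x. cs k x \<noteq> 0}" by (rule finite_subset [OF sub]) (intro finite_imageI fS)
    fix P Q assume "cs k (P, Q) \<noteq> 0"
    then have "(P, Q) \<in> (\<lambda>\<alpha>. (redP \<alpha>, redQ \<alpha>)) ` S k" using sub by blast
    then show "mabs P = mabs Q" by (auto simp: mabs_red)
  qed
  note valid = this
  have p: "poly_of (cs k) = (\<lambda>r. \<Sum>\<alpha>\<in>S k. coef a \<alpha> * red_mon \<alpha> r)" for k
  proof
    fix r
    have "poly_of (cs k) r = (\<Sum>x\<in>(\<lambda>\<alpha>. (redP \<alpha>, redQ \<alpha>)) ` S k. cs k x * fPQ (fst x) (snd x) r)"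
      unfolding poly_of_def by (rule sum.mono_neutral_left) (use fS sub in auto)
    also have "\<dots> = (\<Sum>\<alpha>\<in>S k. cs k (redP \<alpha>, redQ \<alpha>) * red_mon \<alpha> r)"
    proof (subst sum.reindex)
      show "inj_on (\<lambda>\<alpha>. (redP \<alpha>, redQ \<alpha>)) (S k)" by (rule inj_on_inverseI [of _ unred]) simp
    qed simp
    also have "\<dots> = (\<Sum>\<alpha>\<in>S k. coef a \<alpha> * red_mon \<alpha> r)"
      by (intro sum.cong) (auto simp: cs_def)
    finally show "poly_of (cs k) r = (\<Sum>\<alpha>\<in>S k. coef a \<alpha> * red_mon \<alpha> r)" .
  qed
  show "conv_A (\<lambda>k. poly_of (cs k)) a"
  proof (subst conv_A_iff)
    show pA: "poly_of (cs k) \<in> Adn" for k by (rule poly_of_Adn [OF valid])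
    show "a \<in> Adn" by (rule a)
    show "\<forall>B\<ge>1. (\<lambda>k. knorm B (\<lambda>r. poly_of (cs k) r - a r)) \<longlonglongrightarrow> 0"
    proof (intro allI impI)
      fix B :: real assume B: "B \<ge> 1"
      let ?s = "\<lambda>\<alpha>. knorm B (\<lambda>r. coef a \<alpha> * red_mon \<alpha> r)"
      \<comment> \<open>The sets \<open>S k\<close> eventually contain every finite set, so the
        unordered sum may be evaluated along this sequence.\<close>
      have "filterlim S (finite_subsets_at_top UNIV) sequentially"
        unfolding filterlim_finite_subsets_at_top
      proof (intro allI impI, elim conjE)
        fix X :: "('n + 'n \<Rightarrow> nat) set" assume X: "finite X"
        obtain N where N: "\<And>\<alpha>. \<alpha> \<in> X \<Longrightarrow> to_nat \<alpha> < N"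
          using finite_nat_set_iff_bounded [of "to_nat ` X"] X by auto
        show "\<forall>\<^sub>F k in sequentially. finite (S k) \<and> X \<subseteq> S k \<and> S k \<subseteq> UNIV"
          using eventually_ge_at_top [of N]
        proof eventually_elim
          case (elim k)
          then show ?case using N fS by (fastforce simp: S_def)
        qed
      qed
      moreover have "(sum ?s \<longlongrightarrow> infsum ?s UNIV) (finite_subsets_at_top UNIV)"
        using has_sum_infsum [OF knorm_coef_red_mon_summable [OF a B]] unfolding has_sum_def .
      ultimately have "(\<lambda>k. sum ?s (S k)) \<longlonglongrightarrow> infsum ?s UNIV"
        by (rule filterlim_compose [rotated])
      then have "(\<lambda>k. infsum ?s UNIV - sum ?s (S k)) \<longlonglongrightarrow> infsum ?s UNIV - infsum ?s UNIV"
        by (intro tendsto_intros)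
      then have lim: "(\<lambda>k. infsum ?s UNIV - sum ?s (S k)) \<longlonglongrightarrow> 0" by simp
      have bd: "knorm B (\<lambda>r. poly_of (cs k) r - a r) \<le> infsum ?s UNIV - sum ?s (S k)" for k
      proof -
        have "knorm B (\<lambda>r. (\<Sum>\<alpha>\<in>S k. coef a \<alpha> * red_mon \<alpha> r) - (\<Sum>\<^sub>\<infinity>\<alpha>. coef a \<alpha> * red_mon \<alpha> r)) \<le> infsum ?s UNIV - sum ?s (S k)"
          by (rule knorm_tail [OF Adn_cmult [OF red_mon_Adn] knorm_coef_red_mon_summable [OF a] B fS])
        moreover have "(\<lambda>r. poly_of (cs k) r - a r) = (\<lambda>r. (\<Sum>\<alpha>\<in>S k. coef a \<alpha> * red_mon \<alpha> r) - (\<Sum>\<^sub>\<infinity>\<alpha>. coef a \<alpha> * red_mon \<alpha> r))"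
          unfolding p by (rule ext) (subst Adn_expansion [OF a], rule refl)
        ultimately show ?thesis by simp
      qed
      show "(\<lambda>k. knorm B (\<lambda>r. poly_of (cs k) r - a r)) \<longlonglongrightarrow> 0"
        by (rule tendsto_sandwich [OF _ _ tendsto_const lim])
          (auto intro!: always_eventually knorm_nonneg Adn_diff pA a bd)
    qed
  qed
qed

text \<open>\<open>wick_star\<close> has the required property for all approximating sequences by
  joint continuity; a single pair of such sequences then forces any other candidate to equal
  it.\<close>

lemma star_h_eq_wick_star:
  fixes a b :: "('n::finite) pt \<Rightarrow> complex"
  assumes h: "h > 0" and a: "a \<in> Adn" and b: "b \<in> Adn"
  shows "star_h h a b = wick_star h a b"
proof -
  have ex: "conv_A (\<lambda>k. pstar h (cs k) (ds k)) (wick_star h a b)"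
    if "\<forall>k. valid_coef (cs k)" "\<forall>k. valid_coef (ds k)"
      "conv_A (\<lambda>k. poly_of (cs k)) a" "conv_A (\<lambda>k. poly_of (ds k)) b" for cs ds
  proof -
    have "pstar h (cs k) (ds k) = wick_star h (poly_of (cs k)) (poly_of (ds k))" for k
      using that by (intro pstar_eq_wick_star h) auto
    moreover have "conv_A (\<lambda>k. wick_star h (poly_of (cs k)) (poly_of (ds k))) (wick_star h a b)"
      using that by (intro conv_A_wick_star h a b poly_of_Adn) auto
    ultimately show ?thesis by simp
  qed
  obtain cs where cs: "\<And>k. valid_coef (cs k)" "conv_A (\<lambda>k. poly_of (cs k)) a"
    using polynomials_dense [OF a] by blast
  obtain ds where ds: "\<And>k. valid_coef (ds k)" "conv_A (\<lambda>k. poly_of (ds k)) b"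
    using polynomials_dense [OF b] by blast
  have "(THE e. e \<in> Adn \<and> (\<forall>cs ds. (\<forall>k. valid_coef (cs k)) \<and> (\<forall>k. valid_coef (ds k)) \<and>
        conv_A (\<lambda>k. poly_of (cs k)) a \<and> conv_A (\<lambda>k. poly_of (ds k)) b \<longrightarrow>
        conv_A (\<lambda>k. pstar h (cs k) (ds k)) e)) = wick_star h a b"
  proof (rule the_equality)
    show "wick_star h a b \<in> Adn \<and> (\<forall>cs ds. (\<forall>k. valid_coef (cs k)) \<and> (\<forall>k. valid_coef (ds k)) \<and>
        conv_A (\<lambda>k. poly_of (cs k)) a \<and> conv_A (\<lambda>k. poly_of (ds k)) b \<longrightarrow>
        conv_A (\<lambda>k. pstar h (cs k) (ds k)) (wick_star h a b))"
      using ex wick_star_Adn [OF h a b] by blast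
    fix e assume e: "e \<in> Adn \<and> (\<forall>cs ds. (\<forall>k. valid_coef (cs k)) \<and> (\<forall>k. valid_coef (ds k)) \<and>
        conv_A (\<lambda>k. poly_of (cs k)) a \<and> conv_A (\<lambda>k. poly_of (ds k)) b \<longrightarrow>
        conv_A (\<lambda>k. pstar h (cs k) (ds k)) e)"
    show "e = wick_star h a b"
    proof (rule conv_A_unique)
      show "pstar h (cs k) (ds k) \<in> Adn" for k by (intro pstar_eq_wick_star h cs ds)
      show "conv_A (\<lambda>k. pstar h (cs k) (ds k)) e" using e cs ds by blast
      show "conv_A (\<lambda>k. pstar h (cs k) (ds k)) (wick_star h a b)" using ex cs ds by blast
    qed (use e wick_star_Adn [OF h a b] in auto)
  qed
  then show ?thesis using h unfolding star_h_def by simp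
qed

subsection \<open>The representation on entire functions\<close>

text \<open>Vectors of type \<open>vec\<close> are indexed by nat, so the multi-indices J of the
  basis vectors e_J are enumerated.\<close>

definition idx :: "nat \<Rightarrow> ('n::finite \<Rightarrow> nat)" where
  "idx = from_nat_into UNIV"

lemma bij_idx: "bij (idx :: nat \<Rightarrow> ('n::finite \<Rightarrow> nat))"
  unfolding idx_def
proof (rule bij_betw_from_nat_into)
  have "inj (\<lambda>k (_::'n). k::nat)" by (rule injI) (metis (full_types))
  then have "infinite (range (\<lambda>k (_::'n). k::nat))" by (simp add: finite_image_iff)
  then show "infinite (UNIV :: ('n \<Rightarrow> nat) set)" by (meson finite_subset subset_UNIV)
qed auto

definition idx_deg :: "'n::finite itself \<Rightarrow> nat \<Rightarrow> nat" where
  "idx_deg _ k = sum (idx k :: 'n \<Rightarrow> nat) UNIV"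

text \<open>The Taylor coefficients of entire functions of n variables. The \<open>itself\<close>
  argument supplies n, which the type \<open>vec\<close> does not show.\<close>

definition entire_seqs :: "'n::finite itself \<Rightarrow> vec set" where
  "entire_seqs T = {f. \<forall>R\<ge>1. (\<lambda>k. cmod (f k) * R ^ idx_deg T k) summable_on UNIV}"

text \<open>The squared norm of the monomial z^J for the reproducing kernel (1 - <z,w>)^(-l) on the
  unit ball.\<close>

definition ip_weight :: "'n::finite itself \<Rightarrow> real \<Rightarrow> nat \<Rightarrow> real" where
  "ip_weight T l k = (\<Prod>j\<in>UNIV. fact ((idx k :: 'n \<Rightarrow> nat) j)) / pochhammer l (idx_deg T k)"

definition entire_ip :: "'n::finite itself \<Rightarrow> real \<Rightarrow> vec \<Rightarrow> vec \<Rightarrow> complex" where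
  "entire_ip T l f g = (\<Sum>\<^sub>\<infinity>k. cnj (f k) * g k * of_real (ip_weight T l k))"

definition wick_rep :: "real \<Rightarrow> (('n::finite) pt \<Rightarrow> complex) \<Rightarrow> vec \<Rightarrow> vec" where
  "wick_rep l a f = (\<lambda>k. \<Sum>\<^sub>\<infinity>j. mat_elem l (idx k) (idx j) a * f j)"

lemma entire_seqs_D: "f \<in> entire_seqs T \<Longrightarrow> R \<ge> 1 \<Longrightarrow> (\<lambda>k. cmod (f k) * R ^ idx_deg T k) summable_on UNIV"
  unfolding entire_seqs_def by blast

lemma geo_sum_idx_deg: "(\<lambda>k. (1/2::real) ^ idx_deg TYPE('n::finite) k) summable_on UNIV"
  unfolding idx_deg_def using iffD2 [OF summable_on_reindex_bij_betw [OF bij_idx] geo_sum_summable [where 'i = 'n]] .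

lemma entire_seqs_bound:
  assumes "f \<in> entire_seqs T"
  obtains C where "C \<ge> 0" "\<And>k. cmod (f k) \<le> C"
proof
  let ?C = "\<Sum>\<^sub>\<infinity>k. cmod (f k) * 1 ^ idx_deg T k"
  have s: "(\<lambda>k. cmod (f k) * 1 ^ idx_deg T k) summable_on UNIV" by (rule entire_seqs_D [OF assms]) simp
  show "0 \<le> ?C" by (intro infsum_nonneg) auto
  fix k
  show "cmod (f k) \<le> ?C" using finite_sum_le_infsum [OF s, of "{k}"] by simp
qed

lemma ip_weight_pos: "l > 0 \<Longrightarrow> ip_weight T l k > 0"
  unfolding ip_weight_def by (intro divide_pos_pos prod_pos pochhammer_pos) auto

lemma ip_weight_le: "l > 0 \<Longrightarrow> ip_weight T l k \<le> (1 / llower l) ^ idx_deg T k"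
proof -
  assume l: "l > 0"
  have "(\<Prod>j\<in>UNIV. fact ((idx k :: 'a \<Rightarrow> nat) j)) \<le> (fact (idx_deg TYPE('a) k) :: real)"
    unfolding idx_deg_def by (rule prod_fact_le) simp
  moreover have "llower l ^ idx_deg TYPE('a) k * fact (idx_deg TYPE('a) k) \<le> pochhammer l (idx_deg TYPE('a) k)"
    by (rule pochhammer_bounds [OF l])
  moreover have "llower l ^ idx_deg TYPE('a) k * fact (idx_deg TYPE('a) k) > 0" using growth(2) [OF l] by simp
  ultimately have "ip_weight TYPE('a) l k \<le> fact (idx_deg TYPE('a) k) / (llower l ^ idx_deg TYPE('a) k * fact (idx_deg TYPE('a) k))"
    unfolding ip_weight_def by (intro frac_le) auto
  then show ?thesis by (simp add: power_one_over ip_weight_def idx_deg_def)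
qed

lemma llower_inv: "l > 0 \<Longrightarrow> 1 / llower l \<ge> 1"
  using growth(2,3) [of l] by (simp add: le_divide_eq)

lemma entire_seqs_ip_weight_summable:
  assumes l: "l > 0" and f: "f \<in> entire_seqs T"
  shows "(\<lambda>k. cmod (f k) * ip_weight T l k) summable_on UNIV"
proof (rule summable_on_comparison_test [OF entire_seqs_D [OF f llower_inv [OF l]]])
  fix k
  show "cmod (f k) * ip_weight T l k \<le> cmod (f k) * (1 / llower l) ^ idx_deg T k" by (intro mult_left_mono ip_weight_le l) auto
  show "0 \<le> cmod (f k) * ip_weight T l k" using ip_weight_pos [OF l, of T k] by simp
qed

lemma ip_summable:
  assumes l: "l > 0" and f: "f \<in> entire_seqs T" and g: "g \<in> entire_seqs T"
  shows "(\<lambda>k. cmod (cnj (f k) * g k * of_real (ip_weight T l k))) summable_on UNIV"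
proof -
  obtain C where C: "C \<ge> 0" "\<And>k. cmod (f k) \<le> C" using entire_seqs_bound [OF f] by blast
  have "(\<lambda>k. C * (cmod (g k) * ip_weight T l k)) summable_on UNIV"
    by (intro summable_on_cmult_right entire_seqs_ip_weight_summable l g)
  then show ?thesis
  proof (rule Infinite_Sum.abs_summable_on_comparison_test')
    fix k
    have "cmod (cnj (f k) * g k * of_real (ip_weight T l k)) = cmod (f k) * (cmod (g k) * ip_weight T l k)"
      using ip_weight_pos [OF l, of T k] by (simp add: norm_mult)
    also have "\<dots> \<le> C * (cmod (g k) * ip_weight T l k)"
      using C ip_weight_pos [OF l, of T k] by (intro mult_right_mono) auto
    finally show "cmod (cnj (f k) * g k * of_real (ip_weight T l k)) \<le> C * (cmod (g k) * ip_weight T l k)" .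
  qed
qed

lemma entire_seqs_add: "f \<in> entire_seqs T \<Longrightarrow> g \<in> entire_seqs T \<Longrightarrow> vadd f g \<in> entire_seqs T"
  unfolding entire_seqs_def mem_Collect_eq
proof (intro allI impI)
  fix R :: real assume f: "\<forall>R\<ge>1. (\<lambda>k. cmod (f k) * R ^ idx_deg T k) summable_on UNIV"
    and g: "\<forall>R\<ge>1. (\<lambda>k. cmod (g k) * R ^ idx_deg T k) summable_on UNIV" and R: "R \<ge> 1"
  have "(\<lambda>k. cmod (f k) * R ^ idx_deg T k + cmod (g k) * R ^ idx_deg T k) summable_on UNIV"
    using f g R by (intro summable_on_add) auto
  then show "(\<lambda>k. cmod (vadd f g k) * R ^ idx_deg T k) summable_on UNIV"
  proof (rule summable_on_comparison_test)
    fix k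
    show "cmod (vadd f g k) * R ^ idx_deg T k \<le> cmod (f k) * R ^ idx_deg T k + cmod (g k) * R ^ idx_deg T k"
      unfolding vadd_def distrib_right [symmetric] using R by (intro mult_right_mono norm_triangle_ineq) auto
  qed (use R in auto)
qed

lemma entire_seqs_scale: "f \<in> entire_seqs T \<Longrightarrow> vscale c f \<in> entire_seqs T"
  unfolding entire_seqs_def mem_Collect_eq
proof (intro allI impI)
  fix R :: real assume "\<forall>R\<ge>1. (\<lambda>k. cmod (f k) * R ^ idx_deg T k) summable_on UNIV" "R \<ge> 1"
  then have "(\<lambda>k. cmod c * (cmod (f k) * R ^ idx_deg T k)) summable_on UNIV"
    by (intro summable_on_cmult_right) auto
  then show "(\<lambda>k. cmod (vscale c f k) * R ^ idx_deg T k) summable_on UNIV"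
    by (simp only: vscale_def norm_mult mult.assoc)
qed

lemma pre_hilbert_entire_seqs:
  assumes l: "l > 0"
  shows "pre_hilbert (entire_seqs T) (entire_ip T l)"
  unfolding pre_hilbert_def
proof (intro conjI ballI allI impI)
  note s = abs_summable_summable [OF ip_summable [OF l]]
  show "(\<lambda>n. 0) \<in> entire_seqs T" by (simp add: entire_seqs_def)
  fix f g assume f: "f \<in> entire_seqs T" and g: "g \<in> entire_seqs T"
  show "vadd f g \<in> entire_seqs T" by (rule entire_seqs_add [OF f g])
  show "entire_ip T l f g = cnj (entire_ip T l g f)"
    unfolding entire_ip_def infsum_cnj [symmetric] by (simp add: mult_ac)
  show "entire_ip T l f (vscale c g) = c * entire_ip T l f g" for c
    unfolding entire_ip_def infsum_cmult_right' [symmetric] by (simp add: vscale_def mult_ac)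
  fix k assume k: "k \<in> entire_seqs T"
  have "(\<lambda>n. cnj (f n) * vadd g k n * of_real (ip_weight T l n)) =
     (\<lambda>n. cnj (f n) * g n * of_real (ip_weight T l n) + cnj (f n) * k n * of_real (ip_weight T l n))"
    by (simp add: vadd_def algebra_simps)
  then show "entire_ip T l f (vadd g k) = entire_ip T l f g + entire_ip T l f k"
    unfolding entire_ip_def by (simp only: infsum_add [OF s [OF f g] s [OF f k]])
next
  fix c f assume "f \<in> entire_seqs T"
  then show "vscale c f \<in> entire_seqs T" by (rule entire_seqs_scale)
next
  fix f assume f: "f \<in> entire_seqs T"
  let ?q = "\<lambda>k. (cmod (f k))\<^sup>2 * ip_weight T l k"
  have e: "cnj (f k) * f k * of_real (ip_weight T l k) = of_real (?q k)" for k
    by (simp add: complex_norm_square mult.commute [of "f k"] del: of_real_power)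
  have nn: "0 \<le> ?q k" for k using ip_weight_pos [OF l, of T k] by simp
  have "(\<lambda>k. cmod (of_real (?q k))) summable_on UNIV" using ip_summable [OF l f f] unfolding e .
  then have sq: "?q summable_on UNIV" by (simp only: norm_of_real abs_of_nonneg [OF nn])
  have ff: "entire_ip T l f f = of_real (infsum ?q UNIV)"
    unfolding entire_ip_def e by (rule infsumI [OF has_sum_of_real [OF has_sum_infsum [OF sq]]])
  show "0 \<le> Re (entire_ip T l f f)" unfolding ff by (simp add: infsum_nonneg nn)
  assume "entire_ip T l f f = 0"
  then have z: "infsum ?q UNIV = 0" unfolding ff by simp
  show "f = (\<lambda>n. 0)"
  proof
    fix k
    have "?q k \<le> infsum ?q UNIV" using finite_sum_le_infsum [OF sq, of "{k}"] nn by simp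
    then have "?q k = 0" using z nn [of k] by simp
    then show "f k = 0" using ip_weight_pos [OF l, of T k] by simp
  qed
qed

lemma wick_rep_term_summable:
  fixes a :: "('n::finite) pt \<Rightarrow> complex"
  assumes l: "l > 0" and a: "a \<in> Adn" and f: "f \<in> entire_seqs TYPE('n)"
  shows "(\<lambda>j. cmod (mat_elem l M (idx j) a * f j)) summable_on UNIV"
proof -
  have A: "growth l \<ge> 1" by (rule growth(4) [OF l])
  have "(\<lambda>j. (geo_sum TYPE('n + 'n) * knorm (mat_rad TYPE('n) l 1) a) * (cmod (f j) * growth l ^ idx_deg TYPE('n) j)) summable_on UNIV"
    by (intro summable_on_cmult_right entire_seqs_D f A)
  then show ?thesis
  proof (rule Infinite_Sum.abs_summable_on_comparison_test')
    fix j
    have "cmod (mat_elem l M (idx j) a) \<le> geo_sum TYPE('n + 'n) * knorm (mat_rad TYPE('n) l 1) a * growth l ^ idx_deg TYPE('n) j"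
      using mat_elem_bound [OF l order_refl a, of M "idx j"] by (simp add: idx_deg_def)
    from mult_right_mono [OF this norm_ge_zero [of "f j"]]
    show "cmod (mat_elem l M (idx j) a * f j) \<le> (geo_sum TYPE('n + 'n) * knorm (mat_rad TYPE('n) l 1) a) * (cmod (f j) * growth l ^ idx_deg TYPE('n) j)"
      by (simp add: norm_mult mult_ac)
  qed
qed

lemma wick_rep_bound:
  fixes a :: "('n::finite) pt \<Rightarrow> complex"
  assumes l: "l > 0" and R: "R \<ge> 1" and a: "a \<in> Adn" and f: "f \<in> entire_seqs TYPE('n)"
  shows "cmod (wick_rep l a f k) * R ^ idx_deg TYPE('n) k \<le>
    (geo_sum TYPE('n + 'n) * (\<Sum>\<^sub>\<infinity>j. cmod (f j) * (growth l * R) ^ idx_deg TYPE('n) j)) * knorm (mat_rad TYPE('n) l R) a"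
proof -
  let ?c = "geo_sum TYPE('n + 'n) * knorm (mat_rad TYPE('n) l R) a"
  have s1: "(\<lambda>j. cmod (mat_elem l (idx k) (idx j) a * f j)) summable_on UNIV" by (rule wick_rep_term_summable [OF l a f])
  have s2: "(\<lambda>j. cmod (f j) * (growth l * R) ^ idx_deg TYPE('n) j) summable_on UNIV" by (rule entire_seqs_D [OF f growth_mult_ge_1 [OF l R]])
  have "cmod (wick_rep l a f k) * R ^ idx_deg TYPE('n) k \<le> (\<Sum>\<^sub>\<infinity>j. cmod (mat_elem l (idx k) (idx j) a * f j)) * R ^ idx_deg TYPE('n) k"
    unfolding wick_rep_def using R by (intro mult_right_mono norm_infsum_bound s1) auto
  also have "\<dots> = (\<Sum>\<^sub>\<infinity>j. cmod (mat_elem l (idx k) (idx j) a * f j) * R ^ idx_deg TYPE('n) k)"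
    by (rule infsum_cmult_left' [symmetric])
  also have "\<dots> \<le> (\<Sum>\<^sub>\<infinity>j. ?c * (cmod (f j) * (growth l * R) ^ idx_deg TYPE('n) j))"
  proof (intro infsum_mono summable_on_cmult_left summable_on_cmult_right s1 s2)
    fix j
    have "cmod (mat_elem l (idx k) (idx j) a) * R ^ idx_deg TYPE('n) k \<le> ?c * (growth l * R) ^ idx_deg TYPE('n) j"
      using mat_elem_bound [OF l R a, of "idx k" "idx j"] by (simp add: idx_deg_def)
    from mult_right_mono [OF this norm_ge_zero [of "f j"]]
    show "cmod (mat_elem l (idx k) (idx j) a * f j) * R ^ idx_deg TYPE('n) k \<le> ?c * (cmod (f j) * (growth l * R) ^ idx_deg TYPE('n) j)"
      by (simp only: norm_mult mult_ac)
  qed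
  also have "\<dots> = (geo_sum TYPE('n + 'n) * (\<Sum>\<^sub>\<infinity>j. cmod (f j) * (growth l * R) ^ idx_deg TYPE('n) j)) * knorm (mat_rad TYPE('n) l R) a"
    unfolding infsum_cmult_right' by simp
  finally show ?thesis .
qed

text \<open>\<open>wick_rep_bound\<close> is uniform in k; taken at the radius 2R it becomes
  summability at R.\<close>

lemma wick_rep_entire_seqs:
  fixes a :: "('n::finite) pt \<Rightarrow> complex"
  assumes l: "l > 0" and a: "a \<in> Adn" and f: "f \<in> entire_seqs TYPE('n)"
  shows "wick_rep l a f \<in> entire_seqs TYPE('n)"
  unfolding entire_seqs_def mem_Collect_eq
proof (intro allI impI)
  fix R :: real assume R: "R \<ge> 1"
  then have R2: "2 * R \<ge> 1" by simp
  define C where "C = (geo_sum TYPE('n + 'n) * (\<Sum>\<^sub>\<infinity>j. cmod (f j) * (growth l * (2 * R)) ^ idx_deg TYPE('n) j)) * knorm (mat_rad TYPE('n) l (2 * R)) a"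
  have "(\<lambda>k. C * (1/2) ^ idx_deg TYPE('n) k) summable_on UNIV" by (intro summable_on_cmult_right geo_sum_idx_deg)
  then show "(\<lambda>k. cmod (wick_rep l a f k) * R ^ idx_deg TYPE('n) k) summable_on UNIV"
  proof (rule summable_on_comparison_test)
    fix k
    have "cmod (wick_rep l a f k) * R ^ idx_deg TYPE('n) k = cmod (wick_rep l a f k) * (2 * R) ^ idx_deg TYPE('n) k * (1/2) ^ idx_deg TYPE('n) k"
      by (simp add: power_mult_distrib power_divide)
    also have "\<dots> \<le> C * (1/2) ^ idx_deg TYPE('n) k"
      unfolding C_def by (intro mult_right_mono wick_rep_bound l R2 a f) auto
    finally show "cmod (wick_rep l a f k) * R ^ idx_deg TYPE('n) k \<le> C * (1/2) ^ idx_deg TYPE('n) k" .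
  qed (use R in auto)
qed

lemma wick_rep_lin:
  fixes a :: "('n::finite) pt \<Rightarrow> complex"
  assumes l: "l > 0" and a: "a \<in> Adn"
  shows "lin_on (entire_seqs TYPE('n)) (wick_rep l a)"
  unfolding lin_on_def
proof (intro conjI ballI allI)
  note s = abs_summable_summable [OF wick_rep_term_summable [OF l a]]
  fix f assume f: "f \<in> entire_seqs TYPE('n)"
  show "wick_rep l a f \<in> entire_seqs TYPE('n)" by (rule wick_rep_entire_seqs [OF l a f])
  show "wick_rep l a (vscale c f) = vscale c (wick_rep l a f)" for c
    unfolding wick_rep_def vscale_def infsum_cmult_right' [symmetric] by (simp only: mult_ac)
  fix g assume g: "g \<in> entire_seqs TYPE('n)"
  show "wick_rep l a (vadd f g) = vadd (wick_rep l a f) (wick_rep l a g)"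
    unfolding wick_rep_def vadd_def distrib_left by (rule ext, rule infsum_add [OF s [OF f] s [OF g]])
qed

lemma wick_rep_unit:
  fixes f :: vec
  assumes l: "l > 0"
  shows "wick_rep l (unitA :: ('n::finite) pt \<Rightarrow> complex) f = f"
proof
  fix k
  have u: "(unitA :: 'n pt \<Rightarrow> complex) = fPQ (\<lambda>_. 0) (\<lambda>_. 0)"
    by (auto simp: unitA_def fPQ_def mpow_def fun_eq_iff)
  have m: "mat_elem l M J (unitA :: 'n pt \<Rightarrow> complex) = (if M = J then 1 else 0)" for M J
    unfolding u using l by (subst mat_elem_fPQ) (auto simp: mon_elem_def mabs_def fun_eq_iff pochhammer_neq_0)
  have "wick_rep l (unitA :: 'n pt \<Rightarrow> complex) f k = (\<Sum>\<^sub>\<infinity>j. (if (idx k :: 'n \<Rightarrow> nat) = idx j then 1 else 0) * f j)"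
    unfolding wick_rep_def m ..
  also have "\<dots> = f k"
    using bij_is_inj [OF bij_idx [where 'n = 'n]] by (subst infsum_single [of k]) (auto dest: injD)
  finally show "wick_rep l (unitA :: 'n pt \<Rightarrow> complex) f k = f k" .
qed

text \<open>After \<open>mat_elem_wick_star\<close> only an exchange of sums remains; the matrix of
  b, estimated at twice the growth rate of that of a, leaves a factor 2^-|K| in the intermediate
  index.\<close>

lemma wick_rep_wick_star:
  fixes a b :: "('n::finite) pt \<Rightarrow> complex"
  assumes h: "h > 0" and a: "a \<in> Adn" and b: "b \<in> Adn" and f: "f \<in> entire_seqs TYPE('n)"
  shows "wick_rep (1 / (2 * h)) (wick_star h a b) f = wick_rep (1 / (2 * h)) a (wick_rep (1 / (2 * h)) b f)"
proof
  fix k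
  define l where "l = 1 / (2 * h)"
  have l: "l > 0" using h by (simp add: l_def)
  define u where "u i = mat_elem l (idx k :: 'n \<Rightarrow> nat) (idx i) a" for i
  define v where "v i j = mat_elem l (idx i :: 'n \<Rightarrow> nat) (idx j) b * f j" for i j
  have "wick_rep l (wick_star h a b) f k = (\<Sum>\<^sub>\<infinity>j. \<Sum>\<^sub>\<infinity>i. u i * v i j)"
    unfolding wick_rep_def
  proof (rule infsum_cong)
    fix j
    have "mat_elem l (idx k) (idx j) (wick_star h a b) = (\<Sum>\<^sub>\<infinity>K. mat_elem l (idx k) K a * mat_elem l K (idx j) b)"
      unfolding l_def by (rule mat_elem_wick_star [OF h a b])
    also have "\<dots> = (\<Sum>\<^sub>\<infinity>i. mat_elem l (idx k) (idx i) a * mat_elem l (idx i) (idx j) b)"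
      by (rule infsum_reindex_bij_betw [OF bij_idx, symmetric])
    finally have X: "mat_elem l (idx k) (idx j) (wick_star h a b) = (\<Sum>\<^sub>\<infinity>i. mat_elem l (idx k) (idx i) a * mat_elem l (idx i) (idx j) b)" .
    show "mat_elem l (idx k) (idx j) (wick_star h a b) * f j = (\<Sum>\<^sub>\<infinity>i. u i * v i j)"
      unfolding X u_def v_def infsum_cmult_left' [symmetric] mult.assoc ..
  qed
  also have "\<dots> = (\<Sum>\<^sub>\<infinity>i. \<Sum>\<^sub>\<infinity>j. u i * v i j)"
  proof (rule infsum_swap_banach)
    let ?A = "growth l" and ?d = "idx_deg TYPE('n)"
    have A: "?A \<ge> 1" by (rule growth(4) [OF l])
    have A2: "2 * ?A \<ge> 1" using A by simp
    let ?sa = "geo_sum TYPE('n + 'n) * knorm (mat_rad TYPE('n) l 1) a" and ?sb = "geo_sum TYPE('n + 'n) * knorm (mat_rad TYPE('n) l (2 * ?A)) b"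
    have bd: "cmod (u i * v i j) \<le> ((?sa * ?sb) * (cmod (f j) * (?A * (2 * ?A)) ^ ?d j)) * (1/2) ^ ?d i" for i j
    proof -
      have X: "cmod (u i) \<le> ?sa * ?A ^ ?d i"
        using mat_elem_bound [OF l order_refl a, of "idx k" "idx i"] unfolding u_def idx_deg_def by simp
      have "cmod (mat_elem l (idx i) (idx j) b) * (2 * ?A) ^ ?d i \<le> ?sb * (?A * (2 * ?A)) ^ ?d j"
        using mat_elem_bound [OF l A2 b, of "idx i" "idx j"] unfolding idx_deg_def .
      from mult_right_mono [OF this norm_ge_zero [of "f j"]]
      have Y: "cmod (v i j) * (2 * ?A) ^ ?d i \<le> ?sb * (cmod (f j) * (?A * (2 * ?A)) ^ ?d j)"
        unfolding v_def norm_mult by (simp only: mult_ac)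
      have "cmod (u i) * (cmod (v i j) * (2 * ?A) ^ ?d i) \<le> (?sa * ?A ^ ?d i) * (?sb * (cmod (f j) * (?A * (2 * ?A)) ^ ?d j))"
        by (rule mult_mono [OF X Y]) (use A in \<open>auto intro!: mult_nonneg_nonneg knorm_nonneg a geo_sum_nonneg\<close>)
      then have "(cmod (u i * v i j) * 2 ^ ?d i) * ?A ^ ?d i \<le> ((?sa * ?sb) * (cmod (f j) * (?A * (2 * ?A)) ^ ?d j)) * ?A ^ ?d i"
        unfolding norm_mult power_mult_distrib [of 2 ?A "?d i"] by (simp only: mult_ac)
      then have "cmod (u i * v i j) * 2 ^ ?d i \<le> (?sa * ?sb) * (cmod (f j) * (?A * (2 * ?A)) ^ ?d j)"
        using A by (subst (asm) mult_le_cancel_right_pos) auto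
      then show ?thesis unfolding power_one_over [of 2 "?d i"]
        by (simp only: pos_le_divide_eq zero_less_power zero_less_numeral times_divide_eq_right mult_1_right)
    qed
    have AA: "?A * (2 * ?A) \<ge> 1" using growth_mult_ge_1 [OF l A2] .
    have s: "(\<lambda>(j, i). ((?sa * ?sb) * (cmod (f j) * (?A * (2 * ?A)) ^ ?d j)) * (1/2) ^ ?d i) summable_on UNIV"
      using A by (intro summable_on_product_real summable_on_cmult_right entire_seqs_D f AA geo_sum_idx_deg mult_nonneg_nonneg geo_sum_nonneg knorm_nonneg a b) auto
    have "(\<lambda>p. cmod (case p of (j, i) \<Rightarrow> u i * v i j)) summable_on UNIV"
      by (rule Infinite_Sum.abs_summable_on_comparison_test' [OF s]) (use bd in \<open>simp add: case_prod_beta'\<close>)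
    from abs_summable_summable [OF this]
    show "(\<lambda>(j, i). u i * v i j) summable_on UNIV \<times> UNIV" by simp
  qed
  also have "\<dots> = wick_rep l a (wick_rep l b f) k"
    unfolding wick_rep_def u_def v_def infsum_cmult_right' ..
  finally show "wick_rep (1 / (2 * h)) (wick_star h a b) f k = wick_rep (1 / (2 * h)) a (wick_rep (1 / (2 * h)) b f) k"
    unfolding l_def .
qed

text \<open>The inner product is made for this symmetry. Matching exponents mean J_j - Q_j = M_j -
  P_j, so M_j! J_j!/(J_j - Q_j)! is symmetric under the exchange, and |P| = |Q| gives Q_0 + |J| =
  P_0 + |M|. With truncation both falling factorials vanish.\<close>

lemma mon_elem_adjoint:
  fixes P Q :: "('n::finite) mi" and M J :: "'n \<Rightarrow> nat"
  assumes l: "l > 0" and PQ: "mabs P = mabs Q"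
  shows "(\<Prod>j\<in>UNIV. fact (M j)) / pochhammer l (sum M UNIV) * mon_elem l Q P M J =
    (\<Prod>j\<in>UNIV. fact (J j)) / pochhammer l (sum J UNIV) * mon_elem l P Q J M"
proof (cases "\<forall>j. M j + Q (Some j) = J j + P (Some j)")
  case True
  have "sum M UNIV + (\<Sum>j\<in>UNIV. Q (Some j)) = sum J UNIV + (\<Sum>j\<in>UNIV. P (Some j))"
    unfolding sum.distrib [symmetric] using True by simp
  then have e: "Q None + sum J UNIV = P None + sum M UNIV" using PQ unfolding mabs_option by linarith
  have f: "fact (M j) * ffall (real (J j)) (Q (Some j)) = fact (J j) * ffall (real (M j)) (P (Some j))" for j
  proof (cases "Q (Some j) \<le> J j")
    case Q: True
    then have "P (Some j) \<le> M j" "M j - P (Some j) = J j - Q (Some j)" using True [rule_format, of j] by linarith+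
    then show ?thesis using Q by (simp add: ffall_nat binomial_fact)
  next
    case False
    then have "J j < Q (Some j)" "M j < P (Some j)" using True [rule_format, of j] by linarith+
    then show ?thesis by (simp add: ffall_eq_0)
  qed
  have F: "(\<Prod>j\<in>UNIV. fact (M j)) * (\<Prod>j\<in>UNIV. ffall (real (J j)) (Q (Some j))) =
      (\<Prod>j\<in>UNIV. fact (J j)) * (\<Prod>j\<in>UNIV. ffall (real (M j)) (P (Some j)))"
    unfolding prod.distrib [symmetric] by (intro prod.cong refl f)
  have T': "\<forall>j. J j + P (Some j) = M j + Q (Some j)" using True by simp
  have alg: "x / m * (p / (q * j) * y) = x' / j * (p / (q * m) * y')" if "x * y = x' * y'"
    for x y x' y' m p q j :: real
  proof -
    have "x / m * (p / (q * j) * y) = (x * y) * (p / (m * q * j))" by (simp add: mult_ac)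
    also have "\<dots> = x' / j * (p / (q * m) * y')" unfolding that by (simp add: mult_ac)
    finally show ?thesis .
  qed
  have r1: "mon_elem l Q P M J = pochhammer l (P None + sum M UNIV) / (pochhammer l (mabs Q) * pochhammer l (sum J UNIV)) *
       (\<Prod>j\<in>UNIV. ffall (real (J j)) (Q (Some j)))"
    unfolding mon_elem_def if_P [OF True] e ..
  have r2: "mon_elem l P Q J M = pochhammer l (P None + sum M UNIV) / (pochhammer l (mabs Q) * pochhammer l (sum M UNIV)) *
       (\<Prod>j\<in>UNIV. ffall (real (M j)) (P (Some j)))"
    unfolding mon_elem_def if_P [OF T'] PQ ..
  show ?thesis unfolding r1 r2 by (rule alg [OF F])
next
  case False
  then have "\<not> (\<forall>j. J j + P (Some j) = M j + Q (Some j))" by metis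
  then have "mon_elem l P Q J M = 0" unfolding mon_elem_def by (rule if_not_P)
  moreover have "mon_elem l Q P M J = 0" unfolding mon_elem_def by (rule if_not_P [OF False])
  ultimately show ?thesis by simp
qed

lemma mat_elem_adjoint:
  fixes a :: "('n::finite) pt \<Rightarrow> complex"
  assumes l: "l > 0" and a: "a \<in> Adn"
  shows "of_real (ip_weight TYPE('n) l k) * mat_elem l (idx k) (idx j) (invol a) =
    of_real (ip_weight TYPE('n) l j) * cnj (mat_elem l (idx j) (idx k) a)"
proof -
  have "mat_elem l (idx k) (idx j) (invol a) =
    (\<Sum>\<^sub>\<infinity>\<alpha>. cnj (coef a (flip \<alpha>)) * of_real (mon_elem l (redQ (flip \<alpha>)) (redP (flip \<alpha>)) (idx k) (idx j)))"
    unfolding mat_elem_def coef_invol [OF a] red_flip ..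
  also have "\<dots> = (\<Sum>\<^sub>\<infinity>\<alpha>. cnj (coef a \<alpha>) * of_real (mon_elem l (redQ \<alpha>) (redP \<alpha>) (idx k) (idx j)))"
    by (rule infsum_reindex_bij_betw [OF bij_flip])
  finally have X: "mat_elem l (idx k) (idx j) (invol a) =
    (\<Sum>\<^sub>\<infinity>\<alpha>. cnj (coef a \<alpha>) * of_real (mon_elem l (redQ \<alpha>) (redP \<alpha>) (idx k) (idx j)))" .
  have "of_real (ip_weight TYPE('n) l k) * mat_elem l (idx k) (idx j) (invol a) =
    (\<Sum>\<^sub>\<infinity>\<alpha>. of_real (ip_weight TYPE('n) l k) * (cnj (coef a \<alpha>) * of_real (mon_elem l (redQ \<alpha>) (redP \<alpha>) (idx k) (idx j))))"
    unfolding X infsum_cmult_right' ..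
  also have "\<dots> = (\<Sum>\<^sub>\<infinity>\<alpha>. cnj (coef a \<alpha>) * of_real (ip_weight TYPE('n) l k * mon_elem l (redQ \<alpha>) (redP \<alpha>) (idx k) (idx j)))"
    by (rule infsum_cong) (simp only: of_real_mult mult_ac)
  also have "\<dots> = (\<Sum>\<^sub>\<infinity>\<alpha>. cnj (coef a \<alpha>) * of_real (ip_weight TYPE('n) l j * mon_elem l (redP \<alpha>) (redQ \<alpha>) (idx j) (idx k)))"
  proof -
    have "ip_weight TYPE('n) l k * mon_elem l (redQ \<alpha>) (redP \<alpha>) (idx k) (idx j) = ip_weight TYPE('n) l j * mon_elem l (redP \<alpha>) (redQ \<alpha>) (idx j) (idx k)" for \<alpha> :: "'n + 'n \<Rightarrow> nat"
      unfolding ip_weight_def idx_deg_def by (rule mon_elem_adjoint [OF l]) (simp add: mabs_red)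
    then show ?thesis by (simp only:)
  qed
  also have "\<dots> = of_real (ip_weight TYPE('n) l j) * cnj (mat_elem l (idx j) (idx k) a)"
    unfolding mat_elem_def infsum_cnj [symmetric] infsum_cmult_right' [symmetric] by (simp add: mult_ac)
  finally show ?thesis .
qed

text \<open>The weighted matrix symmetry is summed over both indices. The exchange of sums is
  justified because the weights and the entries grow at most geometrically against two rapidly
  decreasing vectors.\<close>

lemma wick_rep_adjoint:
  fixes a :: "('n::finite) pt \<Rightarrow> complex"
  assumes l: "l > 0" and a: "a \<in> Adn" and f: "f \<in> entire_seqs TYPE('n)" and g: "g \<in> entire_seqs TYPE('n)"
  shows "entire_ip TYPE('n) l f (wick_rep l (invol a) g) = entire_ip TYPE('n) l (wick_rep l a f) g"
proof -
  let ?w = "\<lambda>k. complex_of_real (ip_weight TYPE('n) l k)"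
  define t where "t k j = cnj (f k) * (?w k * mat_elem l (idx k) (idx j) (invol a)) * g j" for k j
  have t': "t k j = cnj (mat_elem l (idx j) (idx k) a * f k) * g j * ?w j" for k j
    unfolding t_def mat_elem_adjoint [OF l a] by simp
  have "entire_ip TYPE('n) l f (wick_rep l (invol a) g) = (\<Sum>\<^sub>\<infinity>k. \<Sum>\<^sub>\<infinity>j. t k j)"
    unfolding entire_ip_def wick_rep_def t_def infsum_cmult_left' [symmetric] infsum_cmult_right' [symmetric]
    by (simp only: mult_ac)
  also have "\<dots> = (\<Sum>\<^sub>\<infinity>j. \<Sum>\<^sub>\<infinity>k. t k j)"
  proof (rule infsum_swap_banach)
    let ?A = "growth l" and ?d = "idx_deg TYPE('n)"
    have A: "?A \<ge> 1" by (rule growth(4) [OF l])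
    let ?sa = "geo_sum TYPE('n + 'n) * knorm (mat_rad TYPE('n) l 1) (invol a)"
    have bd: "cmod (t k j) \<le> (?sa * (cmod (f k) * ip_weight TYPE('n) l k)) * (cmod (g j) * ?A ^ ?d j)" for k j
    proof -
      have "cmod (mat_elem l (idx k) (idx j) (invol a)) \<le> ?sa * ?A ^ ?d j"
        using mat_elem_bound [OF l order_refl invol_Adn [OF a], of "idx k" "idx j"] unfolding idx_deg_def by simp
      then have "(cmod (f k) * ip_weight TYPE('n) l k * cmod (g j)) * cmod (mat_elem l (idx k) (idx j) (invol a)) \<le>
        (cmod (f k) * ip_weight TYPE('n) l k * cmod (g j)) * (?sa * ?A ^ ?d j)"
        using ip_weight_pos [OF l, of "TYPE('n)" k] by (intro mult_left_mono) auto
      moreover have "cmod (t k j) = (cmod (f k) * ip_weight TYPE('n) l k * cmod (g j)) * cmod (mat_elem l (idx k) (idx j) (invol a))"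
        unfolding t_def using ip_weight_pos [OF l, of "TYPE('n)" k] by (simp add: norm_mult)
      ultimately show ?thesis by (simp only: mult_ac)
    qed
    have s: "(\<lambda>(k, j). (?sa * (cmod (f k) * ip_weight TYPE('n) l k)) * (cmod (g j) * ?A ^ ?d j)) summable_on UNIV"
      using A ip_weight_pos [OF l, of "TYPE('n)"]
      by (intro summable_on_product_real summable_on_cmult_right entire_seqs_D g A entire_seqs_ip_weight_summable l f
        mult_nonneg_nonneg geo_sum_nonneg knorm_nonneg invol_Adn a) (auto intro: less_imp_le)
    have "(\<lambda>p. cmod (case p of (k, j) \<Rightarrow> t k j)) summable_on UNIV"
      by (rule Infinite_Sum.abs_summable_on_comparison_test' [OF s]) (use bd in \<open>simp add: case_prod_beta'\<close>)
    from abs_summable_summable [OF this]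
    show "(\<lambda>(k, j). t k j) summable_on UNIV \<times> UNIV" by simp
  qed
  also have "\<dots> = entire_ip TYPE('n) l (wick_rep l a f) g"
    unfolding entire_ip_def wick_rep_def t' infsum_cnj [symmetric] infsum_cmult_left' [symmetric] ..
  finally show ?thesis .
qed

lemma invol_invol: "invol (invol a) = a"
  by (simp add: invol_def)

text \<open>The compact set can be chosen independently of f and g; only the constant depends on the
  vectors.\<close>

lemma wick_rep_continuous:
  fixes f g :: vec
  assumes l: "l > 0" and f: "f \<in> entire_seqs TYPE('n::finite)" and g: "g \<in> entire_seqs TYPE('n)"
  obtains K C where "compact K" "K \<subseteq> Zhat"
    "\<And>a :: 'n pt \<Rightarrow> complex. a \<in> Adn \<Longrightarrow> cmod (entire_ip TYPE('n) l f (wick_rep l a g)) \<le> C * snorm K a"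
proof
  let ?B = "mat_rad TYPE('n) l 1"
  let ?W = "\<Sum>\<^sub>\<infinity>k. cmod (f k) * ip_weight TYPE('n) l k"
  define G where "G = geo_sum TYPE('n + 'n) * (\<Sum>\<^sub>\<infinity>j. cmod (g j) * (growth l * 1) ^ idx_deg TYPE('n) j)"
  show "compact (KB ?B :: ('n pt \<times> 'n pt) set)" "KB ?B \<subseteq> (Zhat :: ('n pt \<times> 'n pt) set)"
    by (rule compact_KB, rule KB_Zhat)
  fix a :: "'n pt \<Rightarrow> complex" assume a: "a \<in> Adn"
  have rb: "cmod (wick_rep l a g k) \<le> G * knorm ?B a" for k
    using wick_rep_bound [OF l order_refl a g, of k] unfolding G_def by simp
  have s: "(\<lambda>k. cmod (cnj (f k) * wick_rep l a g k * of_real (ip_weight TYPE('n) l k))) summable_on UNIV"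
    by (rule ip_summable [OF l f wick_rep_entire_seqs [OF l a g]])
  have "cmod (entire_ip TYPE('n) l f (wick_rep l a g)) \<le> (\<Sum>\<^sub>\<infinity>k. cmod (cnj (f k) * wick_rep l a g k * of_real (ip_weight TYPE('n) l k)))"
    unfolding entire_ip_def by (rule norm_infsum_bound [OF s])
  also have "\<dots> \<le> (\<Sum>\<^sub>\<infinity>k. (cmod (f k) * ip_weight TYPE('n) l k) * (G * knorm ?B a))"
  proof (intro infsum_mono s summable_on_cmult_left entire_seqs_ip_weight_summable l f)
    fix k
    have "cmod (cnj (f k) * wick_rep l a g k * of_real (ip_weight TYPE('n) l k)) = (cmod (f k) * ip_weight TYPE('n) l k) * cmod (wick_rep l a g k)"
      using ip_weight_pos [OF l, of "TYPE('n)" k] by (simp add: norm_mult)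
    also have "\<dots> \<le> (cmod (f k) * ip_weight TYPE('n) l k) * (G * knorm ?B a)"
      using ip_weight_pos [OF l, of "TYPE('n)" k] by (intro mult_left_mono rb) auto
    finally show "cmod (cnj (f k) * wick_rep l a g k * of_real (ip_weight TYPE('n) l k)) \<le> (cmod (f k) * ip_weight TYPE('n) l k) * (G * knorm ?B a)" .
  qed
  also have "\<dots> = (?W * G) * snorm (KB ?B) a"
    unfolding infsum_cmult_left' knorm_def by simp
  finally show "cmod (entire_ip TYPE('n) l f (wick_rep l a g)) \<le> (?W * G) * snorm (KB ?B) a" .
qed

lemma cont_rep_wick_rep:
  assumes h: "h > 0"
  shows "cont_rep h (entire_seqs TYPE('n::finite)) (entire_ip TYPE('n) (1 / (2 * h)))
    (wick_rep (1 / (2 * h)) :: ('n pt \<Rightarrow> complex) \<Rightarrow> vec \<Rightarrow> vec)"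
proof -
  define l where "l = 1 / (2 * h)"
  have l: "l > 0" using h by (simp add: l_def)
  show ?thesis
    unfolding cont_rep_def l_def [symmetric]
  proof (intro conjI ballI allI)
    show "pre_hilbert (entire_seqs TYPE('n)) (entire_ip TYPE('n) l)" by (rule pre_hilbert_entire_seqs [OF l])
  next
    fix a :: "'n pt \<Rightarrow> complex" assume a: "a \<in> Adn"
    have "entire_ip TYPE('n) l f (wick_rep l a g) = entire_ip TYPE('n) l (wick_rep l (invol a) f) g"
      if "f \<in> entire_seqs TYPE('n)" "g \<in> entire_seqs TYPE('n)" for f g
      using wick_rep_adjoint [OF l invol_Adn [OF a] that] by (simp add: invol_invol)
    then show "adjointable (entire_seqs TYPE('n)) (entire_ip TYPE('n) l) (wick_rep l a)"
      unfolding adjointable_def using wick_rep_lin [OF l a] wick_rep_lin [OF l invol_Adn [OF a]] by blast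
  next
    fix a b :: "'n pt \<Rightarrow> complex" and f assume a: "a \<in> Adn" and b: "b \<in> Adn" and f: "f \<in> entire_seqs TYPE('n)"
    note s = abs_summable_summable [OF wick_rep_term_summable [OF l _ f]]
    show "wick_rep l (\<lambda>r. a r + b r) f = vadd (wick_rep l a f) (wick_rep l b f)"
      unfolding wick_rep_def vadd_def cont_functional_add [OF cont_functional_mat_elem [OF l] a b] distrib_right
      by (rule ext, rule infsum_add [OF s [OF a] s [OF b]])
    show "wick_rep l (star_h h a b) f = wick_rep l a (wick_rep l b f)"
      unfolding star_h_eq_wick_star [OF h a b] unfolding l_def by (rule wick_rep_wick_star [OF h a b f])
  next
    fix c and a :: "'n pt \<Rightarrow> complex" and f assume a: "a \<in> Adn"
    show "wick_rep l (\<lambda>r. c * a r) f = vscale c (wick_rep l a f)"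
      unfolding wick_rep_def vscale_def cont_functional_cmult [OF cont_functional_mat_elem [OF l] a] mult.assoc by (rule ext, rule infsum_cmult_right')
  next
    fix f
    show "wick_rep l (unitA :: 'n pt \<Rightarrow> complex) f = f" by (rule wick_rep_unit [OF l])
  next
    fix a :: "'n pt \<Rightarrow> complex" and f g assume "a \<in> Adn" "f \<in> entire_seqs TYPE('n)" "g \<in> entire_seqs TYPE('n)"
    then show "entire_ip TYPE('n) l f (wick_rep l (invol a) g) = entire_ip TYPE('n) l (wick_rep l a f) g"
      by (rule wick_rep_adjoint [OF l])
  next
    fix f g assume fg: "f \<in> entire_seqs TYPE('n)" "g \<in> entire_seqs TYPE('n)"
    show "\<exists>K C. compact K \<and> K \<subseteq> Zhat \<and>
         (\<forall>a\<in>(Adn :: ('n pt \<Rightarrow> complex) set). cmod (entire_ip TYPE('n) l f (wick_rep l a g)) \<le> C * snorm K a)"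
      by (rule wick_rep_continuous [OF l fg]) (intro exI conjI ballI)
  qed
qed

text \<open>Applied to a unit sequence, the operator returns a column of its matrix, so equal
  operators have equal matrix elements and \<open>Adn_eq_if_mat_elem\<close> applies.\<close>

lemma faithful_wick_rep:
  assumes l: "l > 0"
  shows "faithful_rep (entire_seqs TYPE('n::finite)) (wick_rep l :: ('n pt \<Rightarrow> complex) \<Rightarrow> vec \<Rightarrow> vec)"
  unfolding faithful_rep_def
proof (intro ballI impI)
  fix a b :: "'n pt \<Rightarrow> complex"
  assume a: "a \<in> Adn" and b: "b \<in> Adn" and eq: "\<forall>f\<in>entire_seqs TYPE('n). wick_rep l a f = wick_rep l b f"
  show "a = b"
  proof (rule Adn_eq_if_mat_elem [OF l a b])
    fix M J :: "'n \<Rightarrow> nat"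
    obtain k j where k: "M = idx k" and j: "J = idx j"
      using bij_is_surj [OF bij_idx [where 'n = 'n]] by (metis surjD)
    define e where "e i = (if i = j then 1 else 0 :: complex)" for i
    have "e \<in> entire_seqs TYPE('n)"
      unfolding entire_seqs_def mem_Collect_eq
    proof (intro allI impI)
      fix R :: real
      have "(\<lambda>i. cmod (e i) * R ^ idx_deg TYPE('n) i) summable_on {j}" by (rule summable_on_finite) simp
      then show "(\<lambda>i. cmod (e i) * R ^ idx_deg TYPE('n) i) summable_on UNIV"
        by (rule iffD1 [OF summable_on_cong_neutral, rotated -1]) (auto simp: e_def)
    qed
    then have "wick_rep l a e k = wick_rep l b e k" using eq by simp
    moreover have "wick_rep l c e k = mat_elem l M J c" for c :: "'n pt \<Rightarrow> complex"
      unfolding wick_rep_def k j by (subst infsum_single [of j]) (auto simp: e_def)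
    ultimately show "mat_elem l M J a = mat_elem l M J b" by simp
  qed
qed

subsection \<open>The classical case\<close>

lemma Adn_continuous:
  fixes a :: "('n::finite) pt \<Rightarrow> complex"
  assumes "a \<in> Adn"
  shows "continuous_on Zset a"
proof -
  have "continuous_on Zset (\<lambda>r :: 'n pt. DeltaD r)"
    unfolding DeltaD_def conjv_def by (intro continuous_intros)
  then have "continuous_on Zset (\<lambda>r. lift a (DeltaD r))"
    by (rule continuous_on_compose2 [OF holo_Zhat_continuous [OF holo_lift [OF assms]]]) (auto intro: DeltaD_Zhat)
  then show ?thesis by (rule continuous_on_eq) (simp add: lift_DeltaD [OF assms])
qed

text \<open>A sequence suits the index type of \<open>vec\<close>; density makes restriction to it
  injective on continuous functions.\<close>

lemma dense_sequence:
  obtains x :: "nat \<Rightarrow> ('n::finite) pt" where "range x \<subseteq> Zset" "Zset \<subseteq> closure (range x)"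
proof -
  obtain T :: "'n pt set" where T: "countable T" "T \<subseteq> Zset" "Zset \<subseteq> closure T"
    using separable [of Zset] by blast
  have "(mkpt 1 (\<lambda>_. 0) :: 'n pt) \<in> Zset" by (simp add: Zset_def)
  then have "T \<noteq> {}" using T(3) by auto
  then have "range (from_nat_into T) = T" by (rule range_from_nat_into [OF _ T(1)])
  with T(2,3) show thesis by (intro that [of "from_nat_into T"]) simp_all
qed

text \<open>Elements of the algebra may be unbounded on the disc; finite support is preserved by
  every multiplication, and finitely many points form a compact set, which gives weak
  continuity.\<close>

definition fin_seqs :: "vec set" where "fin_seqs = {f. finite {k. f k \<noteq> 0}}"

definition fin_ip :: "vec \<Rightarrow> vec \<Rightarrow> complex" where
  "fin_ip f g = (\<Sum>k | f k \<noteq> 0. cnj (f k) * g k)"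

definition mult_rep :: "(nat \<Rightarrow> 'p) \<Rightarrow> ('p \<Rightarrow> complex) \<Rightarrow> vec \<Rightarrow> vec" where
  "mult_rep x a f = (\<lambda>k. a (x k) * f k)"

lemma fin_ip_eq:
  assumes "finite S" "\<And>k. k \<notin> S \<Longrightarrow> cnj (f k) * g k = 0" "f \<in> fin_seqs"
  shows "fin_ip f g = (\<Sum>k\<in>S. cnj (f k) * g k)"
proof -
  have "fin_ip f g = (\<Sum>k\<in>S \<union> {k. f k \<noteq> 0}. cnj (f k) * g k)"
    unfolding fin_ip_def using assms by (intro sum.mono_neutral_left) (auto simp: fin_seqs_def)
  also have "\<dots> = (\<Sum>k\<in>S. cnj (f k) * g k)"
    using assms by (intro sum.mono_neutral_right) (auto simp: fin_seqs_def)
  finally show ?thesis .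
qed

lemma fin_seqs_add: "f \<in> fin_seqs \<Longrightarrow> g \<in> fin_seqs \<Longrightarrow> vadd f g \<in> fin_seqs"
  unfolding fin_seqs_def vadd_def mem_Collect_eq
  by (rule finite_subset [of _ "{k. f k \<noteq> 0} \<union> {k. g k \<noteq> 0}"]) auto

lemma fin_seqs_mult: "f \<in> fin_seqs \<Longrightarrow> (\<lambda>k. c k * f k) \<in> fin_seqs"
  unfolding fin_seqs_def mem_Collect_eq by (rule finite_subset [of _ "{k. f k \<noteq> 0}"]) auto

lemma pre_hilbert_fin_seqs: "pre_hilbert fin_seqs fin_ip"
  unfolding pre_hilbert_def
proof (intro conjI ballI allI impI)
  show "(\<lambda>n. 0) \<in> fin_seqs" by (simp add: fin_seqs_def)
  fix f g assume f: "f \<in> fin_seqs" and g: "g \<in> fin_seqs"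
  show "vadd f g \<in> fin_seqs" by (rule fin_seqs_add [OF f g])
  show "fin_ip f (vscale c g) = c * fin_ip f g" for c
    unfolding fin_ip_def vscale_def sum_distrib_left by (simp only: mult_ac)
  show "fin_ip f g = cnj (fin_ip g f)"
  proof -
    have "fin_ip f g = (\<Sum>k | g k \<noteq> 0. cnj (f k) * g k)"
      using g by (intro fin_ip_eq f) (auto simp: fin_seqs_def)
    then show ?thesis unfolding fin_ip_def by (simp add: mult.commute)
  qed
  show "fin_ip f (vadd g k) = fin_ip f g + fin_ip f k" for k
    unfolding fin_ip_def vadd_def by (simp add: distrib_left sum.distrib)
next
  fix c f assume "f \<in> fin_seqs"
  then show "vscale c f \<in> fin_seqs" unfolding vscale_def by (rule fin_seqs_mult)
next
  fix f assume f: "f \<in> fin_seqs"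
  have e: "fin_ip f f = of_real (\<Sum>k | f k \<noteq> 0. (cmod (f k))\<^sup>2)"
    unfolding fin_ip_def of_real_sum by (intro sum.cong refl) (simp add: complex_norm_square mult.commute del: of_real_power)
  show "0 \<le> Re (fin_ip f f)" unfolding e by (simp add: sum_nonneg)
  assume "fin_ip f f = 0"
  then have "(\<Sum>k | f k \<noteq> 0. (cmod (f k))\<^sup>2) = 0" unfolding e of_real_eq_0_iff .
  then have "\<forall>k\<in>{k. f k \<noteq> 0}. (cmod (f k))\<^sup>2 = 0"
    using f by (subst (asm) sum_nonneg_eq_0_iff) (auto simp: fin_seqs_def)
  then show "f = (\<lambda>n. 0)" by auto
qed

lemma mult_rep_lin: "lin_on fin_seqs (mult_rep x a)"
  unfolding lin_on_def mult_rep_def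
  by (intro conjI ballI allI fin_seqs_mult) (auto simp: vadd_def vscale_def algebra_simps)

lemma mult_rep_adjoint:
  assumes "f \<in> fin_seqs"
  shows "fin_ip f (mult_rep x (\<lambda>r. cnj (a r)) g) = fin_ip (mult_rep x a f) g"
proof -
  have "fin_ip (mult_rep x a f) g = (\<Sum>k | f k \<noteq> 0. cnj (mult_rep x a f k) * g k)"
    using assms fin_seqs_mult [OF assms, of "\<lambda>k. a (x k)"] by (intro fin_ip_eq) (auto simp: fin_seqs_def mult_rep_def)
  then show ?thesis unfolding fin_ip_def mult_rep_def by (simp add: mult_ac)
qed

lemma cont_rep_mult_rep:
  fixes x :: "nat \<Rightarrow> ('n::finite) pt"
  assumes x: "range x \<subseteq> Zset"
  shows "cont_rep 0 fin_seqs fin_ip (mult_rep x)"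
  unfolding cont_rep_def
proof (intro conjI ballI allI)
  show "pre_hilbert fin_seqs fin_ip" by (rule pre_hilbert_fin_seqs)
next
  fix a :: "'n pt \<Rightarrow> complex"
  have "\<forall>f\<in>fin_seqs. \<forall>g\<in>fin_seqs. fin_ip f (mult_rep x a g) = fin_ip (mult_rep x (\<lambda>r. cnj (a r)) f) g"
    using mult_rep_adjoint [where a = "\<lambda>r. cnj (a r)"] by simp
  then show "adjointable fin_seqs fin_ip (mult_rep x a)"
    unfolding adjointable_def using mult_rep_lin by blast
next
  fix f g assume f: "f \<in> fin_seqs" and g: "g \<in> fin_seqs"
  let ?S = "{k. f k \<noteq> 0}"
  let ?K = "DeltaD ` x ` ?S"
  have fS: "finite ?S" using f by (simp add: fin_seqs_def)
  have xZ: "x k \<in> Zset" for k using x by blast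
  have K1: "compact ?K" by (intro finite_imp_compact finite_imageI fS)
  have K2: "?K \<subseteq> Zhat" using DeltaD_Zhat [OF xZ] by blast
  note K = K1 K2
  show "\<exists>K C. compact K \<and> K \<subseteq> Zhat \<and> (\<forall>a\<in>Adn. cmod (fin_ip f (mult_rep x a g)) \<le> C * snorm K a)"
  proof (intro exI conjI ballI)
    fix a :: "'n pt \<Rightarrow> complex" assume a: "a \<in> Adn"
    have "cmod (fin_ip f (mult_rep x a g)) \<le> (\<Sum>k\<in>?S. cmod (f k) * cmod (g k) * snorm ?K a)"
      unfolding fin_ip_def
    proof (rule sum_norm_le)
      fix k assume k: "k \<in> ?S"
      have "cmod (lift a (DeltaD (x k))) \<le> snorm ?K a" by (rule snorm_ge [OF a K]) (use k in auto)
      then have "cmod (a (x k)) \<le> snorm ?K a" unfolding lift_DeltaD [OF a xZ] .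
      from mult_left_mono [OF this, of "cmod (f k) * cmod (g k)"]
      show "cmod (cnj (f k) * mult_rep x a g k) \<le> cmod (f k) * cmod (g k) * snorm ?K a"
        by (simp add: mult_rep_def norm_mult mult_ac)
    qed
    then show "cmod (fin_ip f (mult_rep x a g)) \<le> (\<Sum>k\<in>?S. cmod (f k) * cmod (g k)) * snorm ?K a"
      unfolding sum_distrib_right .
  qed (rule K)+
next
  fix f
  show "mult_rep x unitA f = f" using x by (auto simp: mult_rep_def unitA_def fun_eq_iff)
next
  fix a :: "'n pt \<Rightarrow> complex" and f g assume "f \<in> fin_seqs"
  then show "fin_ip f (mult_rep x (invol a) g) = fin_ip (mult_rep x a f) g"
    unfolding invol_def by (rule mult_rep_adjoint)
qed (simp_all add: mult_rep_def vadd_def vscale_def star_h_def algebra_simps)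

lemma faithful_mult_rep:
  fixes x :: "nat \<Rightarrow> ('n::finite) pt"
  assumes x: "range x \<subseteq> Zset" "Zset \<subseteq> closure (range x)"
  shows "faithful_rep fin_seqs (mult_rep x)"
  unfolding faithful_rep_def
proof (intro ballI impI ext)
  fix a b :: "'n pt \<Rightarrow> complex" and r
  assume a: "a \<in> Adn" and b: "b \<in> Adn" and eq: "\<forall>f\<in>fin_seqs. mult_rep x a f = mult_rep x b f"
  have ab: "a (x k) = b (x k)" for k
  proof -
    define e where "e i = (if i = k then 1 else 0 :: complex)" for i
    have "e \<in> fin_seqs" by (simp add: fin_seqs_def e_def)
    then have "mult_rep x a e k = mult_rep x b e k" using eq by simp
    then show ?thesis by (simp add: mult_rep_def e_def)
  qed
  show "a r = b r"
  proof (cases "r \<in> Zset")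
    case True
    then obtain t where t: "\<And>n. t n \<in> range x" "t \<longlonglongrightarrow> r"
      using x(2) unfolding closure_sequential by (metis (no_types, lifting) mem_Collect_eq subsetD closure_sequential)
    have tZ: "\<forall>\<^sub>F n in sequentially. t n \<in> Zset" using t(1) x(1) by (auto intro: always_eventually)
    have "(\<lambda>n. a (t n)) \<longlonglongrightarrow> a r" "(\<lambda>n. b (t n)) \<longlonglongrightarrow> b r"
      by (rule continuous_on_tendsto_compose [OF Adn_continuous t(2) True tZ]; fact)+
    moreover have "a (t n) = b (t n)" for n using t(1) [of n] ab by auto
    ultimately show ?thesis using LIMSEQ_unique by simp
  next
    case False
    then show ?thesis by (simp add: Adn_outside [OF a] Adn_outside [OF b])
  qed
qed

theorem theorem4p14:
  fixes h :: real
  assumes "h \<ge> 0"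
  shows "\<exists>V ip (rho :: (('n::finite) pt \<Rightarrow> complex) \<Rightarrow> vec \<Rightarrow> vec).
           cont_rep h V ip rho \<and> faithful_rep V rho"
proof (cases "h = 0")
  case True
  obtain x :: "nat \<Rightarrow> 'n pt" where x: "range x \<subseteq> Zset" "Zset \<subseteq> closure (range x)"
    using dense_sequence by blast
  then show ?thesis using cont_rep_mult_rep [OF x(1)] faithful_mult_rep [OF x] True by blast
next
  case False
  then have h: "h > 0" using assms by simp
  then have "1 / (2 * h) > 0" by simp
  from cont_rep_wick_rep [OF h] faithful_wick_rep [OF this] show ?thesis by blast
qed

end
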